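(* Consider the variant of the firefighter process in which $4$ firefighters are available at the first step and $3$ firefighters at each subsequent step. Then for every planar graph $G$ with at least two vertices, $\frac{1}{n^2}\sum_{v\in V(G)} s(G,v)\ge 1/2712$, where $n=|V(G)|$ and $s(G,v)$ is the maximum number of vertices of $G$ that can be saved in this variant when the fire starts at $v$.
   Context: Firefighter process (variant): in a finite simple graph $G$, a fire starts at time $0$ at a vertex $v$. At time step $1$ the firefighters protect at most $4$ non-burning vertices, and at each later time step they protect at most $3$ non-burning vertices (protection is permanent); after the protection in each step, the fire spreads from every burning vertex to all its unprotected neighbours. A vertex is saved if it never burns. The quantity $\frac{1}{n^2}\sum_{v} s(G,v)$ is the surviving rate of $G$ in this variant. *)

theory Defs
  imports "HOL-Analysis.Analysis"
begin

definition simple_graph :: "'a set \<Rightarrow> ('a \<Rightarrow> 'a \<Rightarrow> bool) \<Rightarrow> bool" where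
  "simple_graph V E \<longleftrightarrow> finite V \<and> (\<forall>u w. E u w \<longrightarrow> u \<in> V \<and> w \<in> V)
     \<and> (\<forall>u w. E u w \<longrightarrow> E w u) \<and> (\<forall>u. \<not> E u u)"

definition planar :: "'a set \<Rightarrow> ('a \<Rightarrow> 'a \<Rightarrow> bool) \<Rightarrow> bool" where
  "planar V E \<longleftrightarrow> (\<exists>(p :: 'a \<Rightarrow> complex) (\<gamma> :: 'a \<Rightarrow> 'a \<Rightarrow> real \<Rightarrow> complex).
     inj_on p V \<and>
     (\<forall>u w. E u w \<longrightarrow> arc (\<gamma> u w) \<and> pathstart (\<gamma> u w) = p u \<and> pathfinish (\<gamma> u w) = p w
        \<and> path_image (\<gamma> u w) \<inter> p ` V = {p u, p w}) \<and>
     (\<forall>u w x y. E u w \<longrightarrow> E x y \<longrightarrow> {u, w} \<noteq> {x, y} \<longrightarrow>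
        path_image (\<gamma> u w) \<inter> path_image (\<gamma> x y) \<subseteq> p ` ({u, w} \<inter> {x, y})))"

definition budget :: "nat \<Rightarrow> nat" where
  "budget t = (if t = 1 then 4 else 3)"

text \<open>P t is the set of vertices protected at time step t (t \<ge> 1; P 0 is ignored).\<close>
definition protected_upto :: "(nat \<Rightarrow> 'a set) \<Rightarrow> nat \<Rightarrow> 'a set" where
  "protected_upto P t = (\<Union>i\<in>{1..t}. P i)"

fun burning :: "'a set \<Rightarrow> ('a \<Rightarrow> 'a \<Rightarrow> bool) \<Rightarrow> 'a \<Rightarrow> (nat \<Rightarrow> 'a set) \<Rightarrow> nat \<Rightarrow> 'a set" where
  "burning V E v P 0 = {v}"
| "burning V E v P (Suc t) = burning V E v P t \<union>
     {u \<in> V. u \<notin> protected_upto P (Suc t) \<and> (\<exists>w \<in> burning V E v P t. E w u)}"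

definition valid_strategy :: "'a set \<Rightarrow> ('a \<Rightarrow> 'a \<Rightarrow> bool) \<Rightarrow> 'a \<Rightarrow> (nat \<Rightarrow> 'a set) \<Rightarrow> bool" where
  "valid_strategy V E v P \<longleftrightarrow> (\<forall>t\<ge>1. P t \<subseteq> V - burning V E v P (t - 1) \<and> card (P t) \<le> budget t)"

definition saved :: "'a set \<Rightarrow> ('a \<Rightarrow> 'a \<Rightarrow> bool) \<Rightarrow> 'a \<Rightarrow> (nat \<Rightarrow> 'a set) \<Rightarrow> 'a set" where
  "saved V E v P = V - (\<Union>t. burning V E v P t)"

definition num_saved :: "'a set \<Rightarrow> ('a \<Rightarrow> 'a \<Rightarrow> bool) \<Rightarrow> 'a \<Rightarrow> nat" where
  "num_saved V E v = Max {card (saved V E v P) | P. valid_strategy V E v P}"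

definition surviving_rate :: "'a set \<Rightarrow> ('a \<Rightarrow> 'a \<Rightarrow> bool) \<Rightarrow> real" where
  "surviving_rate V E = (\<Sum>v\<in>V. real (num_saved V E v)) / (real (card V))^2"

end

theory Submission
  imports Defs
begin

text \<open>By Euler's formula a seventh of the vertices have degree at most 6; it suffices that a fire starting
  at such a vertex v can be kept away from about an eighth of the graph. Let H be a maximal subgraph
  through v that is built from a cycle by adding ears; the rest of the graph hangs on single vertices
  of H. In a breadth-first tree of H rooted at v, two firefighters per step protect two root paths
  before the fire gets there. If the two paths end on a common face, they separate H into two sides,
  and since at least one of the at most 6 neighbours of v lies on the paths, one side contains at
  most 2 further neighbours of v. Protecting these in the first step as well saves that side. A
  Lipton-Tarjan argument yields two paths such that both sides are large.

  The facial structure of H comes from the drawing: an ear lies in one face, which the theta curve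
  lemma splits in two. Everything else uses only the incidences of faces, edges and vertices.\<close>

section \<open>Arcs and closed curves in the plane\<close>

text \<open>Graphs built by ears are used because all their faces are bounded by cycles: a face can
  be a list of distinct vertices, and its region is one side of a Jordan curve. What lies beyond a
  cut vertex enters only as a weight of the vertex on which it hangs.

  A separator made of root paths needs these paths to be light, which in the classical setting
  follows from a small radius. Here it follows from the game: a root path can itself be protected,
  so if fewer than \<open>k\<close> vertices can be saved, every root path weighs less than
  \<open>k\<close>. This is why the main estimate is by contradiction.

  Faces are not triangulated. In place of a triangle inside the smallest heavy cycle there is a face
  of any length, and the end of the second path is moved along its boundary; the separating curve is
  closed through this face.

  Regions are replaced by sets of faces, added over the two-element field, so that sides of closed
  curves are handled by linear algebra and parity.

  For large graphs the resulting rate is \<open>1 / 112\<close>. Small graphs are settled by saving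
  a single vertex, and 2712 leaves ample room between the two cases.\<close>

definition arc_between :: "complex set \<Rightarrow> complex \<Rightarrow> complex \<Rightarrow> bool" where
  "arc_between K a b \<longleftrightarrow> (\<exists>g. arc g \<and> pathstart g = a \<and> pathfinish g = b \<and> path_image g = K)"

definition jordan_curve :: "complex set \<Rightarrow> bool" where
  "jordan_curve C \<longleftrightarrow> (\<exists>g. simple_path g \<and> pathfinish g = pathstart g \<and> path_image g = C)"

lemma arc_between_commute: "arc_between K a b \<Longrightarrow> arc_between K b a"
  unfolding arc_between_def
  by (metis arc_reversepath path_image_reversepath pathfinish_reversepath pathstart_reversepath)

lemma arc_between_facts:
  assumes "arc_between K a b"
  shows "a \<noteq> b" "compact K" "connected K" "a \<in> K" "b \<in> K"
    "connected (K - {a,b})" "K - {a,b} \<noteq> {}" "K \<subseteq> closure (K - {a,b})"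
proof -
  obtain g where g: "arc g" "pathstart g = a" "pathfinish g = b" "path_image g = K"
    using assms unfolding arc_between_def by blast
  show "a \<noteq> b" using arc_distinct_ends g by blast
  show "compact K" "connected K" using g compact_arc_image connected_arc_image by blast+
  show "a \<in> K" "b \<in> K" using g by auto
  have sp: "simple_path g" using g arc_imp_simple_path by blast
  show "connected (K - {a,b})" "K - {a,b} \<noteq> {}"
    using connected_simple_path_endless[OF sp] nonempty_simple_path_endless[OF sp] g by auto
  have e: "K - {a,b} = g ` {0<..<1}"
    using simple_path_endless[OF sp] g by auto
  have "g ` closure {0<..<1} \<subseteq> closure (g ` {0<..<1})"
    using g(1) by (intro image_closure_subset) (auto simp: arc_def path_def closure_subset)
  then show "K \<subseteq> closure (K - {a,b})"
    unfolding e using g(4) by (auto simp: path_image_def)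
qed

lemma jordan_curve_arcs:
  assumes "arc_between K a b" "arc_between L a b" "K \<inter> L = {a,b}"
  shows "jordan_curve (K \<union> L)"
proof -
  obtain g where g: "arc g" "pathstart g = a" "pathfinish g = b" "path_image g = K"
    using assms unfolding arc_between_def by blast
  obtain h where h: "arc h" "pathstart h = b" "pathfinish h = a" "path_image h = L"
    using arc_between_commute[OF assms(2)] unfolding arc_between_def by blast
  have "simple_path (g +++ h)"
    using g h assms(3) by (intro simple_path_join_loop) auto
  moreover have "path_image (g +++ h) = K \<union> L"
    using g h by (simp add: path_image_join)
  ultimately show ?thesis
    unfolding jordan_curve_def using g h by (metis pathfinish_join pathstart_join)
qed

lemma jordan_curve_facts:
  assumes "jordan_curve C"
  shows "open (inside C)" "connected (inside C)" "inside C \<noteq> {}" "bounded (inside C)"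
    "open (outside C)" "connected (outside C)" "outside C \<noteq> {}" "\<not> bounded (outside C)"
    "inside C \<inter> outside C = {}" "inside C \<union> outside C = - C"
    "frontier (inside C) = C" "frontier (outside C) = C"
  using assms Jordan_inside_outside unfolding jordan_curve_def by blast+

lemma theta_inside:
  assumes "arc_between K a b" "arc_between L a b" "arc_between M a b"
    and "K \<inter> L = {a,b}" "K \<inter> M = {a,b}" "L \<inter> M = {a,b}"
    and "M \<inter> inside (K \<union> L) \<noteq> {}"
  shows "inside (K \<union> M) \<inter> inside (L \<union> M) = {}"
    "inside (K \<union> M) \<union> inside (L \<union> M) \<union> (M - {a,b}) = inside (K \<union> L)"
proof -
  obtain k where k: "simple_path k" "pathstart k = a" "pathfinish k = b" "path_image k = K"
    using assms unfolding arc_between_def using arc_imp_simple_path by blast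
  obtain l where l: "simple_path l" "pathstart l = a" "pathfinish l = b" "path_image l = L"
    using assms unfolding arc_between_def using arc_imp_simple_path by blast
  obtain m where m: "simple_path m" "pathstart m = a" "pathfinish m = b" "path_image m = M"
    using assms unfolding arc_between_def using arc_imp_simple_path by blast
  have "a \<noteq> b" using assms(1) arc_between_facts by blast
  then show "inside (K \<union> M) \<inter> inside (L \<union> M) = {}"
    "inside (K \<union> M) \<union> inside (L \<union> M) \<union> (M - {a,b}) = inside (K \<union> L)"
    using split_inside_simple_closed_curve[OF k(1-3) l(1-3) m(1-3)] assms(4-7) k l m by auto
qed

text \<open>Otherwise \<open>x\<close> could be joined to a far point off
  \<open>K \<union> M\<close> and also off \<open>L \<union> M\<close>. These two sets meet in the
  connected arc \<open>M\<close>, so by Janiszewski's theorem the points would be joined off the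
  whole theta curve, although \<open>K \<union> L\<close> separates them.\<close>

lemma theta_point:
  assumes arcs: "arc_between K a b" "arc_between L a b" "arc_between M a b"
    and int: "K \<inter> L = {a,b}" "K \<inter> M = {a,b}" "L \<inter> M = {a,b}"
    and x: "x \<in> inside (K \<union> L)" "x \<in> outside (K \<union> M)" "x \<in> outside (L \<union> M)"
  shows False
proof -
  have j: "jordan_curve (K \<union> L)" "jordan_curve (K \<union> M)" "jordan_curve (L \<union> M)"
    using jordan_curve_arcs arcs int by blast+
  have comp: "compact K" "compact L" "compact M" "connected M"
    using arcs arc_between_facts by blast+
  have bd: "bounded (inside (K \<union> L) \<union> inside (K \<union> M) \<union> inside (L \<union> M) \<union> K \<union> L \<union> M)"
    using j jordan_curve_facts(4) comp by (simp add: compact_imp_bounded)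
  then obtain y where y: "y \<notin> inside (K \<union> L) \<union> inside (K \<union> M) \<union> inside (L \<union> M) \<union> K \<union> L \<union> M"
    using not_bounded_UNIV by (metis UNIV_eq_I)
  then have yo: "y \<in> outside (K \<union> L)" "y \<in> outside (K \<union> M)" "y \<in> outside (L \<union> M)"
    using jordan_curve_facts(10)[OF j(1)] jordan_curve_facts(10)[OF j(2)]
      jordan_curve_facts(10)[OF j(3)] by blast+
  have "connected_component (- ((K \<union> M) \<union> (L \<union> M))) x y"
  proof (rule Janiszewski)
    show "compact (K \<union> M)" "closed (L \<union> M)"
      using comp by (auto simp: compact_imp_closed)
    have "(K \<union> M) \<inter> (L \<union> M) = M"
      using int arc_between_facts(4,5)[OF arcs(3)] by blast
    then show "connected ((K \<union> M) \<inter> (L \<union> M))" using comp by simp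
    show "connected_component (- (K \<union> M)) x y"
      unfolding connected_component_def
      using jordan_curve_facts(6,10)[OF j(2)] x yo by blast
    show "connected_component (- (L \<union> M)) x y"
      unfolding connected_component_def
      using jordan_curve_facts(6,10)[OF j(3)] x yo by blast
  qed
  then obtain T where T: "connected T" "T \<subseteq> - (K \<union> M \<union> (L \<union> M))" "x \<in> T" "y \<in> T"
    unfolding connected_component_def by blast
  have "T \<inter> frontier (inside (K \<union> L)) \<noteq> {}"
    using T x y by (intro connected_Int_frontier) auto
  then show False using T jordan_curve_facts(11)[OF j(1)] by auto
qed

text \<open>The arcs exchange roles: \<open>L\<close> turns out to be a chord inside
  \<open>K \<union> M\<close>, so \<open>theta_inside\<close> applies to that curve, and the outside
  is recovered by complements. The common inner point \<open>x\<close> decides that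
  \<open>L\<close>, and not \<open>K\<close>, is the arc swallowed.\<close>

lemma theta_outside:
  assumes arcs: "arc_between K a b" "arc_between L a b" "arc_between M a b"
    and int: "K \<inter> L = {a,b}" "K \<inter> M = {a,b}" "L \<inter> M = {a,b}"
    and M: "M - {a,b} \<subseteq> outside (K \<union> L)"
    and x: "x \<in> inside (K \<union> L)" "x \<in> inside (K \<union> M)"
  shows "outside (K \<union> M) \<inter> inside (L \<union> M) = {}"
    "outside (K \<union> M) \<union> inside (L \<union> M) = outside (K \<union> L) - M"
proof -
  have j: "jordan_curve (K \<union> L)" "jordan_curve (K \<union> M)" "jordan_curve (L \<union> M)"
    using jordan_curve_arcs arcs int by blast+
  \<comment> \<open>If \<open>L\<close> missed \<open>inside (K \<union> M)\<close>, this connected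
    set would meet \<open>inside (K \<union> L)\<close> without crossing
    \<open>K \<union> L\<close>, hence lie in it, and \<open>M\<close> would lie in its closure,
    although the open arc is outside.\<close>
  have "L \<inter> inside (K \<union> M) \<noteq> {}"
  proof
    assume L: "L \<inter> inside (K \<union> M) = {}"
    have dis: "inside (K \<union> M) \<inter> (K \<union> L) = {}"
      using L jordan_curve_facts(10)[OF j(2)] by blast
    have sub: "inside (K \<union> M) \<subseteq> inside (K \<union> L)"
    proof (rule ccontr)
      assume "\<not> ?thesis"
      then have "inside (K \<union> M) \<inter> frontier (inside (K \<union> L)) \<noteq> {}"
        using x jordan_curve_facts(2)[OF j(2)] by (intro connected_Int_frontier) auto
      then show False using dis jordan_curve_facts(11)[OF j(1)] by auto
    qed
    have "M \<subseteq> closure (inside (K \<union> M))"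
      using jordan_curve_facts(11)[OF j(2)] by (auto simp: frontier_def)
    also have "\<dots> \<subseteq> closure (inside (K \<union> L))" using sub closure_mono by blast
    also have "\<dots> \<subseteq> inside (K \<union> L) \<union> (K \<union> L)"
      using jordan_curve_facts(11)[OF j(1)] closure_Un_frontier by blast
    finally have "M - {a,b} = {}"
      using M jordan_curve_facts(9,10)[OF j(1)] by blast
    then show False using arc_between_facts(7)[OF arcs(3)] by blast
  qed
  then have s: "inside (K \<union> L) \<inter> inside (M \<union> L) = {}"
    "inside (K \<union> L) \<union> inside (M \<union> L) \<union> (L - {a,b}) = inside (K \<union> M)"
    using theta_inside[OF arcs(1) arcs(3) arcs(2)] int by (auto simp: Int_commute)
  have "M \<union> L = L \<union> M" by blast
  note s = s[unfolded this]
  show "outside (K \<union> M) \<inter> inside (L \<union> M) = {}"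
    using s jordan_curve_facts(9)[OF j(2)] by blast
  have ab: "a \<in> K" "b \<in> K" "a \<in> L" "b \<in> L" "a \<in> M" "b \<in> M"
    using arcs arc_between_facts by blast+
  show "outside (K \<union> M) \<union> inside (L \<union> M) = outside (K \<union> L) - M"
  proof (intro set_eqI)
    fix z
    have out: "z \<in> outside C \<longleftrightarrow> z \<notin> C \<and> z \<notin> inside C" if "jordan_curve C" for C
      using jordan_curve_facts(9,10)[OF that] by blast
    show "z \<in> outside (K \<union> M) \<union> inside (L \<union> M) \<longleftrightarrow> z \<in> outside (K \<union> L) - M"
    proof (cases "z = a \<or> z = b")
      case True
      then show ?thesis using ab out[OF j(2)] jordan_curve_facts(10)[OF j(3)] by blast
    next
      case False
      have "z \<in> K \<and> z \<in> L \<longleftrightarrow> False" "z \<in> K \<and> z \<in> M \<longleftrightarrow> False" "z \<in> L \<and> z \<in> M \<longleftrightarrow> False"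
        using int False by blast+
      moreover have "z \<in> inside (K \<union> L) \<and> z \<in> inside (L \<union> M) \<longleftrightarrow> False"
        "z \<in> inside (K \<union> L) \<or> z \<in> inside (L \<union> M) \<or> z \<in> L \<longleftrightarrow> z \<in> inside (K \<union> M)"
        using s False by blast+
      moreover have "z \<in> inside (L \<union> M) \<Longrightarrow> z \<notin> L \<and> z \<notin> M" "z \<in> inside (K \<union> L) \<Longrightarrow> z \<notin> K"
        "z \<in> inside (K \<union> M) \<Longrightarrow> z \<notin> K \<and> z \<notin> M"
        using jordan_curve_facts(10)[OF j(3)] jordan_curve_facts(10)[OF j(1)]
          jordan_curve_facts(10)[OF j(2)] by blast+
      ultimately show ?thesis
        unfolding Un_iff Diff_iff out[OF j(1)] out[OF j(2)] by argo
    qed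
  qed
qed

text \<open>A face is known only as one side of its boundary curve. Whichever side \<open>R\<close>
  is, both halves are again sides of the two new curves, so the unbounded face needs no separate
  treatment later.\<close>

lemma theta_split:
  assumes arcs: "arc_between K a b" "arc_between L a b" "arc_between M a b"
    and int: "K \<inter> L = {a,b}" "K \<inter> M = {a,b}" "L \<inter> M = {a,b}"
    and R: "R \<in> {inside (K \<union> L), outside (K \<union> L)}" and M: "M - {a,b} \<subseteq> R"
  obtains R1 R2 where "R1 \<in> {inside (K \<union> M), outside (K \<union> M)}"
    "R2 \<in> {inside (L \<union> M), outside (L \<union> M)}" "R1 \<inter> R2 = {}" "R1 \<union> R2 = R - M"
proof (cases "R = inside (K \<union> L)")
  case True
  have j: "jordan_curve (K \<union> L)" "jordan_curve (K \<union> M)" "jordan_curve (L \<union> M)"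
    using jordan_curve_arcs arcs int by blast+
  have "M \<inter> inside (K \<union> L) \<noteq> {}"
    using True M arc_between_facts(7)[OF arcs(3)] by blast
  note t = theta_inside[OF arcs int this]
  have "inside (K \<union> M) \<union> inside (L \<union> M) = R - M"
    using t True jordan_curve_facts(10)[OF j(2)] jordan_curve_facts(10)[OF j(3)]
      jordan_curve_facts(10)[OF j(1)] arc_between_facts(4,5)[OF arcs(1)] by blast
  then show ?thesis using t that by blast
next
  case False
  then have R': "R = outside (K \<union> L)" using R by blast
  have j: "jordan_curve (K \<union> L)" "jordan_curve (K \<union> M)" "jordan_curve (L \<union> M)"
    using jordan_curve_arcs arcs int by blast+
  \<comment> \<open>By \<open>theta_point\<close> a point inside \<open>K \<union> L\<close> lies
    inside one of the new curves. That curve contributes its outside as the unbounded half, and the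
    other curve contributes its inside.\<close>
  have "open (inside (K \<union> L))" "inside (K \<union> L) \<noteq> {}" using jordan_curve_facts j by blast+
  then obtain x where x: "x \<in> inside (K \<union> L)" by blast
  have "x \<notin> K \<union> L \<union> M"
    using x M R' jordan_curve_facts(9,10)[OF j(1)] arc_between_facts(4,5)[OF arcs(1)] by blast
  then have "x \<in> inside (K \<union> M) \<or> x \<in> inside (L \<union> M)"
    using theta_point[OF arcs int x] jordan_curve_facts(10)[OF j(2)] jordan_curve_facts(10)[OF j(3)]
    by blast
  then show ?thesis
  proof
    assume "x \<in> inside (K \<union> M)"
    then show ?thesis
      using theta_outside[OF arcs int M[unfolded R'] x] that R' by blast
  next
    assume a: "x \<in> inside (L \<union> M)"
    have e: "L \<union> K = K \<union> L" by blast
    show ?thesis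
      using theta_outside[OF arcs(2,1,3) _ int(3,2), unfolded e, OF _ M[unfolded R'] x a]
        that[of "inside (K \<union> M)" "outside (L \<union> M)"] int(1) R' by (auto simp: Int_commute Un_commute)
  qed
qed

section \<open>Paths and cycles as edge sets\<close>

fun path_edges :: "'a list \<Rightarrow> 'a set set" where
  "path_edges [] = {}"
| "path_edges [x] = {}"
| "path_edges (x # y # zs) = insert {x, y} (path_edges (y # zs))"

definition cycle_edges :: "'a list \<Rightarrow> 'a set set" where
  "cycle_edges f = path_edges (f @ [hd f])"

definition edge_degree :: "'a set set \<Rightarrow> 'a \<Rightarrow> nat" where
  "edge_degree Z w = card {e \<in> Z. w \<in> e}"

text \<open>Taking all even edge sets instead of single cycles keeps the class closed under
  \<open>sym_diff\<close>, the addition of the cycle space over the two-element field.\<close>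

definition even_graph :: "'a set set \<Rightarrow> bool" where
  "even_graph Z \<longleftrightarrow> finite Z \<and> (\<forall>w. even (edge_degree Z w))"

lemma finite_path_edges [simp]: "finite (path_edges xs)"
  by (induction xs rule: path_edges.induct) auto

lemma path_edges_append: "path_edges (xs @ y # ys) = path_edges (xs @ [y]) \<union> path_edges (y # ys)"
  by (induction xs rule: path_edges.induct) auto

lemma path_edges_snoc: "xs \<noteq> [] \<Longrightarrow> path_edges (xs @ [x]) = insert {last xs, x} (path_edges xs)"
  by (induction xs rule: path_edges.induct) auto

lemma path_edges_rev [simp]: "path_edges (rev xs) = path_edges xs"
proof (induction xs rule: path_edges.induct)
  case (3 x y zs)
  have "path_edges (rev (x # y # zs)) = path_edges (rev (y # zs) @ [x])" by simp
  also have "\<dots> = insert {last (rev (y # zs)), x} (path_edges (rev (y # zs)))"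
    by (rule path_edges_snoc) simp
  also have "\<dots> = path_edges (x # y # zs)"
    using 3 by (simp only: last_rev list.sel path_edges.simps insert_commute[of y x])
  finally show ?case .
qed auto

lemma path_edges_subset: "e \<in> path_edges xs \<Longrightarrow> e \<subseteq> set xs"
  by (induction xs rule: path_edges.induct) auto

lemma Union_path_edges: "length xs \<ge> 2 \<Longrightarrow> \<Union>(path_edges xs) = set xs"
proof (induction xs rule: path_edges.induct)
  case (3 x y zs)
  then show ?case by (cases zs) auto
qed auto

lemma path_edges_split:
  "e \<in> path_edges xs \<Longrightarrow> \<exists>ps x y qs. xs = ps @ x # y # qs \<and> e = {x, y}"
proof (induction xs rule: path_edges.induct)
  case (3 x y zs)
  show ?case
  proof (cases "e = {x, y}")
    case True
    then show ?thesis by (metis append_Nil)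
  next
    case False
    then obtain ps u w qs where "y # zs = ps @ u # w # qs" "e = {u, w}" using 3 by auto
    then have "x # y # zs = (x # ps) @ u # w # qs" "e = {u, w}" by auto
    then show ?thesis by blast
  qed
qed auto

lemma card_path_edges: "distinct xs \<Longrightarrow> card (path_edges xs) = length xs - 1"
proof (induction xs rule: path_edges.induct)
  case (3 x y zs)
  have "{x, y} \<notin> path_edges (y # zs)" using 3 path_edges_subset by fastforce
  then show ?case using 3 by simp
qed auto

lemma cycle_edges_insert: "f \<noteq> [] \<Longrightarrow> cycle_edges f = insert {last f, hd f} (path_edges f)"
  unfolding cycle_edges_def by (simp add: path_edges_snoc)

lemma cycle_edges_append:
  "cycle_edges (a # p @ b # q) = path_edges (a # p @ [b]) \<union> path_edges (b # q @ [a])"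
  unfolding cycle_edges_def using path_edges_append[of "a # p" b "q @ [a]"] by simp

lemma cycle_edges_rotate: "cycle_edges (xs @ ys) = cycle_edges (ys @ xs)"
proof (cases "xs = [] \<or> ys = []")
  case False
  then obtain a p b q where "xs = a # p" "ys = b # q" by (metis neq_Nil_conv)
  then show ?thesis using cycle_edges_append[of a p b q] cycle_edges_append[of b q a p] by auto
qed auto

lemma cycle_edges_rev: "cycle_edges (rev f) = cycle_edges f"
proof (cases "f = []")
  case False
  then show ?thesis
    by (simp add: cycle_edges_insert hd_rev last_rev insert_commute)
qed (simp add: cycle_edges_def)

lemma finite_cycle_edges [simp]: "finite (cycle_edges f)"
  by (simp add: cycle_edges_def)

lemma Union_cycle_edges: "length f \<ge> 2 \<Longrightarrow> \<Union>(cycle_edges f) = set f"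
  by (cases "f = []") (auto simp: cycle_edges_insert Union_path_edges last_in_set)

lemma closing_edge_notin:
  assumes "distinct f" "length f \<ge> 3" shows "{last f, hd f} \<notin> path_edges f"
proof
  assume a: "{last f, hd f} \<in> path_edges f"
  obtain x y zs where f: "f = x # y # zs"
    using assms by (cases f; cases "tl f") auto
  then have "zs \<noteq> []" using assms by auto
  have "last f \<noteq> x" "last f \<noteq> y" using assms f \<open>zs \<noteq> []\<close> last_in_set by force+
  then have "{last f, hd f} \<in> path_edges (y # zs)" using a f by (auto simp: doubleton_eq_iff)
  then show False using path_edges_subset[of _ "y # zs"] assms f by fastforce
qed

lemma card_cycle_edges:
  assumes "distinct f" "length f \<ge> 3" shows "card (cycle_edges f) = length f"
proof -
  have "f \<noteq> []" using assms by auto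
  then show ?thesis using closing_edge_notin[OF assms] assms
    by (simp add: cycle_edges_insert card_path_edges)
qed

lemma cycle_edges_rotate_to:
  assumes "e \<in> cycle_edges f" "distinct f" "f \<noteq> []"
  obtains g where "cycle_edges g = cycle_edges f" "set g = set f" "distinct g"
    "length g = length f" "e = {last g, hd g}"
proof (cases "e = {last f, hd f}")
  case False
  then have "e \<in> path_edges f" using assms by (simp add: cycle_edges_insert)
  then obtain ps x y qs where f: "f = ps @ x # y # qs" "e = {x, y}" using path_edges_split by metis
  show ?thesis
  proof (rule that)
    show "cycle_edges ((y # qs) @ (ps @ [x])) = cycle_edges f"
      using cycle_edges_rotate[of "y # qs" "ps @ [x]"] f by simp
  qed (use assms f in auto)
qed (use that assms in blast)

lemma cycle_rotate_two:
  assumes "distinct f" "a \<in> set f" "b \<in> set f" "a \<noteq> b"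
  obtains p q where "cycle_edges (a # p @ b # q) = cycle_edges f" "set (a # p @ b # q) = set f"
    "distinct (a # p @ b # q)" "length (a # p @ b # q) = length f"
proof -
  obtain ps qs where f: "f = ps @ a # qs" using assms split_list by metis
  have "b \<in> set (qs @ ps)" using assms f by auto
  then obtain p q where pq: "qs @ ps = p @ b # q" using split_list by metis
  have e: "a # p @ b # q = (a # qs) @ ps" using pq by simp
  have m: "set (qs @ ps) = set (p @ b # q)" "length (qs @ ps) = length (p @ b # q)" by (simp_all only: pq)
  show ?thesis
  proof (rule that)
    show "cycle_edges (a # p @ b # q) = cycle_edges f"
      unfolding e using cycle_edges_rotate[of "a # qs" ps] f by simp
    show "set (a # p @ b # q) = set f" "distinct (a # p @ b # q)" "length (a # p @ b # q) = length f"
      unfolding e using assms f by auto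
  qed
qed

section \<open>Parity of degrees and the cycle space\<close>

lemma odd_card_sym_diff:
  assumes "finite A" "finite B"
  shows "odd (card (sym_diff A B)) \<longleftrightarrow> (odd (card A) \<noteq> odd (card B))"
proof -
  have "card A = card (A - B) + card (A \<inter> B)" "card B = card (B - A) + card (A \<inter> B)"
    using card_Diff_subset_Int[of A B] card_Diff_subset_Int[of B A] assms
    by (simp_all add: Int_commute card_mono)
  moreover have "card (sym_diff A B) = card (A - B) + card (B - A)"
    using assms by (intro card_Un_disjoint) auto
  ultimately show ?thesis by auto
qed

lemma odd_degree_sym_diff:
  assumes "finite A" "finite B"
  shows "odd (edge_degree (sym_diff A B) w) \<longleftrightarrow> (odd (edge_degree A w) \<noteq> odd (edge_degree B w))"
proof -
  have "{e \<in> sym_diff A B. w \<in> e} = sym_diff {e \<in> A. w \<in> e} {e \<in> B. w \<in> e}" by auto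
  then show ?thesis unfolding edge_degree_def using odd_card_sym_diff[of "{e \<in> A. w \<in> e}" "{e \<in> B. w \<in> e}"] assms by simp
qed

lemma even_graph_sym_diff: "even_graph A \<Longrightarrow> even_graph B \<Longrightarrow> even_graph (sym_diff A B)"
  using odd_degree_sym_diff[of A B] by (simp add: even_graph_def)

lemma degree_single: "edge_degree {e} w = (if w \<in> e then 1 else 0)"
  unfolding edge_degree_def by (auto simp: Collect_conv_if)

text \<open>The exclusive or also covers a one-vertex list, whose two ends coincide and
  cancel.\<close>

lemma odd_degree_path:
  "distinct ws \<Longrightarrow> ws \<noteq> [] \<Longrightarrow> odd (edge_degree (path_edges ws) w) \<longleftrightarrow> ((w = hd ws) \<noteq> (w = last ws))"
proof (induction ws rule: path_edges.induct)
  case (3 x y zs)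
  have "{x, y} \<notin> path_edges (y # zs)" using 3 path_edges_subset by fastforce
  then have e: "path_edges (x # y # zs) = sym_diff {{x, y}} (path_edges (y # zs))" by auto
  have "x \<noteq> last (y # zs)" "x \<noteq> y" using 3(2) last_in_set[of "y # zs"] by auto
  then show ?case
    unfolding e using 3 by (subst odd_degree_sym_diff) (auto simp: degree_single)
qed (auto simp: edge_degree_def)

lemma even_graph_cycle:
  assumes "distinct f" "length f \<ge> 3" shows "even_graph (cycle_edges f)"
proof -
  have ne: "f \<noteq> []" using assms by auto
  have e: "cycle_edges f = sym_diff {{last f, hd f}} (path_edges f)"
    using closing_edge_notin[OF assms] ne by (auto simp: cycle_edges_insert)
  have "hd f \<noteq> last f"
    using assms by (cases f; cases "tl f") (auto simp: last_in_set)
  then have "even (edge_degree (cycle_edges f) w)" for w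
    using odd_degree_sym_diff[of "{{last f, hd f}}" "path_edges f" w]
      odd_degree_path[OF assms(1) ne, of w] unfolding e by (auto simp: degree_single split: if_splits)
  then show ?thesis unfolding even_graph_def by simp
qed

text \<open>The first vertex of the path meets one edge only, so an even subset omits this edge; the
  rest follows along the path.\<close>

lemma even_subgraph_path_empty:
  "distinct ws \<Longrightarrow> even_graph Z \<Longrightarrow> Z \<subseteq> path_edges ws \<Longrightarrow> Z = {}"
proof (induction ws rule: path_edges.induct)
  case (3 x y zs)
  have n: "x \<notin> e" if "e \<in> path_edges (y # zs)" for e
    using path_edges_subset[OF that] 3(2) by auto
  have "{x, y} \<notin> Z"
  proof
    assume "{x, y} \<in> Z"
    then have "{e \<in> Z. x \<in> e} = {{x, y}}" using 3(4) n by auto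
    then have "edge_degree Z x = 1" by (simp add: edge_degree_def)
    then show False using 3(3) unfolding even_graph_def by (metis odd_one)
  qed
  then show ?case using 3 by auto
qed auto

text \<open>If an edge is missing, rotating it into the closing position leaves \<open>Z\<close>
  inside a path, which carries no nonempty even set.\<close>

lemma even_subgraph_cycle:
  assumes "distinct f" "length f \<ge> 3" "even_graph Z" "Z \<subseteq> cycle_edges f"
  shows "Z = {} \<or> Z = cycle_edges f"
proof (rule disjCI)
  assume "Z \<noteq> cycle_edges f"
  then obtain e where e: "e \<in> cycle_edges f" "e \<notin> Z" using assms by blast
  have ne: "f \<noteq> []" using assms by auto
  obtain g where g: "cycle_edges g = cycle_edges f" "set g = set f" "distinct g"
    "length g = length f" "e = {last g, hd g}"
    by (rule cycle_edges_rotate_to[OF e(1) assms(1) ne])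
  have "g \<noteq> []" using g(4) assms(2) by auto
  then have "cycle_edges f = insert e (path_edges g)"
    using cycle_edges_insert[of g] unfolding g(1) g(5) by simp
  then have "Z \<subseteq> insert e (path_edges g)" using assms(4) by simp
  then have "Z \<subseteq> path_edges g" using subset_insert[OF e(2)] by simp
  then show "Z = {}" using even_subgraph_path_empty[OF g(3) assms(3)] by simp
qed

lemma path_all_or_none:
  assumes "\<And>xs x y z zs. ws = xs @ x # y # z # zs \<Longrightarrow> {x, y} \<in> Z \<longleftrightarrow> {y, z} \<in> Z"
  shows "path_edges ws \<subseteq> Z \<or> path_edges ws \<inter> Z = {}"
  using assms
proof (induction ws rule: path_edges.induct)
  case (3 x y zs)
  have IH: "path_edges (y # zs) \<subseteq> Z \<or> path_edges (y # zs) \<inter> Z = {}"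
  proof (rule "3.IH")
    fix xs x' y' z' zs'
    assume "y # zs = xs @ x' # y' # z' # zs'"
    then have "x # y # zs = (x # xs) @ x' # y' # z' # zs'" by simp
    then show "({x', y'} \<in> Z) = ({y', z'} \<in> Z)" using "3.prems" by blast
  qed
  show ?case
  proof (cases zs)
    case (Cons z zs')
    then have "x # y # zs = [] @ x # y # z # zs'" by simp
    then have "{x, y} \<in> Z \<longleftrightarrow> {y, z} \<in> Z" using "3.prems" by blast
    then show ?thesis using IH Cons by auto
  qed auto
qed auto

lemma edges_at_inner_vertex:
  assumes "distinct (xs @ x # y # z # zs)"
  shows "{e \<in> path_edges (xs @ x # y # z # zs). y \<in> e} = {{x, y}, {y, z}}"
proof -
  have e: "path_edges (xs @ x # y # z # zs) = path_edges (xs @ [x]) \<union> {{x, y}, {y, z}} \<union> path_edges (z # zs)"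
    using path_edges_append[of xs x "y # z # zs"] by auto
  have "y \<notin> e" if "e \<in> path_edges (xs @ [x])" for e
    using path_edges_subset[OF that] assms by auto
  moreover have "y \<notin> e" if "e \<in> path_edges (z # zs)" for e
    using path_edges_subset[OF that] assms by auto
  ultimately show ?thesis unfolding e by blast
qed

text \<open>An inner vertex of the ear lies on no edge of \<open>E\<close>, so two consecutive ear
  edges are all that \<open>Z\<close> can have there, and parity keeps or drops them
  together.\<close>

lemma even_graph_ear:
  assumes Z: "even_graph Z" "Z \<subseteq> E \<union> path_edges (a # r @ [b])"
    and d: "distinct (a # r @ [b])" "set r \<inter> \<Union>E = {}"
  shows "path_edges (a # r @ [b]) \<subseteq> Z \<or> path_edges (a # r @ [b]) \<inter> Z = {}"
proof (rule path_all_or_none)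
  fix xs x y z zs
  assume eq: "a # r @ [b] = xs @ x # y # z # zs"
  have y: "y \<in> set r"
  proof -
    have "y \<in> set (a # r @ [b])" unfolding eq by simp
    moreover have "y \<noteq> a"
      using d(1) eq by (cases xs) auto
    moreover have "y \<noteq> b"
    proof
      assume "y = b"
      moreover have "last (a # r @ [b]) = last (z # zs)" unfolding eq by simp
      then have "b \<in> set (z # zs)" by (metis last.simps last_in_set last_snoc append_Cons list.distinct(1))
      moreover have "distinct (xs @ x # y # z # zs)" using d(1) unfolding eq .
      ultimately show False by auto
    qed
    ultimately show ?thesis by auto
  qed
  have dd: "distinct (xs @ x # y # z # zs)" using d(1) unfolding eq .
  have "{e \<in> Z. y \<in> e} \<subseteq> {{x, y}, {y, z}}"
  proof
    fix e assume "e \<in> {e \<in> Z. y \<in> e}"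
    then have e: "e \<in> Z" "y \<in> e" by auto
    then have "e \<notin> E" using y d(2) by blast
    then have "e \<in> path_edges (xs @ x # y # z # zs)" using e Z(2) unfolding eq by blast
    then show "e \<in> {{x, y}, {y, z}}" using edges_at_inner_vertex[OF dd] e(2) by blast
  qed
  moreover have "{x, y} \<noteq> {y, z}" using dd by (auto simp: doubleton_eq_iff)
  moreover have "even (card {e \<in> Z. y \<in> e})" using Z unfolding even_graph_def edge_degree_def by blast
  ultimately show "{x, y} \<in> Z \<longleftrightarrow> {y, z} \<in> Z"
  proof -
    assume s: "{e \<in> Z. y \<in> e} \<subseteq> {{x, y}, {y, z}}" and ne: "{x, y} \<noteq> {y, z}"
      and ev: "even (card {e \<in> Z. y \<in> e})"
    have False if "{u, y} \<in> Z" "{e \<in> Z. y \<in> e} \<subseteq> {{u, y}}" for u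
    proof -
      have "{e \<in> Z. y \<in> e} = {{u, y}}" using that by auto
      then show False using ev by simp
    qed
    note one = this
    show ?thesis
    proof
      assume "{x, y} \<in> Z"
      then show "{y, z} \<in> Z" using one[of x] s by auto
    next
      assume "{y, z} \<in> Z"
      then have "{z, y} \<in> Z" by (simp add: insert_commute)
      then show "{x, y} \<in> Z" using one[of z] s by (auto simp: insert_commute)
    qed
  qed
qed

section \<open>Combinatorial plane maps\<close>

text \<open>The cut between \<open>A\<close> and the other faces in the dual graph, listed by the
  primal edges that cross it.\<close>

definition face_boundary :: "'a list set \<Rightarrow> 'a list set \<Rightarrow> 'a set set" where
  "face_boundary F A = {e. \<exists>f\<in>A. \<exists>g\<in>F - A. e \<in> cycle_edges f \<and> e \<in> cycle_edges g}"

definition adjacency :: "'a set set \<Rightarrow> ('a \<times> 'a) set" where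
  "adjacency E = {(u, w). {u, w} \<in> E}"

definition two_faced :: "'a set set \<Rightarrow> 'a list set \<Rightarrow> bool" where
  "two_faced E F \<longleftrightarrow> finite E \<and> finite F \<and>
     (\<forall>f\<in>F. distinct f \<and> length f \<ge> 3 \<and> cycle_edges f \<subseteq> E) \<and>
     (\<forall>e\<in>E. \<exists>f g. f \<noteq> g \<and> {h \<in> F. e \<in> cycle_edges h} = {f, g})"

text \<open>Faces are vertex lists, so that the two sides of a single cycle f are told apart as f and rev f.
  The clauses of a cycle map are: the dual graph is connected, every cycle bounds, the faces around a
  vertex are linked through the edges at it, Euler's formula holds, and the graph is connected.\<close>

definition cycle_map :: "'a set set \<Rightarrow> 'a list set \<Rightarrow> bool" where
  "cycle_map E F \<longleftrightarrow> two_faced E F \<and>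
     (\<forall>A\<subseteq>F. face_boundary F A = {} \<longrightarrow> A = {} \<or> A = F) \<and>
     (\<forall>Z\<subseteq>E. even_graph Z \<longrightarrow> (\<exists>A\<subseteq>F. face_boundary F A = Z)) \<and>
     (\<forall>A\<subseteq>F. \<forall>w. (\<forall>e\<in>face_boundary F A. w \<notin> e) \<longrightarrow>
        (\<forall>f\<in>F. \<forall>g\<in>F. w \<in> set f \<longrightarrow> w \<in> set g \<longrightarrow> f \<in> A \<longrightarrow> g \<in> A)) \<and>
     card F + card (\<Union>E) = card E + 2 \<and>
     (\<forall>x\<in>\<Union>E. \<forall>y\<in>\<Union>E. (x, y) \<in> (adjacency E)\<^sup>*)"

lemma two_facedD:
  assumes "two_faced E F"
  shows "finite E" "finite F" "f \<in> F \<Longrightarrow> distinct f" "f \<in> F \<Longrightarrow> length f \<ge> 3"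
    "f \<in> F \<Longrightarrow> cycle_edges f \<subseteq> E" "f \<in> F \<Longrightarrow> even_graph (cycle_edges f)"
    "f \<in> F \<Longrightarrow> \<Union>(cycle_edges f) = set f" "f \<in> F \<Longrightarrow> f \<noteq> []"
  using assms even_graph_cycle[of f] Union_cycle_edges[of f] unfolding two_faced_def by (fastforce+)

lemma two_facedE:
  assumes "two_faced E F" "e \<in> E"
  obtains f g where "f \<noteq> g" "{h \<in> F. e \<in> cycle_edges h} = {f, g}" "f \<in> F" "g \<in> F"
    "e \<in> cycle_edges f" "e \<in> cycle_edges g"
proof -
  obtain f g where fg: "f \<noteq> g" "{h \<in> F. e \<in> cycle_edges h} = {f, g}"
    using assms unfolding two_faced_def by blast
  have "f \<in> {h \<in> F. e \<in> cycle_edges h}" "g \<in> {h \<in> F. e \<in> cycle_edges h}" unfolding fg(2) by auto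
  then show ?thesis using that fg by blast
qed

lemma in_face_boundary:
  assumes "f \<noteq> g" "{h \<in> F. e \<in> cycle_edges h} = {f, g}" "A \<subseteq> F"
  shows "e \<in> face_boundary F A \<longleftrightarrow> (f \<in> A \<longleftrightarrow> g \<notin> A)"
proof -
  have fg: "f \<in> F" "g \<in> F" "e \<in> cycle_edges f" "e \<in> cycle_edges g" using assms(2) by blast+
  have only: "h = f \<or> h = g" if "h \<in> F" "e \<in> cycle_edges h" for h using assms(2) that by blast
  show ?thesis
    unfolding face_boundary_def using fg only assms(3) by blast
qed

lemma face_boundary_subset: "two_faced E F \<Longrightarrow> A \<subseteq> F \<Longrightarrow> face_boundary F A \<subseteq> E"
  unfolding face_boundary_def using two_facedD(5) by blast

text \<open>An edge only asks whether exactly one of its two faces is chosen, so the boundary map is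
  linear over the two-element field.\<close>

lemma face_boundary_sym_diff:
  assumes "two_faced E F" "A \<subseteq> F" "B \<subseteq> F"
  shows "face_boundary F (sym_diff A B) = sym_diff (face_boundary F A) (face_boundary F B)"
proof (intro set_eqI)
  fix e
  show "e \<in> face_boundary F (sym_diff A B) \<longleftrightarrow> e \<in> sym_diff (face_boundary F A) (face_boundary F B)"
  proof (cases "e \<in> E")
    case True
    then obtain f g where fg: "f \<noteq> g" "{h \<in> F. e \<in> cycle_edges h} = {f, g}"
      using assms two_facedE by metis
    have s: "sym_diff A B \<subseteq> F" using assms by blast
    show ?thesis
      unfolding in_face_boundary[OF fg s] Un_iff Diff_iff in_face_boundary[OF fg assms(2)]
        in_face_boundary[OF fg assms(3)] by argo
  next
    case False
    have "sym_diff A B \<subseteq> F" using assms by blast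
    then show ?thesis using False face_boundary_subset[OF assms(1)] assms by blast
  qed
qed

lemma face_boundary_single:
  assumes "two_faced E F" "f \<in> F" shows "face_boundary F {f} = cycle_edges f"
proof (intro set_eqI)
  fix e
  show "e \<in> face_boundary F {f} \<longleftrightarrow> e \<in> cycle_edges f"
  proof
    assume "e \<in> cycle_edges f"
    moreover then have "e \<in> E" using assms two_facedD by blast
    then obtain g h where "g \<noteq> h" "g \<in> F" "h \<in> F" "e \<in> cycle_edges g" "e \<in> cycle_edges h"
      using two_facedE[OF assms(1)] by metis
    ultimately show "e \<in> face_boundary F {f}" unfolding face_boundary_def by blast
  qed (auto simp: face_boundary_def)
qed

lemma face_boundary_complement:
  "A \<subseteq> F \<Longrightarrow> face_boundary F (F - A) = face_boundary F A"
  unfolding face_boundary_def by blast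

lemma face_boundary_empty: "face_boundary F {} = {}"
  unfolding face_boundary_def by blast

text \<open>By linearity the boundary is the sum of the facial cycles of the members of
  \<open>A\<close>.\<close>

lemma even_face_boundary:
  assumes "two_faced E F" "A \<subseteq> F" shows "even_graph (face_boundary F A)"
proof -
  have "finite A" using assms two_facedD(2) finite_subset by blast
  then show ?thesis using assms(2)
  proof (induction A)
    case empty
    then show ?case by (simp add: face_boundary_empty even_graph_def edge_degree_def)
  next
    case (insert f A)
    have e: "insert f A = sym_diff {f} A" using insert by auto
    show ?case
      unfolding e using insert assms(1)
      by (subst face_boundary_sym_diff[OF assms(1)])
        (auto intro!: even_graph_sym_diff simp: face_boundary_single[OF assms(1)] two_facedD[OF assms(1)])
  qed
qed

lemma adjacency_rtrancl_sym: "(x, y) \<in> (adjacency E)\<^sup>* \<Longrightarrow> (y, x) \<in> (adjacency E)\<^sup>*"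
proof -
  have "sym (adjacency E)" by (auto simp: sym_def adjacency_def insert_commute)
  then show "(x, y) \<in> (adjacency E)\<^sup>* \<Longrightarrow> (y, x) \<in> (adjacency E)\<^sup>*"
    using sym_rtrancl symD by metis
qed

lemma adjacency_mono: "E \<subseteq> E' \<Longrightarrow> (adjacency E)\<^sup>* \<subseteq> (adjacency E')\<^sup>*"
  by (rule rtrancl_mono) (auto simp: adjacency_def)

lemma path_edges_connected:
  "path_edges ws \<subseteq> E \<Longrightarrow> w \<in> set ws \<Longrightarrow> (hd ws, w) \<in> (adjacency E)\<^sup>*"
proof (induction ws rule: path_edges.induct)
  case (3 x y zs)
  show ?case
  proof (cases "w = x")
    case False
    then have "(y, w) \<in> (adjacency E)\<^sup>*" using 3 by auto
    moreover have "(x, y) \<in> adjacency E" using 3 by (auto simp: adjacency_def)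
    ultimately show ?thesis by (metis converse_rtrancl_into_rtrancl list.sel(1))
  qed auto
qed auto

text \<open>The start of the ear construction. There are only four sets of faces, so the clauses are
  checked case by case; length at least three makes \<open>f\<close> and \<open>rev f\<close>
  different lists.\<close>

lemma cycle_map_cycle:
  assumes "distinct f" "length f \<ge> 3"
  shows "cycle_map (cycle_edges f) {f, rev f}"
proof -
  let ?F = "{f, rev f}"
  obtain x y zs where f: "f = x # y # zs" using assms by (cases f; cases "tl f") auto
  have ne: "f \<noteq> rev f"
  proof
    assume "f = rev f"
    then have "hd f = last f" by (metis hd_rev)
    moreover have "last f \<in> set (y # zs)" unfolding f by (metis last.simps last_in_set list.distinct(1))
    ultimately show False using f assms(1) by simp
  qed
  have ce: "cycle_edges h = cycle_edges f" if "h \<in> ?F" for h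
    using that cycle_edges_rev by auto
  have two: "two_faced (cycle_edges f) ?F"
    unfolding two_faced_def
  proof (intro conjI ballI)
    fix e assume e: "e \<in> cycle_edges f"
    have "{h \<in> ?F. e \<in> cycle_edges h} = {f, rev f}" using e ce by blast
    then show "\<exists>g h. g \<noteq> h \<and> {h \<in> ?F. e \<in> cycle_edges h} = {g, h}" using ne by metis
  next
    fix h assume h: "h \<in> ?F"
    then show "distinct h" "3 \<le> length h" using assms by auto
    show "cycle_edges h \<subseteq> cycle_edges f" using ce[OF h] by simp
  qed simp_all
  have nonempty: "cycle_edges f \<noteq> {}" using cycle_edges_insert[of f] f by blast
  have bd: "face_boundary ?F {f} = cycle_edges f" "face_boundary ?F {rev f} = cycle_edges f"
    using face_boundary_single[OF two, of f] face_boundary_single[OF two, of "rev f"]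
      cycle_edges_rev[of f] by simp_all
  have cases: "A = {} \<or> A = ?F \<or> A = {f} \<or> A = {rev f}" if "A \<subseteq> ?F" for A
    using that by blast
  have un: "\<Union>(cycle_edges f) = set f" using assms Union_cycle_edges[of f] by simp
  have S2: "\<forall>A\<subseteq>?F. face_boundary ?F A = {} \<longrightarrow> A = {} \<or> A = ?F"
    using cases bd nonempty by metis
  have S3: "\<forall>Z\<subseteq>cycle_edges f. even_graph Z \<longrightarrow> (\<exists>A\<subseteq>?F. face_boundary ?F A = Z)"
  proof (intro allI impI)
    fix Z assume "Z \<subseteq> cycle_edges f" "even_graph Z"
    then have "Z = {} \<or> Z = cycle_edges f" using even_subgraph_cycle assms by blast
    then show "\<exists>A\<subseteq>?F. face_boundary ?F A = Z"
      using bd face_boundary_empty by (metis empty_subsetI insert_subset singletonI insertI1)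
  qed
  have S4: "g \<in> A"
    if h: "A \<subseteq> ?F" "\<forall>e\<in>face_boundary ?F A. w \<notin> e" "h \<in> ?F" "g \<in> ?F" "w \<in> set h" "h \<in> A" for A w g h
  proof (rule ccontr)
    assume "g \<notin> A"
    then have "A = {f} \<or> A = {rev f}" using cases[OF h(1)] h by blast
    then have "face_boundary ?F A = cycle_edges f" using bd by blast
    then have "w \<notin> \<Union>(cycle_edges f)" using h(2) by auto
    then show False using h un by auto
  qed
  have S5: "card ?F + card (\<Union>(cycle_edges f)) = card (cycle_edges f) + 2"
    using ne assms by (simp add: un card_cycle_edges distinct_card)
  have S6: "(u, w) \<in> (adjacency (cycle_edges f))\<^sup>*" if "u \<in> set f" "w \<in> set f" for u w
  proof -
    have "path_edges f \<subseteq> cycle_edges f" using cycle_edges_insert[of f] f by blast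
    then have "(hd f, u) \<in> (adjacency (cycle_edges f))\<^sup>*" "(hd f, w) \<in> (adjacency (cycle_edges f))\<^sup>*"
      using path_edges_connected[of f] that by simp_all
    then show ?thesis using adjacency_rtrancl_sym[of "hd f" u] by (meson rtrancl_trans)
  qed
  show ?thesis
    unfolding cycle_map_def
  proof (intro conjI two S2 S3 S5)
    show "\<forall>A\<subseteq>?F. \<forall>w. (\<forall>e\<in>face_boundary ?F A. w \<notin> e) \<longrightarrow>
        (\<forall>h\<in>?F. \<forall>g\<in>?F. w \<in> set h \<longrightarrow> w \<in> set g \<longrightarrow> h \<in> A \<longrightarrow> g \<in> A)"
      by (intro allI impI ballI) (rule S4)
    show "\<forall>x\<in>\<Union>(cycle_edges f). \<forall>y\<in>\<Union>(cycle_edges f). (x, y) \<in> (adjacency (cycle_edges f))\<^sup>*"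
      unfolding un by (intro ballI S6)
  qed
qed

lemma cycle_mapD:
  assumes "cycle_map E F"
  shows "two_faced E F"
    "A \<subseteq> F \<Longrightarrow> face_boundary F A = {} \<Longrightarrow> A = {} \<or> A = F"
    "Z \<subseteq> E \<Longrightarrow> even_graph Z \<Longrightarrow> \<exists>A\<subseteq>F. face_boundary F A = Z"
    "A \<subseteq> F \<Longrightarrow> (\<And>e. e \<in> face_boundary F A \<Longrightarrow> w \<notin> e) \<Longrightarrow> f \<in> F \<Longrightarrow> g \<in> F \<Longrightarrow>
       w \<in> set f \<Longrightarrow> w \<in> set g \<Longrightarrow> f \<in> A \<Longrightarrow> g \<in> A"
    "card F + card (\<Union>E) = card E + 2"
    "x \<in> \<Union>E \<Longrightarrow> y \<in> \<Union>E \<Longrightarrow> (x, y) \<in> (adjacency E)\<^sup>*"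
proof -
  show "A \<subseteq> F \<Longrightarrow> (\<And>e. e \<in> face_boundary F A \<Longrightarrow> w \<notin> e) \<Longrightarrow> f \<in> F \<Longrightarrow> g \<in> F \<Longrightarrow>
       w \<in> set f \<Longrightarrow> w \<in> set g \<Longrightarrow> f \<in> A \<Longrightarrow> g \<in> A"
    using assms unfolding cycle_map_def by metis
qed (use assms in \<open>auto simp: cycle_map_def\<close>)

section \<open>Splitting a face by an ear\<close>

locale ear =
  fixes E :: "'a set set" and F :: "'a list set" and f :: "'a list" and a b :: 'a and p q r :: "'a list"
  assumes map: "cycle_map E F" and fF: "f \<in> F"
    and fcyc: "cycle_edges (a # p @ b # q) = cycle_edges f"
    and fset: "set (a # p @ b # q) = set f"
    and fdist: "distinct (a # p @ b # q)"
    and rdist: "distinct (a # r @ [b])"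
    and rnew: "set r \<inter> \<Union>E = {}"
    and Qnew: "path_edges (a # r @ [b]) \<inter> E = {}"
begin

definition "Q = path_edges (a # r @ [b])"
definition "P1 = path_edges (a # p @ [b])"
definition "P2 = path_edges (b # q @ [a])"
text \<open>The ends of the ear cut the boundary of \<open>f\<close> into stretches through
  \<open>p\<close> and \<open>q\<close>. Each new face keeps one stretch and closes up along the
  ear, traversed backwards in \<open>n1\<close>. A chord is the case of an empty
  \<open>r\<close>.\<close>

definition "n1 = a # p @ b # rev r"
definition "n2 = a # r @ b # q"
definition "F' = insert n1 (insert n2 (F - {f}))"

lemma two: "two_faced E F" using map cycle_mapD by blast

lemma fP: "cycle_edges f = P1 \<union> P2"
  using cycle_edges_append[of a p b q] fcyc by (simp add: P1_def P2_def)

lemma n1P: "cycle_edges n1 = P1 \<union> Q"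
proof -
  have "b # rev r @ [a] = rev (a # r @ [b])" by simp
  then have "path_edges (b # rev r @ [a]) = Q" unfolding Q_def by (simp only: path_edges_rev)
  then show ?thesis using cycle_edges_append[of a p b "rev r"] by (simp add: P1_def n1_def)
qed

lemma n2P: "cycle_edges n2 = P2 \<union> Q"
  using cycle_edges_append[of a r b q] by (auto simp: P2_def n2_def Q_def)

lemma P_sub: "P1 \<subseteq> E" "P2 \<subseteq> E"
  using two_facedD(5)[OF two fF] fP by auto

lemma QE: "Q \<inter> E = {}" using Qnew by (simp add: Q_def)

lemma Qab: "\<exists>e\<in>Q. a \<in> e" "\<exists>e\<in>Q. b \<in> e" "Q \<noteq> {}"
proof -
  have "\<Union>Q = set (a # r @ [b])" unfolding Q_def by (rule Union_path_edges) simp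
  then have "a \<in> \<Union>Q" "b \<in> \<Union>Q" by simp_all
  then show "\<exists>e\<in>Q. a \<in> e" "\<exists>e\<in>Q. b \<in> e" "Q \<noteq> {}" by auto
qed

text \<open>When the ear is a chord, a stretch without inner vertices would be a single edge
  parallel to it. Together with \<open>qr\<close> this gives both new faces at least three
  vertices.\<close>

lemma pq: "p \<noteq> []" if "r = []"
proof
  assume "p = []"
  then have "P1 = {{a, b}}" unfolding P1_def by simp
  then have "{a, b} \<in> E" using P_sub(1) by simp
  then show False using Qnew that by simp
qed

lemma qr: "q \<noteq> []" if "r = []"
proof
  assume "q = []"
  then have "P2 = {{a, b}}" unfolding P2_def by (simp add: insert_commute)
  then have "{a, b} \<in> E" using P_sub(2) by simp
  then show False using Qnew that by simp
qed

lemma fE: "set f \<subseteq> \<Union>E"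
  using two_facedD(5,7)[OF two fF] by blast

lemma pE: "set p \<subseteq> \<Union>E" "set q \<subseteq> \<Union>E" "a \<in> \<Union>E" "b \<in> \<Union>E"
  using fE fset by auto

text \<open>A common edge could only join \<open>a\<close> and \<open>b\<close>; then both stretches
  would be that edge and \<open>f\<close> would have two vertices.\<close>

lemma P12: "P1 \<inter> P2 = {}"
proof (rule ccontr)
  assume "P1 \<inter> P2 \<noteq> {}"
  then obtain e where e: "e \<in> P1" "e \<in> P2" by blast
  then have "e \<subseteq> set (a # p @ [b])" "e \<subseteq> set (b # q @ [a])"
    using path_edges_subset[of e] unfolding P1_def P2_def by blast+
  then have eab: "e \<subseteq> {a, b}" using fdist by auto
  have nab: "{a, b} \<notin> path_edges (x # s @ [y])" if "s \<noteq> []" "distinct (x # s @ [y])" "{x, y} = {a, b}" for x s y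
  proof
    assume "{a, b} \<in> path_edges (x # s @ [y])"
    then have c: "{last (x # s @ [y]), hd (x # s @ [y])} \<in> path_edges (x # s @ [y])"
      using that(3) by (simp add: insert_commute)
    have "length (x # s @ [y]) \<ge> 3" using that(1) by (cases s) auto
    then show False using closing_edge_notin[OF that(2)] c by blast
  qed
  obtain ps x y qs where s: "a # p @ [b] = ps @ x # y # qs" "e = {x, y}"
    using path_edges_split[of e] e(1) unfolding P1_def by metis
  have "x \<noteq> y"
  proof -
    have "distinct (a # p @ [b])" using fdist by auto
    then show ?thesis unfolding s by auto
  qed
  then have eq: "e = {a, b}" using eab s(2) by auto
  have "p = []" using nab[of p a b] fdist e(1) eq unfolding P1_def by auto
  moreover have "q = []" using nab[of q b a] fdist e(2) eq unfolding P2_def by (auto simp: insert_commute)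
  ultimately have "length f = 2"
    using distinct_card[OF fdist] distinct_card[OF two_facedD(3)[OF two fF]] fset by simp
  then show False using two_facedD(4)[OF two fF] by simp
qed

lemma PQ: "P1 \<inter> Q = {}" "P2 \<inter> Q = {}" using P_sub QE by auto

lemma Pne: "P1 \<noteq> {}" "P2 \<noteq> {}"
proof -
  have "\<Union>P1 = set (a # p @ [b])" unfolding P1_def by (rule Union_path_edges) simp
  then show "P1 \<noteq> {}" by auto
  have "\<Union>P2 = set (b # q @ [a])" unfolding P2_def by (rule Union_path_edges) simp
  then show "P2 \<noteq> {}" by auto
qed

lemma n1F: "n1 \<notin> F" and n2F: "n2 \<notin> F" and n12: "n1 \<noteq> n2"
proof -
  show "n1 \<notin> F" using two_facedD(5)[OF two, of n1] n1P Qab(3) QE by auto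
  show "n2 \<notin> F" using two_facedD(5)[OF two, of n2] n2P Qab(3) QE by auto
  show "n1 \<noteq> n2" using n1P n2P P12 Pne PQ by auto
qed

lemma old_Q: "h \<in> F \<Longrightarrow> e \<in> Q \<Longrightarrow> e \<notin> cycle_edges h"
  using two_facedD(5)[OF two] QE by blast

lemma old_P:
  assumes "e \<in> E" shows "e \<in> cycle_edges n1 \<longleftrightarrow> e \<in> P1" "e \<in> cycle_edges n2 \<longleftrightarrow> e \<in> P2"
  using assms QE n1P n2P by auto

lemma two': "two_faced (E \<union> Q) F'"
  unfolding two_faced_def
proof (intro conjI ballI)
  show "finite (E \<union> Q)" "finite F'" using two_facedD(1,2)[OF two] by (auto simp: F'_def Q_def)
next
  fix h assume h: "h \<in> F'"
  have "distinct n1" "distinct n2" using fdist rdist rnew pE by (auto simp: n1_def n2_def)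
  then show "distinct h" using h two_facedD(3)[OF two] by (auto simp: F'_def)
  have "length r + length p \<ge> 1" "length r + length q \<ge> 1"
    using pq qr by (cases r; simp add: Suc_le_eq)+
  then have "3 \<le> length n1" "3 \<le> length n2" by (simp_all add: n1_def n2_def)
  then show "3 \<le> length h" using h two_facedD(4)[OF two] by (auto simp: F'_def)
  show "cycle_edges h \<subseteq> E \<union> Q"
    using h two_facedD(5)[OF two] n1P n2P P_sub by (auto simp: F'_def)
next
  fix e assume "e \<in> E \<union> Q"
  then consider "e \<in> Q" | "e \<in> E" by blast
  then show "\<exists>g k. g \<noteq> k \<and> {h \<in> F'. e \<in> cycle_edges h} = {g, k}"
  proof cases
    case 1
    then have "{h \<in> F'. e \<in> cycle_edges h} = {n1, n2}"
      using old_Q n1P n2P by (auto simp: F'_def)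
    then show ?thesis using n12 by blast
  next
    case 2
    then obtain g k where gk: "g \<noteq> k" "{h \<in> F. e \<in> cycle_edges h} = {g, k}" "g \<in> F" "k \<in> F"
      "e \<in> cycle_edges g" "e \<in> cycle_edges k" by (rule two_facedE[OF two])
    have only: "h = g \<or> h = k" if "h \<in> F" "e \<in> cycle_edges h" for h using gk(2) that by blast
    \<comment> \<open>Seen from the old edge \<open>e\<close>, the face \<open>f\<close> is replaced
      by the half that inherits \<open>e\<close>, and every other face stays.\<close>
    define \<phi> where "\<phi> h = (if h = f then (if e \<in> P1 then n1 else n2) else h)" for h
    have "\<phi> g \<noteq> \<phi> k" using gk n1F n2F by (auto simp: \<phi>_def)
    moreover have "{h \<in> F'. e \<in> cycle_edges h} = {\<phi> g, \<phi> k}"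
    proof (intro set_eqI iffI)
      fix h assume "h \<in> {h \<in> F'. e \<in> cycle_edges h}"
      then have h: "h \<in> F'" "e \<in> cycle_edges h" by auto
      show "h \<in> {\<phi> g, \<phi> k}"
      proof (cases "h = n1 \<or> h = n2")
        case True
        then have "e \<in> cycle_edges f" "h = \<phi> f" using h(2) old_P[OF 2] fP P12 by (auto simp: \<phi>_def)
        then show ?thesis using only[OF fF] by auto
      next
        case False
        then have "h \<in> F" "h \<noteq> f" using h by (auto simp: F'_def)
        then show ?thesis using only[OF _ h(2)] by (auto simp: \<phi>_def)
      qed
    next
      fix h assume "h \<in> {\<phi> g, \<phi> k}"
      then obtain h' where h': "h = \<phi> h'" "h' \<in> F" "e \<in> cycle_edges h'" using gk by blast
      show "h \<in> {h \<in> F'. e \<in> cycle_edges h}"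
      proof (cases "h' = f")
        case True
        then show ?thesis using h' fP old_P[OF 2] by (auto simp: \<phi>_def F'_def)
      next
        case False
        then show ?thesis using h' by (auto simp: \<phi>_def F'_def)
      qed
    qed
    ultimately show ?thesis by blast
  qed
qed

text \<open>What \<open>A\<close> does with a half is compared with \<open>f\<close> only if
  \<open>e\<close> lies on the stretch of that half. This admits sets \<open>A\<close> that hold
  just one of the halves, as they occur in \<open>uniform'\<close>.\<close>

lemma boundary_local:
  assumes A: "A \<subseteq> F'" "A0 \<subseteq> F" "A0 - {f} = A - {n1, n2}" and e: "e \<in> E"
    and 1: "e \<in> P1 \<Longrightarrow> n1 \<in> A \<longleftrightarrow> f \<in> A0" and 2: "e \<in> P2 \<Longrightarrow> n2 \<in> A \<longleftrightarrow> f \<in> A0"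
  shows "e \<in> face_boundary F' A \<longleftrightarrow> e \<in> face_boundary F A0"
proof -
  have same: "h \<in> A \<longleftrightarrow> h \<in> A0" if "h \<in> F" "h \<noteq> f" for h
    using A(3) that n1F n2F by blast
  have fn: "f \<noteq> n1" "f \<noteq> n2" using fF n1F n2F by auto
  define \<phi> where "\<phi> h = (if h = f then (if e \<in> P1 then n1 else n2) else h)" for h
  have \<phi>: "\<phi> h \<in> F' \<and> e \<in> cycle_edges (\<phi> h) \<and> (\<phi> h \<in> A \<longleftrightarrow> h \<in> A0)"
    if "h \<in> F" "e \<in> cycle_edges h" for h
    using that fP old_P[OF e] same 1 2 by (auto simp: \<phi>_def F'_def)
  have \<psi>: "\<exists>h'. h' \<in> F \<and> e \<in> cycle_edges h' \<and> (h' \<in> A0 \<longleftrightarrow> h \<in> A)"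
    if "h \<in> F'" "e \<in> cycle_edges h" for h
  proof (cases "h = n1 \<or> h = n2")
    case True
    then show ?thesis using that old_P[OF e] fP 1 2 fF by blast
  next
    case False
    then show ?thesis using that same by (auto simp: F'_def)
  qed
  show ?thesis
  proof
    assume "e \<in> face_boundary F' A"
    then obtain h k where "h \<in> A" "k \<in> F' - A" "e \<in> cycle_edges h" "e \<in> cycle_edges k"
      unfolding face_boundary_def by blast
    then show "e \<in> face_boundary F A0"
      using \<psi>[of h] \<psi>[of k] A(1) unfolding face_boundary_def by blast
  next
    assume "e \<in> face_boundary F A0"
    then obtain h k where "h \<in> A0" "k \<in> F - A0" "e \<in> cycle_edges h" "e \<in> cycle_edges k"
      unfolding face_boundary_def by blast
    then show "e \<in> face_boundary F' A"
      using \<phi>[of h] \<phi>[of k] A(2) unfolding face_boundary_def by blast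
  qed
qed

lemma boundary_Q:
  assumes "A \<subseteq> F'" "e \<in> Q"
  shows "e \<in> face_boundary F' A \<longleftrightarrow> (n1 \<in> A \<longleftrightarrow> n2 \<notin> A)"
proof (rule in_face_boundary[OF n12 _ assms(1)])
  show "{h \<in> F'. e \<in> cycle_edges h} = {n1, n2}"
    using assms(2) old_Q n1P n2P by (auto simp: F'_def)
qed

text \<open>Glues the two halves back to \<open>f\<close>. It looks at \<open>n1\<close> alone and
  is meant for sets that hold both halves or neither.\<close>

definition "down A = A - {n1, n2} \<union> (if n1 \<in> A then {f} else {})"

lemma down: "A \<subseteq> F' \<Longrightarrow> down A \<subseteq> F" "A \<subseteq> F' \<Longrightarrow> down A - {f} = A - {n1, n2}" "A \<subseteq> F' \<Longrightarrow> f \<in> down A \<longleftrightarrow> n1 \<in> A"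
  using fF n1F n2F by (auto simp: down_def F'_def)

lemma boundary_down:
  assumes "A \<subseteq> F'" "n1 \<in> A \<longleftrightarrow> n2 \<in> A"
  shows "face_boundary F' A = face_boundary F (down A)"
proof (intro set_eqI)
  fix e
  consider "e \<in> Q" | "e \<in> E" | "e \<notin> E \<union> Q" by blast
  then show "e \<in> face_boundary F' A \<longleftrightarrow> e \<in> face_boundary F (down A)"
  proof cases
    case 1
    then show ?thesis
      using boundary_Q[OF assms(1)] assms(2) QE face_boundary_subset[OF two down(1)[OF assms(1)]] by blast
  next
    case 2
    then show ?thesis
      using boundary_local[OF assms(1) down(1,2)[OF assms(1)] 2] down(3)[OF assms(1)] assms(2) by blast
  next
    case 3
    then show ?thesis
      using face_boundary_subset[OF two' assms(1)] face_boundary_subset[OF two down(1)[OF assms(1)]] by blast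
  qed
qed

text \<open>An ear edge outside the boundary forces both halves onto the same side, so the set comes
  from a set of old faces.\<close>

lemma kernel':
  assumes "A \<subseteq> F'" "face_boundary F' A = {}"
  shows "A = {} \<or> A = F'"
proof -
  have n: "n1 \<in> A \<longleftrightarrow> n2 \<in> A" using Qab(3) boundary_Q[OF assms(1)] assms(2) by blast
  then have "down A = {} \<or> down A = F"
    using cycle_mapD(2)[OF map down(1)[OF assms(1)]] boundary_down[OF assms(1)] assms(2) by simp
  then show ?thesis
  proof
    assume "down A = {}"
    then show ?thesis using n down(2,3)[OF assms(1)] by auto
  next
    assume "down A = F"
    then have "n1 \<in> A" "F - {f} = A - {n1, n2}" using down(2,3)[OF assms(1)] fF by auto
    then show ?thesis using n assms(1) unfolding F'_def by blast
  qed
qed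

text \<open>An even set holds all of the ear or none of it; in the first case adding the boundary of
  \<open>n1\<close> removes the ear and leaves an even set of old edges.\<close>

lemma surj':
  assumes "Z \<subseteq> E \<union> Q" "even_graph Z" shows "\<exists>A\<subseteq>F'. face_boundary F' A = Z"
proof -
  have base: "\<exists>A\<subseteq>F'. face_boundary F' A = Y" if Y: "Y \<subseteq> E" "even_graph Y" for Y
  proof -
    obtain A0 where A0: "A0 \<subseteq> F" "face_boundary F A0 = Y" using cycle_mapD(3)[OF map Y] by blast
    define A where "A = A0 - {f} \<union> (if f \<in> A0 then {n1, n2} else {})"
    have A: "A \<subseteq> F'" "n1 \<in> A \<longleftrightarrow> n2 \<in> A" "down A = A0"
      using A0 n1F n2F by (auto simp: A_def F'_def down_def)
    then show ?thesis using boundary_down[OF A(1,2)] A0 by auto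
  qed
  have n1': "n1 \<in> F'" by (simp add: F'_def)
  consider "Q \<subseteq> Z" | "Q \<inter> Z = {}"
    using even_graph_ear[OF assms(2) _ rdist rnew] assms(1) unfolding Q_def by blast
  then show ?thesis
  proof cases
    case 1
    have "even_graph (cycle_edges n1)" using two_facedD(6)[OF two' n1'] .
    then have "even_graph (sym_diff Z (cycle_edges n1))" using assms even_graph_sym_diff by blast
    moreover have "sym_diff Z (cycle_edges n1) \<subseteq> E" using 1 assms(1) n1P P_sub by blast
    ultimately obtain A where A: "A \<subseteq> F'" "face_boundary F' A = sym_diff Z (cycle_edges n1)"
      using base by blast
    have "face_boundary F' (sym_diff A {n1}) = sym_diff (face_boundary F' A) (face_boundary F' {n1})"
      using face_boundary_sym_diff[OF two' A(1)] n1' by blast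
    also have "\<dots> = Z" unfolding A(2) face_boundary_single[OF two' n1'] by blast
    finally show ?thesis using A(1) n1' by (intro exI[of _ "sym_diff A {n1}"]) auto
  next
    case 2
    then show ?thesis using base assms by blast
  qed
qed

text \<open>If both halves are on the same side of \<open>A\<close>, an inner vertex of the ear sees
  only the halves, and any other vertex is handled in the old map. If the halves are separated, the
  ear belongs to the boundary, so \<open>w\<close> is off the ear.\<close>

lemma uniform':
  assumes A: "A \<subseteq> F'" and w: "\<And>e. e \<in> face_boundary F' A \<Longrightarrow> w \<notin> e"
    and gh: "g \<in> F'" "h \<in> F'" "w \<in> set g" "w \<in> set h" "g \<in> A"
  shows "h \<in> A"
proof (cases "n1 \<in> A \<longleftrightarrow> n2 \<in> A")
  case True
  show ?thesis
  proof (cases "w \<in> set r")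
    case True
    then have "w \<notin> set k" if "k \<in> F" for k using two_facedD(5,7)[OF two that] rnew by blast
    then have "g \<in> {n1, n2}" "h \<in> {n1, n2}" using gh by (auto simp: F'_def)
    then show ?thesis using \<open>n1 \<in> A \<longleftrightarrow> n2 \<in> A\<close> gh by blast
  next
    case False
    define \<phi> where "\<phi> k = (if k = n1 \<or> k = n2 then f else k)" for k
    have wf: "w \<in> set f" if "w \<in> set n1 \<or> w \<in> set n2"
      using that False unfolding fset[symmetric] by (auto simp: n1_def n2_def)
    have \<phi>: "\<phi> k \<in> F \<and> w \<in> set (\<phi> k) \<and> (\<phi> k \<in> down A \<longleftrightarrow> k \<in> A)" if "k \<in> F'" "w \<in> set k" for k
      using that wf fF down(2,3)[OF A] True n1F n2F by (auto simp: \<phi>_def F'_def)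
    show ?thesis
      using cycle_mapD(4)[OF map down(1)[OF A], of w "\<phi> g" "\<phi> h"] w boundary_down[OF A True]
        \<phi>[OF gh(1,3)] \<phi>[OF gh(2,4)] gh(5) by simp
  qed
next
  case ne: False
  then have Qb: "Q \<subseteq> face_boundary F' A" using boundary_Q[OF A] by blast
  have "\<Union>Q = set (a # r @ [b])" unfolding Q_def by (rule Union_path_edges) simp
  then have w': "w \<notin> set (a # r @ [b])" using Qb w by blast
  \<comment> \<open>Being off the ear, \<open>w\<close> can lie on \<open>f\<close> through
    \<open>p\<close> or through \<open>q\<close> but not both, so it sees at most one half;
    \<open>f\<close> is put on the side of that half.\<close>
  define c where "c \<longleftrightarrow> (if w \<in> set p then n1 \<in> A else n2 \<in> A)"
  define A0 where "A0 = A - {n1, n2} \<union> (if c then {f} else {})"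
  have A0: "A0 \<subseteq> F" "A0 - {f} = A - {n1, n2}" "f \<in> A0 \<longleftrightarrow> c"
    using A fF by (auto simp: A0_def F'_def)
  have "w \<notin> e" if e: "e \<in> face_boundary F A0" for e
  proof
    assume we: "w \<in> e"
    have eE: "e \<in> E" using face_boundary_subset[OF two A0(1)] e by blast
    have "e \<in> P1 \<Longrightarrow> w \<in> set p" using we w' path_edges_subset[of e "a # p @ [b]"] unfolding P1_def by auto
    moreover have "e \<in> P2 \<Longrightarrow> w \<notin> set p"
      using we w' path_edges_subset[of e "b # q @ [a]"] fdist unfolding P2_def by auto
    ultimately have "e \<in> face_boundary F' A"
      using boundary_local[OF A A0(1,2) eE] e A0(3) by (auto simp: c_def)
    then show False using w we by blast
  qed
  note un = cycle_mapD(4)[OF map A0(1) this]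
  define \<phi> where "\<phi> k = (if k = n1 \<or> k = n2 then f else k)" for k
  have \<phi>: "\<phi> k \<in> F \<and> w \<in> set (\<phi> k) \<and> (\<phi> k \<in> A0 \<longleftrightarrow> k \<in> A)" if k: "k \<in> F'" "w \<in> set k" for k
  proof -
    consider "k = n1" | "k = n2" | "k \<in> F" "k \<noteq> f" "k \<noteq> n1" "k \<noteq> n2" using k n1F n2F by (auto simp: F'_def)
    then show ?thesis
    proof cases
      case 1
      then have "w \<in> set p" using k w' by (auto simp: n1_def)
      then show ?thesis using 1 A0(3) fF fset[symmetric] by (auto simp: \<phi>_def c_def)
    next
      case 2
      then have "w \<in> set q" using k w' by (auto simp: n2_def)
      moreover then have "w \<notin> set p" using fdist by auto
      ultimately show ?thesis using 2 A0(3) fF n12 fset[symmetric] by (auto simp: \<phi>_def c_def)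
    next
      case 3
      then show ?thesis using k A0(2) by (auto simp: \<phi>_def)
    qed
  qed
  show ?thesis using un[of "\<phi> g" "\<phi> h"] \<phi>[OF gh(1,3)] \<phi>[OF gh(2,4)] gh(5) by simp
qed

lemma union': "\<Union>(E \<union> Q) = \<Union>E \<union> set r"
proof -
  have "\<Union>Q = set (a # r @ [b])" unfolding Q_def by (rule Union_path_edges) simp
  then show ?thesis using pE by auto
qed

text \<open>An ear adds \<open>length r\<close> vertices, \<open>length r + 1\<close> edges and one
  face.\<close>

lemma euler': "card F' + card (\<Union>(E \<union> Q)) = card (E \<union> Q) + 2"
proof -
  have fin: "finite (\<Union>E)"
  proof -
    have "e \<in> E \<Longrightarrow> finite e" for e
    proof -
      assume "e \<in> E"
      then obtain h where "h \<in> F" "e \<in> cycle_edges h" using two_facedE[OF two] by metis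
      then have "e \<subseteq> set h" using two_facedD(7)[OF two] by blast
      then show "finite e" using finite_subset by blast
    qed
    then show ?thesis using two_facedD(1)[OF two] by blast
  qed
  have "card Q = length r + 1" unfolding Q_def using card_path_edges[OF rdist] by simp
  then have 1: "card (E \<union> Q) = card E + length r + 1"
    using card_Un_disjoint[of E Q] two_facedD(1)[OF two] QE by (simp add: Q_def Int_commute)
  have 2: "card (\<Union>(E \<union> Q)) = card (\<Union>E) + length r"
    unfolding union' using fin rnew rdist by (subst card_Un_disjoint) (auto simp: distinct_card)
  have "card F > 0" using two_facedD(2)[OF two] fF card_gt_0_iff by blast
  then have 3: "card F' = card F + 1"
    using n1F n2F n12 two_facedD(2)[OF two] fF by (simp add: F'_def card_Diff_singleton)
  show ?thesis using 1 2 3 cycle_mapD(5)[OF map] by simp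
qed

lemma connected': "x \<in> \<Union>(E \<union> Q) \<Longrightarrow> (a, x) \<in> (adjacency (E \<union> Q))\<^sup>*"
proof -
  assume "x \<in> \<Union>(E \<union> Q)"
  then have "x \<in> \<Union>E \<or> x \<in> set (a # r @ [b])" using union' by auto
  then show ?thesis
  proof
    assume "x \<in> \<Union>E"
    then have "(a, x) \<in> (adjacency E)\<^sup>*" using cycle_mapD(6)[OF map] pE by blast
    then show ?thesis using adjacency_mono[of E "E \<union> Q"] by blast
  next
    assume "x \<in> set (a # r @ [b])"
    then show ?thesis using path_edges_connected[of "a # r @ [b]" "E \<union> Q" x] unfolding Q_def by simp
  qed
qed

lemma cycle_map': "cycle_map (E \<union> Q) F'"
  unfolding cycle_map_def
proof (intro conjI two' euler' allI impI ballI)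
  show "A \<subseteq> F' \<Longrightarrow> face_boundary F' A = {} \<Longrightarrow> A = {} \<or> A = F'" for A by (rule kernel')
  show "Z \<subseteq> E \<union> Q \<Longrightarrow> even_graph Z \<Longrightarrow> \<exists>A\<subseteq>F'. face_boundary F' A = Z" for Z by (rule surj')
  show "g \<in> A" if "A \<subseteq> F'" "\<forall>e\<in>face_boundary F' A. w \<notin> e" "h \<in> F'" "g \<in> F'" "w \<in> set h" "w \<in> set g" "h \<in> A"
    for A w h g using uniform'[OF that(1) _ that(3-7)] that(2) by blast
  show "(x, y) \<in> (adjacency (E \<union> Q))\<^sup>*" if "x \<in> \<Union>(E \<union> Q)" "y \<in> \<Union>(E \<union> Q)" for x y
    using connected'[OF that(1)] connected'[OF that(2)] adjacency_rtrancl_sym by (meson rtrancl_trans)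
qed

end

section \<open>Plane drawings\<close>

lemma arc_between_join:
  assumes "arc_between K a b" "arc_between L b c" "K \<inter> L \<subseteq> {b}"
  shows "arc_between (K \<union> L) a c"
proof -
  obtain g where g: "arc g" "pathstart g = a" "pathfinish g = b" "path_image g = K"
    using assms unfolding arc_between_def by blast
  obtain h where h: "arc h" "pathstart h = b" "pathfinish h = c" "path_image h = L"
    using assms unfolding arc_between_def by blast
  have "arc (g +++ h)" using g h assms(3) by (intro arc_join) auto
  moreover have "path_image (g +++ h) = K \<union> L" using g h by (simp add: path_image_join)
  ultimately show ?thesis
    unfolding arc_between_def using g h by (metis pathfinish_join pathstart_join)
qed

text \<open>Curves belong to unordered edges and are used as point sets, in line with
  \<open>path_edges\<close>; parametrizations stay hidden in \<open>arc_between\<close>.\<close>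

locale drawing =
  fixes V :: "'a set" and EE :: "'a set set" and pos :: "'a \<Rightarrow> complex" and img :: "'a set \<Rightarrow> complex set"
  assumes finite_V: "finite V"
    and edges: "e \<in> EE \<Longrightarrow> \<exists>u w. u \<in> V \<and> w \<in> V \<and> u \<noteq> w \<and> e = {u, w}"
    and inj_pos: "inj_on pos V"
    and img_arc: "{u, w} \<in> EE \<Longrightarrow> arc_between (img {u, w}) (pos u) (pos w)"
    and img_pos: "e \<in> EE \<Longrightarrow> img e \<inter> pos ` V = pos ` e"
    and img_Int: "e \<in> EE \<Longrightarrow> e' \<in> EE \<Longrightarrow> e \<noteq> e' \<Longrightarrow> img e \<inter> img e' \<subseteq> pos ` (e \<inter> e')"
begin

definition "drawn E = \<Union>(img ` E)"

text \<open>Each region is given as a side of its own boundary curve rather than as a component of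
  the complement, so the Jordan curve theorem yields its frontier at once.\<close>

definition realizes :: "'a set set \<Rightarrow> 'a list set \<Rightarrow> ('a list \<Rightarrow> complex set) \<Rightarrow> bool" where
  "realizes E F \<rho> \<longleftrightarrow>
     (\<forall>f\<in>F. \<rho> f \<in> {inside (drawn (cycle_edges f)), outside (drawn (cycle_edges f))}) \<and>
     (\<forall>f\<in>F. \<forall>g\<in>F. f \<noteq> g \<longrightarrow> \<rho> f \<inter> \<rho> g = {}) \<and>
     \<Union>(\<rho> ` F) = - drawn E"

definition plane_map :: "'a set set \<Rightarrow> bool" where
  "plane_map E \<longleftrightarrow> E \<subseteq> EE \<and> (\<exists>F \<rho>. cycle_map E F \<and> realizes E F \<rho>)"

lemma edge_V: "e \<in> EE \<Longrightarrow> e \<subseteq> V" using edges by blast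

lemma drawn_Un: "drawn (A \<union> B) = drawn A \<union> drawn B" by (auto simp: drawn_def)

lemma drawn_mono: "A \<subseteq> B \<Longrightarrow> drawn A \<subseteq> drawn B" by (auto simp: drawn_def)

lemma drawn_Int:
  assumes "A \<subseteq> EE" "B \<subseteq> EE" "A \<inter> B = {}"
  shows "drawn A \<inter> drawn B \<subseteq> pos ` (\<Union>A \<inter> \<Union>B)"
proof
  fix z assume "z \<in> drawn A \<inter> drawn B"
  then obtain e e' where e: "e \<in> A" "e' \<in> B" "z \<in> img e" "z \<in> img e'" by (auto simp: drawn_def)
  then have "e \<noteq> e'" "e \<in> EE" "e' \<in> EE" using assms by blast+
  then have "z \<in> pos ` (e \<inter> e')" using img_Int e by blast
  then show "z \<in> pos ` (\<Union>A \<inter> \<Union>B)" using e by blast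
qed

lemma pos_in_img: "e \<in> EE \<Longrightarrow> u \<in> V \<Longrightarrow> pos u \<in> img e \<longleftrightarrow> u \<in> e"
proof
  assume a: "e \<in> EE" "u \<in> V" "pos u \<in> img e"
  then have "pos u \<in> pos ` e" using img_pos by blast
  then show "u \<in> e" using inj_pos a edge_V[OF a(1)] by (meson inj_on_image_mem_iff)
next
  assume "e \<in> EE" "u \<in> V" "u \<in> e"
  then show "pos u \<in> img e" using img_pos by blast
qed

lemma pos_in_drawn: "A \<subseteq> EE \<Longrightarrow> u \<in> V \<Longrightarrow> pos u \<in> drawn A \<longleftrightarrow> u \<in> \<Union>A"
  unfolding drawn_def using pos_in_img by blast

lemma drawn_path:
  "distinct ws \<Longrightarrow> length ws \<ge> 2 \<Longrightarrow> path_edges ws \<subseteq> EE \<Longrightarrow>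
   arc_between (drawn (path_edges ws)) (pos (hd ws)) (pos (last ws))"
proof (induction ws rule: path_edges.induct)
  case (3 x y zs)
  have xy: "arc_between (img {x, y}) (pos x) (pos y)" using 3(4) by (intro img_arc) simp
  show ?case
  proof (cases zs)
    case Nil
    then show ?thesis using xy by (simp add: drawn_def)
  next
    case (Cons z zs')
    have IH: "arc_between (drawn (path_edges (y # zs))) (pos y) (pos (last (y # zs)))"
      using 3 Cons by simp
    have "{x, y} \<notin> path_edges (y # zs)"
      using path_edges_subset[of "{x, y}" "y # zs"] 3(2) by auto
    then have "img {x, y} \<inter> drawn (path_edges (y # zs)) \<subseteq> pos ` ({x, y} \<inter> \<Union>(path_edges (y # zs)))"
      using drawn_Int[of "{{x, y}}" "path_edges (y # zs)"] 3(4) by (simp add: drawn_def)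
    also have "{x, y} \<inter> \<Union>(path_edges (y # zs)) \<subseteq> {y}"
      using path_edges_subset[of _ "y # zs"] 3(2) by auto
    finally have "img {x, y} \<inter> drawn (path_edges (y # zs)) \<subseteq> {pos y}" by blast
    from arc_between_join[OF xy IH this] show ?thesis by (simp add: drawn_def)
  qed
qed auto

lemma drawn_two_paths:
  assumes "distinct (a # s @ b # t)" "path_edges (a # s @ [b]) \<subseteq> EE" "path_edges (a # t @ [b]) \<subseteq> EE"
    "path_edges (a # s @ [b]) \<inter> path_edges (a # t @ [b]) = {}"
  shows "arc_between (drawn (path_edges (a # s @ [b]))) (pos a) (pos b)"
    "arc_between (drawn (path_edges (a # t @ [b]))) (pos a) (pos b)"
    "drawn (path_edges (a # s @ [b])) \<inter> drawn (path_edges (a # t @ [b])) = {pos a, pos b}"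
proof -
  show 1: "arc_between (drawn (path_edges (a # s @ [b]))) (pos a) (pos b)"
    using drawn_path[of "a # s @ [b]"] assms by simp
  show 2: "arc_between (drawn (path_edges (a # t @ [b]))) (pos a) (pos b)"
    using drawn_path[of "a # t @ [b]"] assms by simp
  have "\<Union>(path_edges (a # s @ [b])) \<inter> \<Union>(path_edges (a # t @ [b])) \<subseteq> {a, b}"
    using path_edges_subset[of _ "a # s @ [b]"] path_edges_subset[of _ "a # t @ [b]"] assms(1) by fastforce
  from image_mono[OF this, of pos]
  have "drawn (path_edges (a # s @ [b])) \<inter> drawn (path_edges (a # t @ [b])) \<subseteq> {pos a, pos b}"
    using drawn_Int[OF assms(2-4)] by simp
  then show "drawn (path_edges (a # s @ [b])) \<inter> drawn (path_edges (a # t @ [b])) = {pos a, pos b}"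
    using arc_between_facts(4,5)[OF 1] arc_between_facts(4,5)[OF 2] by blast
qed

lemma drawn_cycle:
  assumes f: "distinct f" "length f \<ge> 3" "cycle_edges f \<subseteq> EE"
  shows "jordan_curve (drawn (cycle_edges f))"
proof -
  obtain x y zs where e: "f = x # y # zs" using f(2) by (cases f; cases "tl f") auto
  have rev: "path_edges (y # zs @ [x]) = path_edges (x # rev zs @ [y])"
    using path_edges_rev[of "x # rev zs @ [y]"] by simp
  have split: "cycle_edges f = path_edges (x # [] @ [y]) \<union> path_edges (x # rev zs @ [y])"
    using cycle_edges_append[of x "[]" y zs] rev by (simp add: e)
  have dist: "distinct (x # [] @ y # rev zs)" using f e by simp
  have "distinct (x # rev zs @ [y])" "3 \<le> length (x # rev zs @ [y])" using f e by auto
  from closing_edge_notin[OF this]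
  have "path_edges (x # [] @ [y]) \<inter> path_edges (x # rev zs @ [y]) = {}" by (simp add: insert_commute)
  from drawn_two_paths[OF dist _ _ this]
  show ?thesis using f(3) unfolding split drawn_Un by (intro jordan_curve_arcs) auto
qed

lemma plane_cycle:
  assumes f: "distinct f" "length f \<ge> 3" "cycle_edges f \<subseteq> EE"
  shows "plane_map (cycle_edges f)"
proof -
  let ?J = "drawn (cycle_edges f)"
  define \<rho> where "\<rho> g = (if g = f then inside ?J else outside ?J)" for g :: "'a list"
  note j = jordan_curve_facts(9,10)[OF drawn_cycle[OF f]]
  have "rev f \<noteq> f"
  proof
    assume "rev f = f"
    obtain x y zs where e: "f = x # y # zs" using f(2) by (cases f; cases "tl f") auto
    have "last f = hd f" using \<open>rev f = f\<close> by (metis last_rev)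
    moreover have "last f \<in> set (y # zs)" unfolding e by (metis last.simps last_in_set list.distinct(1))
    ultimately show False using e f(1) by simp
  qed
  then have r: "\<rho> f = inside ?J" "\<rho> (rev f) = outside ?J" by (simp_all add: \<rho>_def)
  have "realizes (cycle_edges f) {f, rev f} \<rho>"
    unfolding realizes_def using j by (simp add: r cycle_edges_rev Int_commute)
  then show ?thesis unfolding plane_map_def using cycle_map_cycle[OF f(1,2)] f(3) by blast
qed

text \<open>The open ear is connected and misses the drawing of \<open>E\<close>, so it lies in one
  region; its ends are on the frontier of that region, hence on the boundary cycle of its face. The
  ear is thus a chord of a Jordan curve, and the theta lemma splits the region.\<close>

lemma plane_ear:
  assumes E: "plane_map E"
    and ws: "distinct (a # r @ [b])" "path_edges (a # r @ [b]) \<subseteq> EE" "path_edges (a # r @ [b]) \<inter> E = {}"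
      "set r \<inter> \<Union>E = {}" "a \<in> \<Union>E" "b \<in> \<Union>E"
  shows "plane_map (E \<union> path_edges (a # r @ [b]))"
proof -
  let ?Q = "path_edges (a # r @ [b])"
  let ?q = "drawn ?Q"
  obtain F \<rho> where EE: "E \<subseteq> EE" and map: "cycle_map E F" and real: "realizes E F \<rho>"
    using E unfolding plane_map_def by blast
  have two: "two_faced E F" using map cycle_mapD by blast
  have reg: "\<rho> f \<in> {inside (drawn (cycle_edges f)), outside (drawn (cycle_edges f))}"
    and disj: "g \<in> F \<Longrightarrow> f \<noteq> g \<Longrightarrow> \<rho> f \<inter> \<rho> g = {}" if "f \<in> F" for f g
    using real that by (simp_all add: realizes_def)
  have cover: "\<Union>(\<rho> ` F) = - drawn E" using real by (simp add: realizes_def)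
  have UQ: "\<Union>?Q = set (a # r @ [b])" by (rule Union_path_edges) simp
  have abV: "a \<in> V" "b \<in> V" using ws(5,6) EE edge_V by blast+
  have q: "arc_between ?q (pos a) (pos b)" using drawn_path[of "a # r @ [b]"] ws by simp
  have qE: "?q \<inter> drawn E \<subseteq> {pos a, pos b}"
  proof -
    have "\<Union>?Q \<inter> \<Union>E \<subseteq> {a, b}" unfolding UQ using ws(4) by auto
    from image_mono[OF this, of pos] show ?thesis using drawn_Int[OF ws(2) EE ws(3)] by simp
  qed
  have abE: "pos a \<in> drawn E" "pos b \<in> drawn E" using pos_in_drawn[OF EE] abV ws(5,6) by blast+
  obtain z where z: "z \<in> ?q - {pos a, pos b}" using arc_between_facts(7)[OF q] by blast
  then have "z \<in> - drawn E" using qE by blast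
  then obtain f where f: "f \<in> F" "z \<in> \<rho> f" using cover by blast
  note fd = two_facedD(3,4)[OF two f(1)]
  have fE: "cycle_edges f \<subseteq> EE" using two_facedD(5)[OF two f(1)] EE by blast
  have J: "jordan_curve (drawn (cycle_edges f))" using drawn_cycle[OF fd fE] .
  have front: "frontier (\<rho> f) = drawn (cycle_edges f)"
    using reg[OF f(1)] jordan_curve_facts(11,12)[OF J] by auto
  have JE: "drawn (cycle_edges f) \<subseteq> drawn E" using drawn_mono two_facedD(5)[OF two f(1)] by blast
  have inR: "?q - {pos a, pos b} \<subseteq> \<rho> f"
  proof (rule ccontr)
    assume "\<not> ?thesis"
    then have "(?q - {pos a, pos b}) \<inter> frontier (\<rho> f) \<noteq> {}"
      using z f(2) arc_between_facts(6)[OF q] by (intro connected_Int_frontier) auto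
    then show False using front JE qE by blast
  qed
  have "?q \<subseteq> closure (\<rho> f)" using arc_between_facts(8)[OF q] closure_mono[OF inR] by blast
  then have "?q \<subseteq> \<rho> f \<union> drawn (cycle_edges f)" using front closure_Un_frontier by blast
  moreover have "\<rho> f \<inter> drawn E = {}" using cover f(1) by blast
  moreover have "pos a \<in> ?q" "pos b \<in> ?q" using arc_between_facts(4,5)[OF q] by auto
  ultimately have "pos a \<in> drawn (cycle_edges f)" "pos b \<in> drawn (cycle_edges f)" using abE by blast+
  then have ab: "a \<in> set f" "b \<in> set f"
    using pos_in_drawn[OF fE] abV two_facedD(7)[OF two f(1)] by auto
  have "a \<noteq> b" using ws(1) by auto
  obtain s t where st: "cycle_edges (a # s @ b # t) = cycle_edges f" "set (a # s @ b # t) = set f"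
    "distinct (a # s @ b # t)" "length (a # s @ b # t) = length f"
    by (rule cycle_rotate_two[OF fd(1) ab \<open>a \<noteq> b\<close>])
  interpret ear E F f a b s t r
    by unfold_locales (use map f st ws in auto)
  have Qeq: "Q = ?Q" by (simp add: Q_def)
  let ?K = "drawn P1" and ?L = "drawn P2"
  have t_rev: "path_edges (a # rev t @ [b]) = P2"
    using path_edges_rev[of "a # rev t @ [b]"] by (simp add: P2_def)
  have PE: "P1 \<subseteq> EE" "P2 \<subseteq> EE" using P_sub EE by blast+
  have KL: "arc_between ?K (pos a) (pos b)" "arc_between ?L (pos a) (pos b)" "?K \<inter> ?L = {pos a, pos b}"
    using drawn_two_paths[of a s b "rev t"] st(3) PE P12 unfolding t_rev by (auto simp: P1_def)
  have d1: "distinct (a # s @ b # r)" using st(3) ws(1,4) pE by auto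
  have KM: "?K \<inter> ?q = {pos a, pos b}"
    using drawn_two_paths(3)[OF d1] PE(1) ws(2) PQ(1) unfolding P1_def Qeq by blast
  have d2: "distinct (a # rev t @ b # r)" using st(3) ws(1,4) pE by auto
  have LM: "?L \<inter> ?q = {pos a, pos b}"
    using drawn_two_paths(3)[OF d2, unfolded t_rev] PE(2) ws(2) PQ(2) unfolding Qeq by blast
  have fKL: "drawn (cycle_edges f) = ?K \<union> ?L" unfolding fP drawn_Un ..
  obtain R1 R2 where R: "R1 \<in> {inside (?K \<union> ?q), outside (?K \<union> ?q)}"
    "R2 \<in> {inside (?L \<union> ?q), outside (?L \<union> ?q)}" "R1 \<inter> R2 = {}" "R1 \<union> R2 = \<rho> f - ?q"
    by (rule theta_split[OF KL(1,2) q KL(3) KM LM reg[OF f(1), unfolded fKL] inR])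
  define \<rho>' where "\<rho>' = \<rho>(n1 := R1, n2 := R2)"
  have r1: "\<rho>' n1 = R1" "\<rho>' n2 = R2" using n12 by (auto simp: \<rho>'_def)
  have r0: "\<rho>' g = \<rho> g" if "g \<in> F" for g using that n1F n2F by (auto simp: \<rho>'_def)
  have other: "\<rho> g \<inter> ?q = {}" if g: "g \<in> F" "g \<noteq> f" for g
  proof -
    have "\<rho> g \<inter> \<rho> f = {}" using disj[of g f] f(1) g by auto
    moreover have "pos a \<notin> \<rho> g" "pos b \<notin> \<rho> g" using abE cover g(1) by blast+
    ultimately show ?thesis using inR by blast
  qed
  have "realizes (E \<union> ?Q) F' \<rho>'"
    unfolding realizes_def
  proof (intro conjI ballI impI)
    fix g assume "g \<in> F'"
    then consider "g = n1" | "g = n2" | "g \<in> F" by (auto simp: F'_def)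
    then show "\<rho>' g \<in> {inside (drawn (cycle_edges g)), outside (drawn (cycle_edges g))}"
    proof cases
      case 1
      then show ?thesis using R(1) r1 by (simp add: n1P drawn_Un Qeq)
    next
      case 2
      then show ?thesis using R(2) r1 by (simp add: n2P drawn_Un Qeq)
    next
      case 3
      then show ?thesis using reg r0 by simp
    qed
  next
    fix g h assume gh: "g \<in> F'" "h \<in> F'" "g \<noteq> h"
    have R12: "R1 \<subseteq> \<rho> f" "R2 \<subseteq> \<rho> f" using R(4) by blast+
    have old: "\<rho> k \<inter> \<rho> f = {}" if "k \<in> F - {f}" for k using disj[of k f] f(1) that by auto
    have c: "k = n1 \<or> k = n2 \<or> k \<in> F - {f}" if "k \<in> F'" for k using that by (auto simp: F'_def)
    consider "g \<in> F - {f}" "h \<in> F - {f}" | "g \<in> F - {f}" "h \<in> {n1, n2}" | "g \<in> {n1, n2}" "h \<in> F - {f}"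
      | "g \<in> {n1, n2}" "h \<in> {n1, n2}" using c gh by blast
    then show "\<rho>' g \<inter> \<rho>' h = {}"
    proof cases
      case 1
      then show ?thesis using disj[of g h] gh(3) r0 by simp
    next
      case 2
      then have "\<rho>' h \<subseteq> \<rho> f" "\<rho>' g = \<rho> g" using R12 r0 r1 by auto
      then show ?thesis using old 2 by blast
    next
      case 3
      then have "\<rho>' g \<subseteq> \<rho> f" "\<rho>' h = \<rho> h" using R12 r0 r1 by auto
      then show ?thesis using old 3 by blast
    next
      case 4
      then show ?thesis using gh(3) r1 R(3) by auto
    qed
  next
    have "\<Union>(\<rho>' ` F') = R1 \<union> R2 \<union> \<Union>(\<rho>' ` (F - {f}))" unfolding F'_def using r1 by auto
    also have "\<Union>(\<rho>' ` (F - {f})) = \<Union>(\<rho> ` (F - {f}))" using r0 by auto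
    also have "R1 \<union> R2 \<union> \<Union>(\<rho> ` (F - {f})) = \<Union>(\<rho> ` F) - ?q"
      unfolding R(4) using other f(1) by blast
    finally show "\<Union>(\<rho>' ` F') = - drawn (E \<union> ?Q)" unfolding cover drawn_Un by blast
  qed
  then show ?thesis
    unfolding plane_map_def using cycle_map' ws(2) EE Qeq by auto
qed

end

section \<open>Maximal plane subgraphs and the edge bound\<close>

lemma rtrancl_adjacency_path:
  assumes "(u, w) \<in> (adjacency E)\<^sup>*"
  obtains ws where "ws \<noteq> []" "distinct ws" "hd ws = u" "last ws = w" "path_edges ws \<subseteq> E"
proof -
  have "\<exists>ws. ws \<noteq> [] \<and> distinct ws \<and> hd ws = u \<and> last ws = w \<and> path_edges ws \<subseteq> E"
    using assms
  proof (induction rule: converse_rtrancl_induct)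
    case base
    show ?case by (rule exI[of _ "[w]"]) simp
  next
    case (step u u')
    then obtain ws where ws: "ws \<noteq> []" "distinct ws" "hd ws = u'" "last ws = w" "path_edges ws \<subseteq> E"
      by blast
    show ?case
    proof (cases "u \<in> set ws")
      case True
      then obtain ps qs where eq: "ws = ps @ u # qs" using split_list by metis
      have "path_edges (u # qs) \<subseteq> E" using ws(5) path_edges_append[of ps u qs] unfolding eq by simp
      then show ?thesis using ws unfolding eq by (intro exI[of _ "u # qs"]) simp
    next
      case False
      obtain zs where zs: "ws = u' # zs" using ws(1,3) by (metis list.collapse)
      have "path_edges (u # ws) \<subseteq> E" using step(1) ws(5) zs by (simp add: adjacency_def)
      then show ?thesis using False ws by (intro exI[of _ "u # ws"]) simp
    qed
  qed
  then show ?thesis using that by blast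
qed

text \<open>The first vertex of a longest path has all its neighbours on the path; one that is not
  the next vertex closes a cycle of length at least three.\<close>

lemma min_degree_two_cycle:
  assumes W: "finite W" "w \<in> W" and E: "\<And>e. e \<in> E \<Longrightarrow> e \<subseteq> W"
    and deg: "\<And>u x. u \<in> W \<Longrightarrow> \<exists>y. y \<noteq> x \<and> y \<noteq> u \<and> {u, y} \<in> E"
  obtains f where "distinct f" "length f \<ge> 3" "cycle_edges f \<subseteq> E"
proof -
  define P where "P ws \<longleftrightarrow> ws \<noteq> [] \<and> distinct ws \<and> set ws \<subseteq> W \<and> path_edges ws \<subseteq> E" for ws
  have "P [w]" using W by (simp add: P_def)
  moreover have "\<forall>ws. P ws \<longrightarrow> length ws < Suc (card W)"
    using card_mono[OF W(1)] distinct_card unfolding P_def by (metis le_imp_less_Suc)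
  ultimately obtain ws where ws: "P ws" "\<And>xs. P xs \<Longrightarrow> length xs \<le> length ws"
    using ex_has_greatest_nat[of P "[w]" length] by blast
  obtain x xs where x: "ws = x # xs" using ws(1) unfolding P_def by (cases ws) auto
  have long: "z \<in> set ws" if "{x, z} \<in> E" for z
  proof (rule ccontr)
    assume "z \<notin> set ws"
    then have "P (z # ws)" using ws(1) that E[OF that] unfolding P_def x by (auto simp: insert_commute)
    then show False using ws(2) by fastforce
  qed
  obtain y where y: "y \<noteq> x" "{x, y} \<in> E" using deg[of x x] ws(1) unfolding P_def x by auto
  then obtain c cs where c: "xs = c # cs" using long[of y] x by (cases xs) auto
  obtain z where z: "z \<noteq> c" "z \<noteq> x" "{x, z} \<in> E" using deg[of x c] ws(1) unfolding P_def x by auto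
  then have "z \<in> set xs" using long[of z] x by simp
  then obtain ps qs where ps: "xs = ps @ z # qs" using split_list by metis
  then have "ps \<noteq> []" using z(1) c by (cases ps) auto
  show ?thesis
  proof (rule that)
    show "distinct (x # ps @ [z])" using ws(1) unfolding P_def x ps by auto
    show "length (x # ps @ [z]) \<ge> 3" using \<open>ps \<noteq> []\<close> by (cases ps) auto
    have "path_edges (x # ps @ [z]) \<subseteq> path_edges ws"
      using path_edges_append[of "x # ps" z qs] unfolding x ps by simp
    also have "\<dots> \<subseteq> E" using ws(1) unfolding P_def by blast
    finally show "cycle_edges (x # ps @ [z]) \<subseteq> E"
      using z(3) cycle_edges_insert[of "x # ps @ [z]"] by (simp add: insert_commute)
  qed
qed

text \<open>Every face has at least three edges and every edge two faces, so
  \<open>3 * card F \<le> 2 * card E\<close>; Euler's formula eliminates the faces.\<close>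

lemma cycle_map_edge_bound:
  assumes "cycle_map E F" shows "card E + 6 \<le> 3 * card (\<Union>E)"
proof -
  note two = cycle_mapD(1)[OF assms]
  have "3 * card F \<le> (\<Sum>f\<in>F. card {e \<in> E. e \<in> cycle_edges f})"
  proof -
    have "3 \<le> card {e \<in> E. e \<in> cycle_edges f}" if "f \<in> F" for f
    proof -
      have "{e \<in> E. e \<in> cycle_edges f} = cycle_edges f" using two_facedD(5)[OF two that] by blast
      then show ?thesis
        using card_cycle_edges[OF two_facedD(3)[OF two that] two_facedD(4)[OF two that]] two_facedD(4)[OF two that] by simp
    qed
    from sum_mono[of F "\<lambda>_. 3" "\<lambda>f. card {e \<in> E. e \<in> cycle_edges f}", OF this] show ?thesis by simp
  qed
  also have "\<dots> = (\<Sum>e\<in>E. 2)"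
  proof (rule sum_multicount_gen)
    show "\<forall>e\<in>E. card {f \<in> F. e \<in> cycle_edges f} = 2"
    proof
      fix e assume "e \<in> E"
      then obtain f g where "f \<noteq> g" "{h \<in> F. e \<in> cycle_edges h} = {f, g}"
        using two_facedE[OF two] by metis
      then show "card {f \<in> F. e \<in> cycle_edges f} = 2" by simp
    qed
  qed (use two_facedD(1,2)[OF two] in auto)
  finally show ?thesis using cycle_mapD(5)[OF assms] by simp
qed

section \<open>Maximal ear-built subgraphs and what hangs on them\<close>

context drawing
begin

lemma finite_EE: "finite EE"
proof -
  have "EE \<subseteq> Pow V" using edge_V by blast
  then show ?thesis using finite_V finite_subset by blast
qed

lemma drawing_subset: "EE' \<subseteq> EE \<Longrightarrow> drawing V EE' pos img"
proof
  assume sub: "EE' \<subseteq> EE"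
  show "finite V" "inj_on pos V" by (rule finite_V inj_pos)+
  show "e \<in> EE' \<Longrightarrow> \<exists>u w. u \<in> V \<and> w \<in> V \<and> u \<noteq> w \<and> e = {u, w}" for e
    by (rule edges[OF subsetD[OF sub]])
  show "{u, w} \<in> EE' \<Longrightarrow> arc_between (img {u, w}) (pos u) (pos w)" for u w
    by (rule img_arc[OF subsetD[OF sub]])
  show "e \<in> EE' \<Longrightarrow> img e \<inter> pos ` V = pos ` e" for e
    by (rule img_pos[OF subsetD[OF sub]])
  show "e \<in> EE' \<Longrightarrow> e' \<in> EE' \<Longrightarrow> e \<noteq> e' \<Longrightarrow> img e \<inter> img e' \<subseteq> pos ` (e \<inter> e')" for e e'
    by (rule img_Int[OF subsetD[OF sub] subsetD[OF sub]])
qed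

lemma maximal_plane_map:
  assumes "plane_map E0"
  obtains E where "plane_map E" "E0 \<subseteq> E" "\<And>E'. plane_map E' \<Longrightarrow> E \<subseteq> E' \<Longrightarrow> E' = E"
proof -
  let ?S = "{E. plane_map E \<and> E0 \<subseteq> E}"
  have "finite ?S"
    by (rule finite_subset[of _ "Pow EE"]) (auto simp: plane_map_def finite_EE)
  moreover have "E0 \<in> ?S" using assms by simp
  ultimately have "\<exists>E\<in>?S. \<forall>E'\<in>?S. E \<subseteq> E' \<longrightarrow> E = E'"
    by (intro finite_has_maximal) auto
  then obtain E where E: "E \<in> ?S" and max: "\<And>E'. E' \<in> ?S \<Longrightarrow> E \<subseteq> E' \<Longrightarrow> E = E'" by auto
  show ?thesis
  proof (rule that[of E])
    show "plane_map E" "E0 \<subseteq> E" using E by auto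
    show "E' = E" if "plane_map E'" "E \<subseteq> E'" for E' using max[of E'] that E by auto
  qed
qed

lemma maximal_no_ear:
  assumes E: "plane_map E" "\<And>E'. plane_map E' \<Longrightarrow> E \<subseteq> E' \<Longrightarrow> E' = E"
    and ws: "distinct (a # r @ [b])" "path_edges (a # r @ [b]) \<subseteq> EE" "path_edges (a # r @ [b]) \<inter> E = {}"
      "set r \<inter> \<Union>E = {}" "a \<in> \<Union>E" "b \<in> \<Union>E"
  shows False
proof -
  have "E \<union> path_edges (a # r @ [b]) = E" using E(2)[OF plane_ear[OF E(1) ws]] by simp
  then have "path_edges (a # r @ [b]) = {}" using ws(3) by blast
  moreover have "\<Union>(path_edges (a # r @ [b])) = set (a # r @ [b])" by (rule Union_path_edges) simp
  ultimately show False by simp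
qed

lemma maximal_induced:
  assumes E: "plane_map E" "\<And>E'. plane_map E' \<Longrightarrow> E \<subseteq> E' \<Longrightarrow> E' = E"
    and e: "{u, w} \<in> EE" "u \<in> \<Union>E" "w \<in> \<Union>E"
  shows "{u, w} \<in> E"
proof (rule ccontr)
  assume n: "{u, w} \<notin> E"
  have "u \<noteq> w" using edges[OF e(1)] by (auto simp: doubleton_eq_iff)
  then show False using maximal_no_ear[OF E, of u "[]" w] e n by simp
qed

text \<open>Two different attachment vertices would be joined by a path through the outside
  component, and this path would be an ear that can still be added.\<close>

lemma maximal_unique_attachment:
  assumes E: "plane_map E" "\<And>E'. plane_map E' \<Longrightarrow> E \<subseteq> E' \<Longrightarrow> E' = E"
    and uw: "(u, w) \<in> (adjacency {e \<in> EE. e \<inter> \<Union>E = {}})\<^sup>*" "u \<notin> \<Union>E"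
    and ab: "{a, u} \<in> EE" "{b, w} \<in> EE" "a \<in> \<Union>E" "b \<in> \<Union>E"
  shows "a = b"
proof (rule ccontr)
  assume "a \<noteq> b"
  obtain ws where ws: "ws \<noteq> []" "distinct ws" "hd ws = u" "last ws = w"
    "path_edges ws \<subseteq> {e \<in> EE. e \<inter> \<Union>E = {}}"
    by (rule rtrancl_adjacency_path[OF uw(1)])
  have out: "set ws \<inter> \<Union>E = {}"
  proof (cases "length ws \<ge> 2")
    case True
    then have "set ws = \<Union>(path_edges ws)" using Union_path_edges by metis
    then show ?thesis using ws(5) by blast
  next
    case False
    then have "ws = [u]" using ws(1,3) by (cases ws; cases "tl ws") auto
    then show ?thesis using uw(2) by simp
  qed
  obtain zs where zs: "ws = u # zs" using ws(1,3) by (metis list.collapse)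
  have pe: "path_edges (a # ws @ [b]) = insert {a, u} (insert {w, b} (path_edges ws))"
    using path_edges_snoc[OF ws(1), of b] ws(4) by (simp add: zs)
  show False
  proof (rule maximal_no_ear[OF E])
    show "distinct (a # ws @ [b])" using ws(2) out ab \<open>a \<noteq> b\<close> by auto
    show "path_edges (a # ws @ [b]) \<subseteq> EE"
      unfolding pe using ws(5) ab by (auto simp: insert_commute)
    have "w \<in> set ws" "u \<in> set ws" using ws(1,3,4) by auto
    then have "{a, u} \<notin> E" "{w, b} \<notin> E" using out by blast+
    moreover have "path_edges ws \<inter> E = {}"
    proof -
      have "e = {}" if "e \<in> path_edges ws" "e \<in> E" for e using that ws(5) by blast
      moreover have "e \<noteq> {}" if "e \<in> EE" for e using edges[OF that] by blast
      ultimately show ?thesis using ws(5) by blast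
    qed
    ultimately show "path_edges (a # ws @ [b]) \<inter> E = {}" unfolding pe by blast
  qed (use out ab in auto)
qed

text \<open>The anchor of a vertex outside the maximal plane subgraph is the only vertex of the subgraph its
  outside component is attached to, and None if there is no such vertex.\<close>

lemma anchors:
  assumes "plane_map E0"
  obtains E \<kappa> where "plane_map E" "E0 \<subseteq> E"
    "\<And>u. u \<in> \<Union>E \<Longrightarrow> \<kappa> u = Some u" "\<And>u a. \<kappa> u = Some a \<Longrightarrow> a \<in> \<Union>E"
    "\<And>u w. {u, w} \<in> EE \<Longrightarrow> \<kappa> u = \<kappa> w \<or> {u, w} \<in> E"
proof -
  obtain E where E: "plane_map E" "E0 \<subseteq> E" "\<And>E'. plane_map E' \<Longrightarrow> E \<subseteq> E' \<Longrightarrow> E' = E"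
    by (rule maximal_plane_map[OF assms]) blast
  let ?R = "adjacency {e \<in> EE. e \<inter> \<Union>E = {}}"
  define att where "att u a \<longleftrightarrow> a \<in> \<Union>E \<and> (\<exists>w. (u, w) \<in> ?R\<^sup>* \<and> {a, w} \<in> EE)" for u a
  define \<kappa> where "\<kappa> u = (if u \<in> \<Union>E then Some u else if \<exists>a. att u a then Some (SOME a. att u a) else None)" for u
  have uniq: "a = b" if h: "att u a" "att u b" "u \<notin> \<Union>E" for u a b
  proof -
    obtain w x where w: "a \<in> \<Union>E" "b \<in> \<Union>E" "(u, w) \<in> ?R\<^sup>*" "{a, w} \<in> EE" "(u, x) \<in> ?R\<^sup>*" "{b, x} \<in> EE"
      using h(1,2) unfolding att_def by blast
    have wn: "w \<notin> \<Union>E" using w(3) that(3)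
      by (induction rule: rtrancl_induct) (auto simp: adjacency_def)
    have "(w, x) \<in> ?R\<^sup>*" using w(3,5) adjacency_rtrancl_sym by (meson rtrancl_trans)
    then show ?thesis using maximal_unique_attachment[OF E(1,3) _ wn w(4,6,1,2)] by blast
  qed
  have \<kappa>_att: "\<kappa> u = Some a" if "att u a" "u \<notin> \<Union>E" for u a
  proof -
    have "att u (SOME a. att u a)" using that(1) by (rule someI)
    then have "(SOME a. att u a) = a" using uniq that by blast
    then show ?thesis using that unfolding \<kappa>_def by auto
  qed
  have \<kappa>_in: "a \<in> \<Union>E" if "\<kappa> u = Some a" for u a
  proof (cases "u \<in> \<Union>E")
    case False
    then obtain b where "att u b" using \<open>\<kappa> u = Some a\<close> unfolding \<kappa>_def by (metis option.distinct(1))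
    then show ?thesis using \<kappa>_att[OF _ False] that unfolding att_def by fastforce
  qed (use that in \<open>auto simp: \<kappa>_def\<close>)
  have mixed: "\<kappa> w = Some u" if "{u, w} \<in> EE" "u \<in> \<Union>E" "w \<notin> \<Union>E" for u w
    using that by (intro \<kappa>_att) (auto simp: att_def)
  have both: "\<kappa> u = \<kappa> w" if e: "{u, w} \<in> EE" "u \<notin> \<Union>E" "w \<notin> \<Union>E" for u w
  proof -
    have r: "(u, w) \<in> ?R" "(w, u) \<in> ?R" using e by (auto simp: adjacency_def insert_commute)
    have "att u a \<longleftrightarrow> att w a" for a
      using r unfolding att_def by (meson converse_rtrancl_into_rtrancl)
    then have "att u = att w" by blast
    then show ?thesis using e(2,3) unfolding \<kappa>_def by simp
  qed
  show ?thesis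
  proof (rule that[OF E(1,2)])
    show "\<kappa> u = Some u" if "u \<in> \<Union>E" for u using that by (simp add: \<kappa>_def)
    show "a \<in> \<Union>E" if "\<kappa> u = Some a" for u a using \<kappa>_in[OF that] .
    show "\<kappa> u = \<kappa> w \<or> {u, w} \<in> E" if e: "{u, w} \<in> EE" for u w
    proof -
      have \<kappa>U: "\<kappa> x = Some x" if "x \<in> \<Union>E" for x using that by (simp add: \<kappa>_def)
      have e': "{w, u} \<in> EE" using e by (simp add: insert_commute)
      consider "u \<in> \<Union>E" "w \<in> \<Union>E" | "u \<in> \<Union>E" "w \<notin> \<Union>E" | "u \<notin> \<Union>E" "w \<in> \<Union>E"
        | "u \<notin> \<Union>E" "w \<notin> \<Union>E" by blast
      then show ?thesis
      proof cases
        case 1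
        then show ?thesis using maximal_induced[OF E(1,3) e] by blast
      next
        case 2
        then show ?thesis using mixed[OF e] \<kappa>U by simp
      next
        case 3
        then show ?thesis using mixed[OF e'] \<kappa>U by simp
      next
        case 4
        then show ?thesis using both[OF e] by simp
      qed
    qed
  qed
qed

end

text \<open>Adding 3 instead of Euler's 6 keeps the bound true for one and two vertices and makes
  the induction close: each class \<open>X a\<close> meets \<open>?U\<close> in \<open>a\<close>
  alone, and the 3 gained in the class pays for counting \<open>a\<close> twice.\<close>

lemma (in drawing) edge_count:
  assumes "W \<subseteq> V" "W \<noteq> {}"
  shows "card {e \<in> EE. e \<subseteq> W} + 3 \<le> 3 * card W"
  using assms
proof (induction "card W" arbitrary: W rule: less_induct)
  case less
  have finW: "finite W" using less(2) finite_V finite_subset by blast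
  let ?E = "\<lambda>X. {e \<in> EE. e \<subseteq> X}"
  have finE: "finite (?E X)" for X using finite_EE by simp
  \<comment> \<open>A vertex of degree at most 3 can be deleted, since the bound grows by 3 per
    vertex. If there is none, every vertex has two neighbours and there is a cycle to start
    from.\<close>
  show ?case
  proof (cases "\<exists>w\<in>W. card {e \<in> ?E W. w \<in> e} \<le> 3")
    case True
    then obtain w where w: "w \<in> W" "card {e \<in> ?E W. w \<in> e} \<le> 3" by blast
    have split: "?E W = ?E (W - {w}) \<union> {e \<in> ?E W. w \<in> e}" by blast
    have "card (?E W) \<le> card (?E (W - {w})) + card {e \<in> ?E W. w \<in> e}"
      by (subst split) (rule card_Un_le)
    then have c: "card (?E W) \<le> card (?E (W - {w})) + 3" using w(2) by simp
    have cW: "card W = Suc (card (W - {w}))" using w(1) finW by (metis card.remove)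
    show ?thesis
    proof (cases "W - {w} = {}")
      case True
      have "?E W = {}"
      proof -
        have "\<not> e \<subseteq> W" if "e \<in> EE" for e using edges[OF that] True by blast
        then show ?thesis by blast
      qed
      then have "card (?E W) = 0" by (simp only: card.empty)
      then show ?thesis using cW by simp
    next
      case False
      have "card (?E (W - {w})) + 3 \<le> 3 * card (W - {w})"
        using cW less(2) False by (intro less(1)) auto
      then show ?thesis using c cW by simp
    qed
  next
    case False
    interpret sub: drawing V "?E W" pos img by (rule drawing_subset) blast
    obtain w0 where w0: "w0 \<in> W" using less(3) by blast
    have "\<exists>y. y \<noteq> x \<and> y \<noteq> u \<and> {u, y} \<in> ?E W" if u: "u \<in> W" for u x
    proof (rule ccontr)
      assume no: "\<nexists>y. y \<noteq> x \<and> y \<noteq> u \<and> {u, y} \<in> ?E W"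
      have "{e \<in> ?E W. u \<in> e} \<subseteq> {{u, x}}"
      proof
        fix e assume e: "e \<in> {e \<in> ?E W. u \<in> e}"
        then obtain c d where cd: "c \<noteq> d" "e = {c, d}" using edges[of e] by blast
        have "u = c \<or> u = d" using e cd by auto
        then have "\<exists>y. y \<noteq> u \<and> e = {u, y}"
          using cd by (metis insert_commute)
        then obtain y where "y \<noteq> u" "e = {u, y}" by blast
        then show "e \<in> {{u, x}}" using no e by auto
      qed
      from card_mono[OF _ this] have "card {e \<in> ?E W. u \<in> e} \<le> 1" by simp
      then show False using False u by fastforce
    qed
    then obtain f where f: "distinct f" "length f \<ge> 3" "cycle_edges f \<subseteq> ?E W"
      using min_degree_two_cycle[OF finW w0, of "?E W"] by blast
    obtain E \<kappa> where E: "sub.plane_map E" "cycle_edges f \<subseteq> E"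
      "\<And>u. u \<in> \<Union>E \<Longrightarrow> \<kappa> u = Some u" "\<And>u a. \<kappa> u = Some a \<Longrightarrow> a \<in> \<Union>E"
      "\<And>u w. {u, w} \<in> ?E W \<Longrightarrow> \<kappa> u = \<kappa> w \<or> {u, w} \<in> E"
        by (rule sub.anchors[OF sub.plane_cycle[OF f]]) blast
    let ?U = "\<Union>E"
    obtain F where EW: "E \<subseteq> ?E W" and map: "cycle_map E F" using E(1) unfolding sub.plane_map_def by auto
    have UW: "?U \<subseteq> W" using EW by blast
    have finU: "finite ?U" by (rule finite_subset[OF UW finW])
    \<comment> \<open>Three vertices in \<open>?U\<close> make every class \<open>X a\<close> a
      proper subset of \<open>W\<close>, so that the induction hypothesis applies to it.\<close>
    have cU: "3 \<le> card ?U"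
    proof -
      have "set f \<subseteq> ?U" using Union_cycle_edges[of f] f(2) E(2) by auto
      then show ?thesis using card_mono[OF finU, of "set f"] distinct_card[OF f(1)] f(2) by simp
    qed
    define X where "X a = {u \<in> W. \<kappa> u = Some a}" for a
    define N where "N = {u \<in> W. \<kappa> u = None}"
    have finX: "finite (X a)" "finite N" for a using finW by (auto simp: X_def N_def)
    have aX: "a \<in> X a" if "a \<in> ?U" for a using that UW E(3) by (auto simp: X_def)
    have bX: "card (?E (X a)) + 3 \<le> 3 * card (X a)" if a: "a \<in> ?U" for a
    proof -
      obtain b where b: "b \<in> ?U" "b \<noteq> a"
      proof (rule ccontr)
        assume "\<not> thesis"
        then have "?U \<subseteq> {a}" using that by blast
        then have "card ?U \<le> 1" using card_mono[of "{a}" ?U] by simp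
        then show False using cU by simp
      qed
      have "b \<notin> X a" using b E(3) by (auto simp: X_def)
      then have "X a \<subset> W" using b UW by (auto simp: X_def)
      then show ?thesis
        using psubset_card_mono[OF finW] less(2) aX[OF a] by (intro less(1)) auto
    qed
    have bN: "card (?E N) \<le> 3 * card N"
    proof (cases "N = {}")
      case True
      have "\<not> e \<subseteq> N" if "e \<in> EE" for e using edges[OF that] True by blast
      then have "?E N = {}" by blast
      then have "card (?E N) = 0" by (simp only: card.empty)
      then show ?thesis by simp
    next
      case False
      have "?U \<noteq> {}" using cU by (metis card.empty not_numeral_le_zero)
      then obtain a where "a \<in> ?U" by blast
      then have "a \<notin> N" "a \<in> W" using E(3) UW by (auto simp: N_def)
      moreover have "N \<subseteq> W" by (auto simp: N_def)
      ultimately have "N \<subset> W" by blast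
      then have "card {e \<in> EE. e \<subseteq> N} + 3 \<le> 3 * card N"
        using psubset_card_mono[OF finW] less(2) False by (intro less(1)) auto
      then show ?thesis by simp
    qed
    have "?E W \<subseteq> E \<union> (\<Union>a\<in>?U. ?E (X a)) \<union> ?E N"
    proof
      fix e assume e: "e \<in> ?E W"
      then obtain u w where uw: "e = {u, w}" using edges by blast
      show "e \<in> E \<union> (\<Union>a\<in>?U. ?E (X a)) \<union> ?E N"
      proof (cases "e \<in> E")
        case False
        then have eq: "\<kappa> w = \<kappa> u" using E(5)[of u w] e uw by simp
        have uwW: "u \<in> W" "w \<in> W" using e uw by auto
        show ?thesis
        proof (cases "\<kappa> u")
          case None
          then have "e \<in> ?E N" using e eq uwW by (simp add: N_def uw)
          then show ?thesis by blast
        next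
          case (Some a)
          then have "e \<in> ?E (X a)" using e eq uwW by (simp add: X_def uw)
          then show ?thesis using E(4)[OF Some] by blast
        qed
      qed blast
    qed
    then have "card (?E W) \<le> card (E \<union> (\<Union>a\<in>?U. ?E (X a)) \<union> ?E N)"
      by (intro card_mono finite_UnI finite_UN_I finU finE finite_subset[OF EW finE])
    also have "\<dots> \<le> card E + card (\<Union>a\<in>?U. ?E (X a)) + card (?E N)"
      using card_Un_le[of "E \<union> (\<Union>a\<in>?U. ?E (X a))" "?E N"] card_Un_le[of E "\<Union>a\<in>?U. ?E (X a)"] by linarith
    also have "\<dots> \<le> card E + (\<Sum>a\<in>?U. card (?E (X a))) + 3 * card N"
      using card_UN_le[OF finU, of "\<lambda>a. ?E (X a)"] bN by linarith
    finally have "card (?E W) \<le> card E + (\<Sum>a\<in>?U. card (?E (X a))) + 3 * card N" .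
    moreover have "(\<Sum>a\<in>?U. card (?E (X a))) + 3 * card ?U \<le> 3 * (\<Sum>a\<in>?U. card (X a))"
      using sum_mono[of ?U "\<lambda>a. card (?E (X a)) + 3", OF bX]
      by (simp add: sum.distrib sum_distrib_left)
    moreover have "(\<Sum>a\<in>?U. card (X a)) + card N = card W"
    proof -
      have "(\<Sum>a\<in>?U. card (X a)) = card (\<Union>a\<in>?U. X a)"
        using finU finX by (intro card_UN_disjoint[symmetric]) (auto simp: X_def)
      moreover have "card W = card ((\<Union>a\<in>?U. X a) \<union> N)"
      proof -
        have "u \<in> (\<Union>a\<in>?U. X a) \<union> N" if "u \<in> W" for u
        proof (cases "\<kappa> u")
          case None
          then show ?thesis using that by (simp add: N_def)
        next
          case (Some a)
          then have "u \<in> X a" using that by (simp add: X_def)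
          then show ?thesis using E(4)[OF Some] by blast
        qed
        moreover have "X a \<subseteq> W" "N \<subseteq> W" for a by (auto simp: X_def N_def)
        ultimately have "W = (\<Union>a\<in>?U. X a) \<union> N" by blast
        then show ?thesis by (rule arg_cong)
      qed
      moreover have "card ((\<Union>a\<in>?U. X a) \<union> N) = card (\<Union>a\<in>?U. X a) + card N"
        by (intro card_Un_disjoint finite_UN_I finU finX) (auto simp: X_def N_def)
      ultimately show ?thesis by simp
    qed
    moreover have "card E + 6 \<le> 3 * card ?U" by (rule cycle_map_edge_bound[OF map])
    ultimately show ?thesis by linarith
  qed
qed

section \<open>Spreading fire and root paths\<close>

lemma card_saved_le_num_saved:
  assumes "finite V" "valid_strategy V E v P"
  shows "card (saved V E v P) \<le> num_saved V E v"
proof -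
  have "{card (saved V E v P) |P. valid_strategy V E v P} \<subseteq> {..card V}"
    using assms(1) by (auto simp: saved_def intro!: card_mono)
  then have "finite {card (saved V E v P) |P. valid_strategy V E v P}"
    using finite_subset by blast
  then show ?thesis unfolding num_saved_def using assms(2) by (intro Max_ge) blast+
qed

text \<open>Protecting S level by level is in time because the fire needs at least L w steps to reach w.\<close>

lemma num_saved_levels:
  assumes "finite V" and root: "L v = (0::nat)" and step: "\<And>u w. E u w \<Longrightarrow> L w \<le> L u + 1"
    and S: "S \<subseteq> V" "\<And>s. s \<in> S \<Longrightarrow> L s \<ge> 1" "card {s \<in> S. L s = 1} \<le> 4"
      "\<And>t. t \<ge> 2 \<Longrightarrow> card {s \<in> S. L s = t} \<le> 3"
    and Q: "Q \<subseteq> V" "v \<notin> Q" "\<And>u w. u \<in> Q - S \<Longrightarrow> E w u \<Longrightarrow> w \<in> Q"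
  shows "card Q \<le> num_saved V E v"
proof -
  define P where "P t = {s \<in> S. L s = t}" for t
  have lev: "L u \<le> t" if "u \<in> burning V E v P t" for u t
    using that
  proof (induction t arbitrary: u)
    case (Suc t)
    then consider "u \<in> burning V E v P t" | w where "w \<in> burning V E v P t" "E w u" by auto
    then show ?case
    proof cases
      case 1
      then show ?thesis using Suc.IH by fastforce
    next
      case 2
      then show ?thesis using Suc.IH[of w] step[of w u] by simp
    qed
  qed (simp add: root)
  have "valid_strategy V E v P"
    unfolding valid_strategy_def
  proof (intro allI impI conjI)
    fix t :: nat assume t: "1 \<le> t"
    show "P t \<subseteq> V - burning V E v P (t - 1)"
    proof
      fix s assume "s \<in> P t"
      then have "s \<in> V" "L s = t" using S(1) by (auto simp: P_def)
      moreover have "s \<notin> burning V E v P (t - 1)" using lev[of s "t - 1"] \<open>L s = t\<close> t by auto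
      ultimately show "s \<in> V - burning V E v P (t - 1)" by simp
    qed
    show "card (P t) \<le> budget t"
      using S(3) S(4)[of t] t by (auto simp: P_def budget_def)
  qed
  moreover have "Q \<inter> burning V E v P t = {}" for t
  proof (induction t)
    case (Suc t)
    \<comment> \<open>A vertex of \<open>Q\<close> could catch fire only from outside
      \<open>Q\<close>, so it belongs to \<open>S\<close>; its level is at most
      \<open>Suc t\<close>, hence it has been protected by then.\<close>
    have "u \<notin> Q" if u: "u \<in> V" "u \<notin> protected_upto P (Suc t)" "w \<in> burning V E v P t" "E w u" for u w
    proof
      assume uQ: "u \<in> Q"
      have "w \<notin> Q" using Suc u(3) by blast
      then have uS: "u \<in> S" using Q(3)[of u w] uQ u(4) by blast
      have "L u \<le> Suc t" using lev[OF u(3)] step[OF u(4)] by simp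
      then have "u \<in> protected_upto P (Suc t)"
        using S(2)[OF uS] uS by (auto simp: protected_upto_def P_def intro!: bexI[of _ "L u"])
      then show False using u(2) by simp
    qed
    then show ?case using Suc by auto
  qed (use Q(2) in simp)
  then have "Q \<subseteq> saved V E v P" using Q(1) unfolding saved_def by blast
  then have "card Q \<le> card (saved V E v P)"
    using \<open>finite V\<close> by (intro card_mono) (auto simp: saved_def)
  ultimately show ?thesis using card_saved_le_num_saved[OF \<open>finite V\<close>] by fastforce
qed

lemma breadth_first_levels:
  assumes "\<And>w. w \<in> U \<Longrightarrow> (v, w) \<in> R\<^sup>*" and R: "R \<subseteq> U \<times> U"
  obtains L :: "'a \<Rightarrow> nat" and par where "L v = 0" "\<And>u w. (u, w) \<in> R \<Longrightarrow> L w \<le> L u + 1"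
    "\<And>w. w \<in> U \<Longrightarrow> w \<noteq> v \<Longrightarrow> (par w, w) \<in> R \<and> L w = Suc (L (par w))"
proof -
  define L where "L w = (LEAST n. (v, w) \<in> R ^^ n)" for w
  have ex: "\<exists>n. (v, w) \<in> R ^^ n" if "w \<in> U" for w using assms(1)[OF that] rtrancl_power by blast
  have L: "(v, w) \<in> R ^^ L w" if "w \<in> U" for w
    unfolding L_def using ex[OF that] by (rule LeastI_ex)
  have le: "L w \<le> n" if "(v, w) \<in> R ^^ n" for w n
    unfolding L_def using that by (rule Least_le)
  have step: "L w \<le> L u + 1" if "(u, w) \<in> R" for u w
  proof -
    have "u \<in> U" using that R by blast
    then have "(v, w) \<in> R ^^ Suc (L u)" using L that by auto
    then show ?thesis using le by fastforce
  qed
  have "\<exists>u. (u, w) \<in> R \<and> L w = Suc (L u)" if w: "w \<in> U" "w \<noteq> v" for w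
  proof (cases "L w")
    case 0
    then show ?thesis using L[OF w(1)] w(2) by simp
  next
    case (Suc n)
    then obtain u where u: "(v, u) \<in> R ^^ n" "(u, w) \<in> R" using L[OF w(1)] by auto
    then show ?thesis using le[OF u(1)] step[OF u(2)] Suc by (intro exI[of _ u]) auto
  qed
  then obtain par where "\<And>w. w \<in> U \<Longrightarrow> w \<noteq> v \<Longrightarrow> (par w, w) \<in> R \<and> L w = Suc (L (par w))" by metis
  moreover have "L v = 0" using le[of v 0] by simp
  ultimately show ?thesis using that step by blast
qed

section \<open>Root paths and fundamental cycles\<close>

locale rooted_cycle_map =
  fixes E :: "'a set set" and F :: "'a list set" and v :: 'a and L :: "'a \<Rightarrow> nat" and par :: "'a \<Rightarrow> 'a"
  assumes map: "cycle_map E F" and root_in: "v \<in> \<Union>E" and L_root: "L v = 0"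
    and L_step: "{u, w} \<in> E \<Longrightarrow> L w \<le> L u + 1"
    and par: "w \<in> \<Union>E \<Longrightarrow> w \<noteq> v \<Longrightarrow> {par w, w} \<in> E \<and> L w = Suc (L (par w))"
begin

abbreviation "U \<equiv> \<Union>E"

lemma two: "two_faced E F" by (rule cycle_mapD(1)[OF map])

lemma par_U: "w \<in> U \<Longrightarrow> w \<noteq> v \<Longrightarrow> par w \<in> U" using par by blast

lemma finite_U: "finite U"
proof -
  have "finite e" if e: "e \<in> E" for e
  proof -
    obtain h where h: "h \<in> F" "e \<in> cycle_edges h" using two_facedE[OF two e] by metis
    then have "e \<subseteq> set h" using two_facedD(7)[OF two h(1)] by blast
    then show ?thesis using finite_subset by blast
  qed
  then show ?thesis using two_facedD(1)[OF two] by blast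
qed

lemma level_zero: "w \<in> U \<Longrightarrow> L w = 0 \<Longrightarrow> w = v" using par by fastforce

definition tree :: "'a set set" where "tree = {{par w, w} |w. w \<in> U \<and> w \<noteq> v}"

text \<open>The counter makes the recursion along \<open>par\<close> terminate; started with
  \<open>L w\<close>, as in \<open>up\<close>, it runs out exactly at the root.\<close>

fun climb :: "nat \<Rightarrow> 'a \<Rightarrow> 'a set" where
  "climb 0 w = {w}"
| "climb (Suc n) w = insert w (climb n (par w))"

fun climb_edges :: "nat \<Rightarrow> 'a \<Rightarrow> 'a set set" where
  "climb_edges 0 w = {}"
| "climb_edges (Suc n) w = insert {par w, w} (climb_edges n (par w))"

definition "up w = climb (L w) w"
definition "up_edges w = climb_edges (L w) w"

lemma up_induct [consumes 1, case_names root step]: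
  assumes "w \<in> U" "Q v"
    "\<And>w. w \<in> U \<Longrightarrow> w \<noteq> v \<Longrightarrow> par w \<in> U \<Longrightarrow> L w = Suc (L (par w)) \<Longrightarrow> Q (par w) \<Longrightarrow> Q w"
  shows "Q w"
  using assms(1)
proof (induction "L w" arbitrary: w)
  case 0
  then show ?case using level_zero assms(2) by metis
next
  case (Suc n)
  then have "w \<noteq> v" using L_root by auto
  then show ?case using Suc assms(3) par par_U by (metis nat.inject)
qed

lemma up_root: "up v = {v}" "up_edges v = {}" by (simp_all add: up_def up_edges_def L_root)

lemma up_step:
  assumes "w \<in> U" "w \<noteq> v"
  shows "up w = insert w (up (par w))" "up_edges w = insert {par w, w} (up_edges (par w))"
  using par[OF assms] by (simp_all add: up_def up_edges_def)

lemma up_self: "w \<in> U \<Longrightarrow> w \<in> up w"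
  using up_step up_root by (cases "w = v") auto

lemma up_level: "w \<in> U \<Longrightarrow> u \<in> up w \<Longrightarrow> u \<in> U \<and> L u \<le> L w"
proof (induction arbitrary: u rule: up_induct)
  case root
  then have "u = v" using up_root(1) by simp
  then show ?case using root_in by blast
next
  case (step w)
  then show ?case using up_step[OF step(1,2)] by fastforce
qed

lemma root_in_up: "w \<in> U \<Longrightarrow> v \<in> up w"
proof (induction rule: up_induct)
  case (step w)
  then show ?case using up_step[OF step(1,2)] by blast
qed (simp add: up_root)

text \<open>The level drops by one with each step to the parent. This is why a root path costs at
  most one firefighter per step.\<close>

lemma up_inj: "w \<in> U \<Longrightarrow> u \<in> up w \<Longrightarrow> u' \<in> up w \<Longrightarrow> L u = L u' \<Longrightarrow> u = u'"
proof (induction arbitrary: u u' rule: up_induct)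
  case (step w)
  have less: "L x < L w" if "x \<in> up (par w)" for x using up_level[OF step(3) that] step(4) by simp
  have "u = w \<or> u \<in> up (par w)" "u' = w \<or> u' \<in> up (par w)"
    using step(6,7) up_step(1)[OF step(1,2)] by blast+
  then show ?case using less[of u] less[of u'] step(5)[of u u'] step(8) by auto
qed (simp add: up_root)

text \<open>It supplies the neighbour of \<open>v\<close> that lies on the paths and therefore
  counts for neither side.\<close>

lemma up_level_one: "w \<in> U \<Longrightarrow> w \<noteq> v \<Longrightarrow> \<exists>u\<in>up w. L u = 1 \<and> {v, u} \<in> E"
proof (induction rule: up_induct)
  case (step w)
  show ?case
  proof (cases "par w = v")
    case True
    then show ?thesis using step up_step(1)[OF step(1,2)] par[OF step(1,2)] L_root by auto
  next
    case False
    then show ?thesis using step up_step(1)[OF step(1,2)] by auto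
  qed
qed simp

lemma up_edges_sub: "w \<in> U \<Longrightarrow> up_edges w \<subseteq> E \<inter> tree \<and> finite (up_edges w) \<and> (\<forall>e\<in>up_edges w. e \<subseteq> up w)"
proof (induction rule: up_induct)
  case (step w)
  have "{par w, w} \<in> E \<inter> tree" using par[OF step(1,2)] step(1,2) unfolding tree_def by blast
  moreover have "{par w, w} \<subseteq> up w" using up_step(1)[OF step(1,2)] up_self[OF step(3)] by blast
  ultimately show ?case using step(5) up_step[OF step(1,2)] by auto
qed (simp add: up_root)

lemma up_edges_level: "w \<in> U \<Longrightarrow> e \<in> up_edges w \<Longrightarrow> u \<in> e \<Longrightarrow> L u \<le> L w"
  using up_edges_sub up_level by blast

lemma odd_degree_up: "w \<in> U \<Longrightarrow> odd (edge_degree (up_edges w) x) \<longleftrightarrow> ((x = w) \<noteq> (x = v))"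
proof (induction rule: up_induct)
  case root
  then show ?case by (simp add: up_root edge_degree_def)
next
  case (step w)
  have "{par w, w} \<notin> up_edges (par w)"
    using up_edges_level[OF step(3), of "{par w, w}" w] step(4) by auto
  then have eq: "up_edges w = sym_diff {{par w, w}} (up_edges (par w))"
    using up_step(2)[OF step(1,2)] by auto
  have "par w \<noteq> w" using step(4) by (metis n_not_Suc_n)
  then show ?case
    unfolding eq using step(2,5) up_edges_sub[OF step(3)]
    by (subst odd_degree_sym_diff) (auto simp: degree_single)
qed

text \<open>In a nonempty set of tree edges, a child end of maximal level has degree one.\<close>

lemma tree_even_empty:
  assumes "even_graph Y" "Y \<subseteq> tree" shows "Y = {}"
proof (rule ccontr)
  assume "Y \<noteq> {}"
  let ?W = "{w \<in> U. w \<noteq> v \<and> {par w, w} \<in> Y}"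
  obtain e where "e \<in> Y" using \<open>Y \<noteq> {}\<close> by blast
  then have "e \<in> tree" using assms(2) by (rule subsetD[rotated])
  then obtain x where x: "x \<in> U" "x \<noteq> v" "e = {par x, x}" unfolding tree_def by auto
  have "x \<in> ?W" using x(1,2) \<open>e \<in> Y\<close> unfolding x(3) by auto
  then have "?W \<noteq> {}" by blast
  moreover have "finite ?W" by (rule finite_subset[OF _ finite_U]) blast
  ultimately have fin: "finite (L ` ?W)" "L ` ?W \<noteq> {}" by simp_all
  obtain w where w: "Max (L ` ?W) = L w" "w \<in> ?W" by (rule imageE[OF Max_in[OF fin]])
  have wmax: "L u \<le> L w" if "u \<in> ?W" for u
    unfolding w(1)[symmetric] by (rule Max_ge[OF fin(1) imageI[OF that]])
  have "{e \<in> Y. w \<in> e} = {{par w, w}}"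
  proof
    show "{e \<in> Y. w \<in> e} \<subseteq> {{par w, w}}"
    proof
      fix e assume e: "e \<in> {e \<in> Y. w \<in> e}"
      then obtain u where u: "u \<in> U" "u \<noteq> v" "e = {par u, u}" using assms(2) unfolding tree_def by blast
      then have "u \<in> ?W" using e by simp
      then have "L u \<le> L w" by (rule wmax)
      then have "w \<noteq> par u" using par[OF u(1,2)] by auto
      then show "e \<in> {{par w, w}}" using e u(3) by auto
    qed
  qed (use w(2) in auto)
  then have "edge_degree Y w = 1" by (simp add: edge_degree_def)
  then show False using assms(1) unfolding even_graph_def by (metis odd_one)
qed

text \<open>A sum over the two-element field, in which the common beginning of the two root paths
  cancels. If \<open>B\<close> is a single nontree edge from \<open>x\<close> to \<open>y\<close>,
  this is its fundamental cycle.\<close>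

definition joined :: "'a \<Rightarrow> 'a \<Rightarrow> 'a set set \<Rightarrow> 'a set set" where
  "joined x y B = sym_diff (sym_diff (up_edges x) (up_edges y)) B"

lemma even_joined:
  assumes "x \<in> U" "y \<in> U" "finite B" "\<And>z. odd (edge_degree B z) \<longleftrightarrow> ((z = x) \<noteq> (z = y))"
  shows "even_graph (joined x y B)"
proof -
  have fin: "finite (up_edges x)" "finite (up_edges y)" using up_edges_sub assms by blast+
  have "even (edge_degree (joined x y B) z)" for z
    unfolding joined_def
    using odd_degree_sym_diff[of "sym_diff (up_edges x) (up_edges y)" B z]
      odd_degree_sym_diff[of "up_edges x" "up_edges y" z]
      odd_degree_up[OF assms(1), of z] odd_degree_up[OF assms(2), of z] assms(3) assms(4)[of z] fin
    by (metis finite_Diff finite_UnI)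
  moreover have "finite (joined x y B)" unfolding joined_def using fin assms(3) by blast
  ultimately show ?thesis unfolding even_graph_def by blast
qed

lemma joined_sub: "x \<in> U \<Longrightarrow> y \<in> U \<Longrightarrow> joined x y B \<subseteq> tree \<union> B"
  "x \<in> U \<Longrightarrow> y \<in> U \<Longrightarrow> B \<subseteq> E \<Longrightarrow> joined x y B \<subseteq> E"
  unfolding joined_def using up_edges_sub by blast+

lemma joined_avoid:
  assumes "x \<in> U" "y \<in> U" "w \<notin> up x" "w \<notin> up y" "\<And>e. e \<in> B \<Longrightarrow> w \<notin> e" "e \<in> joined x y B"
  shows "w \<notin> e"
  using assms up_edges_sub[of x] up_edges_sub[of y] unfolding joined_def by blast

text \<open>An even set bounds two complementary sets of faces. Leaving out a fixed face
  \<open>f\<close> selects one of them, and by \<open>side_unique\<close> exactly one.\<close>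

lemma side_exists:
  assumes "f \<in> F" "Z \<subseteq> E" "even_graph Z"
  shows "\<exists>A\<subseteq>F. f \<notin> A \<and> face_boundary F A = Z"
proof -
  obtain A where A: "A \<subseteq> F" "face_boundary F A = Z" using cycle_mapD(3)[OF map assms(2,3)] by blast
  show ?thesis
  proof (cases "f \<in> A")
    case True
    then show ?thesis using face_boundary_complement[OF A(1)] A by (intro exI[of _ "F - A"]) auto
  qed (use A in blast)
qed

lemma side_unique:
  assumes "A \<subseteq> F" "B \<subseteq> F" "f \<in> F" "f \<notin> A" "f \<notin> B" "face_boundary F A = face_boundary F B"
  shows "A = B"
proof -
  have "face_boundary F (sym_diff A B) = {}"
    using face_boundary_sym_diff[OF two assms(1,2)] assms(6) by simp
  moreover have "sym_diff A B \<subseteq> F" using assms by blast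
  ultimately have "sym_diff A B = {} \<or> sym_diff A B = F" using cycle_mapD(2)[OF map] by blast
  then show ?thesis using assms(3-5) by blast
qed

text \<open>The boundary of \<open>B \<inter> D\<close> contains \<open>e'\<close> but not
  \<open>e\<close>, as the faces at these two edges show. It therefore differs from the boundary of
  \<open>D\<close> by an even set of tree edges, which is empty; since \<open>f\<close> is in
  neither set, \<open>B \<inter> D = D\<close>.\<close>

lemma laminar:
  assumes B: "B \<subseteq> F" "face_boundary F B \<subseteq> tree \<union> {e}" "e \<in> face_boundary F B"
    and D: "D \<subseteq> F" "face_boundary F D \<subseteq> tree \<union> {e'}" "e' \<in> face_boundary F D"
    and e: "e \<noteq> e'" "e \<notin> tree" "e' \<notin> tree" "e \<in> cycle_edges f" "e' \<in> cycle_edges f"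
    and f: "f \<in> F" "f \<in> B" "f \<notin> D"
  shows "D \<subseteq> B"
proof -
  have eE: "e \<in> E" "e' \<in> E" using face_boundary_subset[OF two] B D by blast+
  have other: "\<exists>g. g \<noteq> f \<and> {h \<in> F. a \<in> cycle_edges h} = {f, g}" if a: "a \<in> E" "a \<in> cycle_edges f" for a
  proof -
    obtain g h where gh: "g \<noteq> h" "{k \<in> F. a \<in> cycle_edges k} = {g, h}" using two_facedE[OF two a(1)] by metis
    have "f \<in> {g, h}" unfolding gh(2)[symmetric] using a(2) f(1) by simp
    then show ?thesis using gh by (metis doubleton_eq_iff empty_iff insert_iff)
  qed
  obtain h where h: "h \<noteq> f" "{k \<in> F. e \<in> cycle_edges k} = {f, h}" using other[OF eE(1) e(4)] by blast
  obtain g where g: "g \<noteq> f" "{k \<in> F. e' \<in> cycle_edges k} = {f, g}" using other[OF eE(2) e(5)] by blast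
  have BD: "B \<inter> D \<subseteq> F" using B by blast
  have "e \<notin> face_boundary F D" "e' \<notin> face_boundary F B" using B D e by blast+
  then have "h \<notin> B" "g \<in> D" "g \<in> B"
    using in_face_boundary[OF h(1)[symmetric] h(2)] in_face_boundary[OF g(1)[symmetric] g(2)] B D f by blast+
  then have Y: "e' \<in> face_boundary F (B \<inter> D)" "e \<notin> face_boundary F (B \<inter> D)"
    using in_face_boundary[OF h(1)[symmetric] h(2) BD] in_face_boundary[OF g(1)[symmetric] g(2) BD] f by blast+
  have "face_boundary F (B \<inter> D) \<subseteq> face_boundary F B \<union> face_boundary F D"
    unfolding face_boundary_def by blast
  then have "sym_diff (face_boundary F (B \<inter> D)) (face_boundary F D) \<subseteq> tree"
    using B(2) D(2,3) Y by blast
  moreover have "even_graph (sym_diff (face_boundary F (B \<inter> D)) (face_boundary F D))"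
    using even_face_boundary[OF two BD] even_face_boundary[OF two D(1)] even_graph_sym_diff by blast
  ultimately have "sym_diff (face_boundary F (B \<inter> D)) (face_boundary F D) = {}" using tree_even_empty by blast
  then have "face_boundary F (B \<inter> D) = face_boundary F D" by blast
  then have "B \<inter> D = D" using side_unique[OF BD D(1) f(1)] f(3) by blast
  then show ?thesis by blast
qed

end

section \<open>Separation by two root paths\<close>

context rooted_cycle_map
begin

text \<open>The root paths are removed in full, including their common beginning, because all of
  their vertices other than the root will be protected.\<close>

definition enclosed :: "'a \<Rightarrow> 'a \<Rightarrow> 'a list set \<Rightarrow> 'a set" where
  "enclosed x y B = {w \<in> U - up x - up y. \<forall>h\<in>F. w \<in> set h \<longrightarrow> h \<in> B}"

definition separating_edge :: "'a \<Rightarrow> 'a \<Rightarrow> 'a list set \<Rightarrow> bool" where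
  "separating_edge x y B \<longleftrightarrow>
     {x, y} \<in> E - tree \<and> B \<subseteq> F \<and> face_boundary F B = joined x y {{x, y}}"

text \<open>That edges are not loops is read off a facial cycle, whose vertices are
  distinct.\<close>

lemma edge_ne: "{x, y} \<in> E \<Longrightarrow> x \<noteq> y"
proof -
  assume e: "{x, y} \<in> E"
  obtain h where h: "h \<in> F" "{x, y} \<in> cycle_edges h" using two_facedE[OF two e] by metis
  obtain ps a b qs where s: "h @ [hd h] = ps @ a # b # qs" "{x, y} = {a, b}"
    using path_edges_split h(2) unfolding cycle_edges_def by metis
  note d = two_facedD(3,4,8)[OF two h(1)]
  have "a \<noteq> b"
  proof (cases qs rule: rev_cases)
    case Nil
    have "h @ [hd h] = (ps @ [a]) @ [b]" unfolding s(1) Nil by simp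
    then have h': "h = ps @ [a]" "hd h = b" using append1_eq_conv[of h "hd h" "ps @ [a]" b] by blast+
    then obtain c cs where "ps = c # cs" using d(2) by (cases ps) auto
    then show ?thesis using h' d(1) by auto
  next
    case (snoc rs z)
    have "h @ [hd h] = (ps @ a # b # rs) @ [z]" unfolding s(1) snoc by simp
    then have "h = ps @ a # b # rs" by (metis butlast_snoc)
    then show ?thesis using d(1) by auto
  qed
  then show "x \<noteq> y" using s(2) by (auto simp: doubleton_eq_iff)
qed

lemma odd_degree_edge: "x \<noteq> y \<Longrightarrow> odd (edge_degree {{x, y}} z) \<longleftrightarrow> ((z = x) \<noteq> (z = y))"
  by (auto simp: degree_single)

lemma even_joined_edge: "{x, y} \<in> E \<Longrightarrow> even_graph (joined x y {{x, y}})"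
  by (rule even_joined[OF _ _ _ odd_degree_edge[OF edge_ne]]) auto

text \<open>Every edge at \<open>w\<close> has two faces, so \<open>w\<close> still has a face when
  \<open>f\<close> is disregarded. This matters once the separating curve runs through
  \<open>f\<close>.\<close>

lemma face_through_vertex:
  assumes "w \<in> U" obtains h where "h \<in> F" "h \<noteq> f" "w \<in> set h"
proof -
  obtain e where e: "e \<in> E" "w \<in> e" using assms by blast
  obtain g k where gk: "g \<noteq> k" "g \<in> F" "k \<in> F" "e \<in> cycle_edges g" "e \<in> cycle_edges k"
    using two_facedE[OF two e(1)] by metis
  have "w \<in> set g" "w \<in> set k" using gk e(2) two_facedD(7)[OF two] by blast+
  then show ?thesis using that gk by metis
qed

lemma face_through_edge:
  assumes "e \<in> E" obtains h where "h \<in> F" "h \<noteq> f" "e \<subseteq> set h"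
proof -
  obtain g k where gk: "g \<noteq> k" "g \<in> F" "k \<in> F" "e \<in> cycle_edges g" "e \<in> cycle_edges k"
    using two_facedE[OF two assms] by metis
  have "e \<subseteq> set g" "e \<subseteq> set k" using gk two_facedD(7)[OF two] by blast+
  then show ?thesis using that gk by metis
qed

text \<open>A vertex off both root paths is on no boundary edge, so the faces around it cannot be
  separated.\<close>

lemma uniform_sides:
  assumes "x \<in> U" "y \<in> U" "{x, y} \<in> E" "B \<subseteq> F" "face_boundary F B = joined x y {{x, y}}"
    "w \<notin> up x" "w \<notin> up y" "g \<in> F" "h \<in> F" "w \<in> set g" "w \<in> set h" "g \<in> B"
  shows "h \<in> B"
proof -
  have xy: "w \<noteq> x" "w \<noteq> y" using assms(1,2,6,7) up_self by blast+
  have "w \<notin> e" if "e \<in> face_boundary F B" for e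
    using joined_avoid[OF assms(1,2,6,7), of "{{x, y}}" e] that xy unfolding assms(5) by blast
  then show ?thesis using cycle_mapD(4)[OF map assms(4), of w g h] assms(8-12) by blast
qed

lemma sum_le_Un:
  fixes \<omega> :: "'a \<Rightarrow> nat"
  assumes "finite A" "finite B" shows "sum \<omega> (A \<union> B) \<le> sum \<omega> A + sum \<omega> B"
  using sum.union_inter[OF assms, of \<omega>] by linarith

lemma exists_nontree_edge: "\<exists>e\<in>E. e \<notin> tree"
proof (rule ccontr)
  assume "\<not> ?thesis"
  then have ET: "E \<subseteq> tree" by blast
  obtain f where f: "f \<in> F" using face_through_vertex[OF root_in] by metis
  have "cycle_edges f = {}"
    using tree_even_empty[OF two_facedD(6)[OF two f]] two_facedD(5)[OF two f] ET by blast
  then show False using cycle_edges_insert[OF two_facedD(8)[OF two f]] by blast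
qed

text \<open>The argument of Lipton and Tarjan: among the fundamental cycles with a heavy side, take one whose
  heavy side has the fewest faces. The root paths to the vertices of the face on that side of its
  edge sweep the heavy side in small steps, so two of them split the graph evenly.\<close>

lemma balanced_root_paths:
  fixes \<omega> :: "'a \<Rightarrow> nat" and k :: nat
  assumes k: "k \<ge> 1" and paths: "\<And>x. x \<in> U \<Longrightarrow> sum \<omega> (up x - {v}) < k"
    and total: "sum \<omega> (U - {v}) \<ge> 6 * k"
  obtains x y I J where "x \<in> U" "y \<in> U" "x \<noteq> y" "I \<union> J = U - up x - up y" "I \<inter> J = {}"
    "\<forall>a\<in>I. \<forall>b\<in>J. {a, b} \<notin> E" "sum \<omega> I \<ge> k" "sum \<omega> J \<ge> k"
proof -
  have finU: "finite X" if "X \<subseteq> U" for X using that finite_U by (rule finite_subset)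
  have sumU: "sum \<omega> X \<le> sum \<omega> Y" if "X \<subseteq> Y" "Y \<subseteq> U" for X Y
    using that finU by (intro sum_mono2) auto
  have upU: "up x \<subseteq> U" if "x \<in> U" for x using up_level[OF that] by blast
  \<comment> \<open>A configuration is a nontree edge with either side of its fundamental cycle,
    provided that this side encloses weight at least \<open>k\<close>.\<close>
  define config where "config = (\<lambda>(x, y, B). separating_edge x y B \<and> sum \<omega> (enclosed x y B) \<ge> k)"
  have "\<exists>c. config c"
  proof -
    obtain x y where xy: "{x, y} \<in> E" "{x, y} \<notin> tree"
    proof -
      obtain e where e: "e \<in> E" "e \<notin> tree" using exists_nontree_edge by blast
      obtain h where "h \<in> F" "e \<in> cycle_edges h" using two_facedE[OF two e(1)] by metis
      then show ?thesis using path_edges_split[of e] e that unfolding cycle_edges_def by metis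
    qed
    have U: "x \<in> U" "y \<in> U" using xy(1) by blast+
    obtain B where B: "B \<subseteq> F" "face_boundary F B = joined x y {{x, y}}"
      using cycle_mapD(3)[OF map _ even_joined_edge[OF xy(1)]] joined_sub(2)[OF U] xy(1) by blast
    have B': "F - B \<subseteq> F" "face_boundary F (F - B) = joined x y {{x, y}}"
      using B face_boundary_complement by blast+
    \<comment> \<open>Off the two root paths every vertex is enclosed by one of the two sides. The
      paths weigh less than \<open>2 * k\<close> out of at least \<open>6 * k\<close>, so one of the
      sides is heavy.\<close>
    have "U - {v} \<subseteq> (enclosed x y B \<union> enclosed x y (F - B)) \<union> ((up x - {v}) \<union> (up y - {v}))"
    proof
      fix w assume w: "w \<in> U - {v}"
      show "w \<in> (enclosed x y B \<union> enclosed x y (F - B)) \<union> ((up x - {v}) \<union> (up y - {v}))"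
      proof (cases "w \<in> up x \<or> w \<in> up y")
        case False
        then have nx: "w \<notin> up x" "w \<notin> up y" by blast+
        obtain h where h: "h \<in> F" "w \<in> set h" using face_through_vertex[of w] w by blast
        show ?thesis
        proof (cases "h \<in> B")
          case True
          then have "w \<in> enclosed x y B"
            using uniform_sides[OF U xy(1) B nx h(1) _ h(2)] w nx unfolding enclosed_def by blast
          then show ?thesis by blast
        next
          case False
          then have "w \<in> enclosed x y (F - B)"
            using uniform_sides[OF U xy(1) B' nx h(1) _ h(2)] h w nx unfolding enclosed_def by blast
          then show ?thesis by blast
        qed
      qed (use w in blast)
    qed
    moreover have "enclosed x y B \<subseteq> U" "enclosed x y (F - B) \<subseteq> U" by (auto simp: enclosed_def)
    moreover have "up x \<subseteq> U" "up y \<subseteq> U" using upU U by blast+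
    ultimately have "sum \<omega> (U - {v}) \<le> sum \<omega> ((enclosed x y B \<union> enclosed x y (F - B)) \<union> ((up x - {v}) \<union> (up y - {v})))"
      by (intro sumU) blast+
    also have "\<dots> \<le> (sum \<omega> (enclosed x y B) + sum \<omega> (enclosed x y (F - B))) + (sum \<omega> (up x - {v}) + sum \<omega> (up y - {v}))"
    proof -
      have fin: "finite (enclosed x y B)" "finite (enclosed x y (F - B))" "finite (up x - {v})" "finite (up y - {v})"
        using \<open>enclosed x y B \<subseteq> U\<close> \<open>enclosed x y (F - B) \<subseteq> U\<close> \<open>up x \<subseteq> U\<close> \<open>up y \<subseteq> U\<close> finU by blast+
      show ?thesis
        using sum_le_Un[of "enclosed x y B \<union> enclosed x y (F - B)" "(up x - {v}) \<union> (up y - {v})" \<omega>]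
          sum_le_Un[OF fin(1,2), of \<omega>] sum_le_Un[OF fin(3,4), of \<omega>] fin by simp
    qed
    finally have "sum \<omega> (enclosed x y B) \<ge> k \<or> sum \<omega> (enclosed x y (F - B)) \<ge> k"
      using paths[OF U(1)] paths[OF U(2)] total by linarith
    moreover have "separating_edge x y B" "separating_edge x y (F - B)"
      using B B' xy by (auto simp: separating_edge_def)
    ultimately have "config (x, y, B) \<or> config (x, y, F - B)" unfolding config_def by simp
    then show ?thesis by blast
  qed
  then obtain c0 where "config c0" by blast
  then have "\<exists>c. config c \<and> (\<forall>d. config d \<longrightarrow> card (snd (snd c)) \<le> card (snd (snd d)))"
    by (rule ex_has_least_nat)
  then obtain c where c: "config c" and c_least: "\<And>d. config d \<Longrightarrow> card (snd (snd c)) \<le> card (snd (snd d))"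
    by blast
  obtain x y B where cxy: "c = (x, y, B)" by (cases c)
  have xyB: "separating_edge x y B" "sum \<omega> (enclosed x y B) \<ge> k"
    using c unfolding cxy config_def by simp_all
  have least: "card B \<le> card D" if "separating_edge x' y' D" "sum \<omega> (enclosed x' y' D) \<ge> k" for x' y' D
    using c_least[of "(x', y', D)"] that unfolding cxy config_def by simp
  have xy: "{x, y} \<in> E" "{x, y} \<notin> tree" and B: "B \<subseteq> F" "face_boundary F B = joined x y {{x, y}}"
    using xyB(1) by (auto simp: separating_edge_def)
  have xyU: "x \<in> U" "y \<in> U" using UnionI[OF xy(1)] by simp_all
  have "{x, y} \<notin> up_edges x" "{x, y} \<notin> up_edges y"
    using up_edges_sub[OF xyU(1)] up_edges_sub[OF xyU(2)] xy(2) by auto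
  then have eB: "{x, y} \<in> face_boundary F B" unfolding B(2) joined_def by simp
  then obtain f where f: "f \<in> F" "f \<in> B" "{x, y} \<in> cycle_edges f"
    using B(1) unfolding face_boundary_def by blast
  obtain c where c: "cycle_edges c = cycle_edges f" "set c = set f" "distinct c"
    "length c = length f" "{x, y} = {last c, hd c}"
    by (rule cycle_edges_rotate_to[OF f(3) two_facedD(3)[OF two f(1)] two_facedD(8)[OF two f(1)]])
  have lc: "length c \<ge> 3" using two_facedD(4)[OF two f(1)] c(4) by simp
  then have cne: "c \<noteq> []" by auto
  let ?m = "length c - 1"
  have cU: "set c \<subseteq> U" using two_facedD(5,7)[OF two f(1)] c(2) by blast
  have ccyc: "cycle_edges c = insert {x, y} (path_edges c)" unfolding c(5) by (rule cycle_edges_insert[OF cne])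
  have cE: "cycle_edges c \<subseteq> E" unfolding c(1) by (rule two_facedD(5)[OF two f(1)])
  have c0: "hd c = c ! 0" "last c = c ! ?m" using cne by (simp_all add: hd_conv_nth last_conv_nth)
  have nU: "c ! i \<in> U" if "i \<le> ?m" for i
  proof -
    have "i < length c" using that lc by linarith
    then show ?thesis using cU nth_mem by blast
  qed
  have inside_sym: "enclosed x y B = enclosed (c ! 0) (c ! ?m) B"
    "joined x y {{x, y}} = joined (c ! 0) (c ! ?m) {{x, y}}"
    using c(5) unfolding c0 enclosed_def joined_def by (auto simp: doubleton_eq_iff)
  \<comment> \<open>\<open>c\<close> runs around \<open>f\<close> with \<open>{x, y}\<close> as its
    closing edge; \<open>pre j\<close> is the stretch from \<open>c ! 0\<close> to
    \<open>c ! j\<close>, and \<open>ed j\<close> is the next edge.\<close>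
  define pre where "pre j = path_edges (take (Suc j) c)" for j
  define ed where "ed j = {c ! j, c ! Suc j}" for j
  have pre_E: "pre j \<subseteq> path_edges c" for j
  proof (cases "Suc j < length c")
    case True
    have "c = take j c @ c ! j # drop (Suc j) c" using True by (simp add: id_take_nth_drop)
    then have "path_edges c = path_edges (take j c @ [c ! j]) \<union> path_edges (c ! j # drop (Suc j) c)"
      using path_edges_append by metis
    then show ?thesis using True by (simp add: pre_def take_Suc_conv_app_nth)
  next
    case False
    then show ?thesis by (simp add: pre_def)
  qed
  have pre_Suc: "pre (Suc j) = sym_diff (pre j) {ed j}" if j: "j < ?m" for j
  proof -
    have t: "take (Suc (Suc j)) c = take (Suc j) c @ [c ! Suc j]" using j by (simp add: take_Suc_conv_app_nth)
    have l: "last (take (Suc j) c) = c ! j" using j by (simp add: take_Suc_conv_app_nth)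
    have ne: "take (Suc j) c \<noteq> []" using cne by simp
    have "pre (Suc j) = insert (ed j) (pre j)"
      unfolding pre_def t ed_def by (subst path_edges_snoc[OF ne]) (simp add: l)
    moreover have "ed j \<notin> pre j"
    proof
      assume "ed j \<in> pre j"
      then have "c ! Suc j \<in> set (take (Suc j) c)" using path_edges_subset unfolding pre_def ed_def by blast
      moreover have "distinct (take (Suc (Suc j)) c)" using c(3) by simp
      ultimately show False unfolding t by auto
    qed
    ultimately show ?thesis by blast
  qed
  have edE: "ed j \<in> cycle_edges c" "ed j \<noteq> {x, y}" if "j < ?m" for j
  proof -
    have j: "Suc j < length c" using that by linarith
    have t: "take (Suc (Suc j)) c = take j c @ c ! j # [c ! Suc j]" using j by (simp add: take_Suc_conv_app_nth)
    have "ed j \<in> pre (Suc j)" unfolding pre_def t ed_def by (subst path_edges_append) simp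
    then have "ed j \<in> path_edges c" using pre_E by blast
    then show "ed j \<in> cycle_edges c" unfolding ccyc by blast
    show "ed j \<noteq> {x, y}" using \<open>ed j \<in> path_edges c\<close> closing_edge_notin[OF c(3) lc] c(5) by auto
  qed
  \<comment> \<open>A j is the side, away from f, of the closed curve formed by the root paths to c ! 0 and c ! j
    and the stretch of f between them; D j is the same for the single edge from c ! j to c ! Suc j.\<close>
  have "\<exists>A\<subseteq>F. f \<notin> A \<and> face_boundary F A = joined (c ! 0) (c ! j) (pre j)" if j: "j \<le> ?m" for j
  proof (rule side_exists[OF f(1)])
    show "joined (c ! 0) (c ! j) (pre j) \<subseteq> E"
      using pre_E[of j] ccyc cE nU j by (intro joined_sub(2)) auto
    have l: "last (take (Suc j) c) = c ! j" using j lc by (simp add: take_Suc_conv_app_nth)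
    have "odd (edge_degree (pre j) z) \<longleftrightarrow> ((z = c ! 0) \<noteq> (z = c ! j))" for z
      using odd_degree_path[of "take (Suc j) c" z] c(3) cne l c0(1) by (simp add: pre_def)
    then show "even_graph (joined (c ! 0) (c ! j) (pre j))"
      using nU j by (intro even_joined) (auto simp: pre_def)
  qed
  then obtain A where A: "\<And>j. j \<le> ?m \<Longrightarrow> A j \<subseteq> F" "\<And>j. j \<le> ?m \<Longrightarrow> f \<notin> A j"
    "\<And>j. j \<le> ?m \<Longrightarrow> face_boundary F (A j) = joined (c ! 0) (c ! j) (pre j)" by metis
  have "\<exists>D\<subseteq>F. f \<notin> D \<and> face_boundary F D = joined (c ! j) (c ! Suc j) {ed j}" if j: "j < ?m" for j
  proof (rule side_exists[OF f(1)])
    have e: "ed j \<in> E" using edE(1)[OF j] cE by blast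
    then show "joined (c ! j) (c ! Suc j) {ed j} \<subseteq> E" using nU j by (intro joined_sub(2)) auto
    show "even_graph (joined (c ! j) (c ! Suc j) {ed j})" using even_joined_edge e unfolding ed_def by blast
  qed
  then obtain D where D: "\<And>j. j < ?m \<Longrightarrow> D j \<subseteq> F" "\<And>j. j < ?m \<Longrightarrow> f \<notin> D j"
    "\<And>j. j < ?m \<Longrightarrow> face_boundary F (D j) = joined (c ! j) (c ! Suc j) {ed j}" by metis
  have A0: "A 0 = {}"
  proof (rule side_unique[OF A(1) _ f(1) A(2)])
    have "pre 0 = {}" using cne by (cases c) (simp_all add: pre_def)
    then show "face_boundary F (A 0) = face_boundary F {}"
      using A(3)[of 0] by (simp add: joined_def face_boundary_empty)
  qed auto
  \<comment> \<open>The root path to \<open>c ! j\<close> occurs twice and cancels, so moving the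
    end by one vertex adds just \<open>D j\<close>.\<close>
  have ASuc: "A (Suc j) = sym_diff (A j) (D j)" if j: "j < ?m" for j
  proof (rule side_unique[OF A(1) _ f(1) A(2)])
    have "face_boundary F (sym_diff (A j) (D j)) = sym_diff (face_boundary F (A j)) (face_boundary F (D j))"
      using face_boundary_sym_diff[OF two A(1) D(1)] j by simp
    also have "\<dots> = joined (c ! 0) (c ! Suc j) (pre (Suc j))"
      using A(3)[of j] D(3)[of j] j pre_Suc[OF j] unfolding joined_def by auto
    finally show "face_boundary F (A (Suc j)) = face_boundary F (sym_diff (A j) (D j))"
      using A(3)[of "Suc j"] j by simp
    show "sym_diff (A j) (D j) \<subseteq> F" "f \<notin> sym_diff (A j) (D j)"
      using A(1,2)[of j] D(1,2)[of j] j by auto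
  qed (use j in auto)
  \<comment> \<open>The full stretch together with \<open>{x, y}\<close> is the boundary of
    \<open>f\<close>, so at the last position the sweep has covered the heavy side except for
    \<open>f\<close>.\<close>
  have Am: "A ?m = B - {f}"
  proof (rule side_unique[OF A(1) _ f(1) A(2)])
    have "B - {f} = sym_diff B {f}" using f(2) by blast
    then have "face_boundary F (B - {f}) = sym_diff (face_boundary F B) (face_boundary F {f})"
      using face_boundary_sym_diff[OF two B(1), of "{f}"] f(1) by simp
    also have "\<dots> = sym_diff (joined (c ! 0) (c ! ?m) {{x, y}}) (insert {x, y} (path_edges c))"
      unfolding B(2) inside_sym(2) face_boundary_single[OF two f(1)] c(1)[symmetric] ccyc ..
    also have "\<dots> = joined (c ! 0) (c ! ?m) (path_edges c)"
      using closing_edge_notin[OF c(3) lc] c(5) unfolding joined_def by auto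
    also have "path_edges c = pre ?m" using cne by (simp add: pre_def)
    finally show "face_boundary F (A ?m) = face_boundary F (B - {f})" using A(3)[of ?m] by simp
  qed (use B(1) in auto)
  have Dtree: "D j = {}" if j: "j < ?m" and t: "ed j \<in> tree" for j
  proof (rule side_unique[OF D(1)[OF j] _ f(1) D(2)[OF j]])
    have "face_boundary F (D j) = {}"
      using even_face_boundary[OF two D(1)[OF j]] joined_sub(1)[OF nU nU, of j "Suc j" "{ed j}"] t D(3)[OF j] j
      by (intro tree_even_empty) auto
    then show "face_boundary F (D j) = face_boundary F {}" by (simp add: face_boundary_empty)
  qed auto
  have DB: "D j \<subseteq> B" if j: "j < ?m" for j
  proof (cases "ed j \<in> tree")
    case True
    then show ?thesis using Dtree[OF j] by simp
  next
    case False
    have ej: "ed j \<in> cycle_edges f" using edE(1)[OF j] c(1) by simp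
    show ?thesis
    proof (rule laminar[OF B(1) _ eB D(1)[OF j] _ _ _ xy(2) False f(3) ej f(1,2) D(2)[OF j]])
      show "face_boundary F B \<subseteq> tree \<union> {{x, y}}"
        unfolding B(2) using xy(1) by (intro joined_sub(1)) auto
      show "face_boundary F (D j) \<subseteq> tree \<union> {ed j}"
        unfolding D(3)[OF j] using nU j by (intro joined_sub(1)) auto
      show "ed j \<in> face_boundary F (D j)"
        unfolding D(3)[OF j] joined_def
        using False up_edges_sub[of "c ! j"] up_edges_sub[of "c ! Suc j"] nU[of j] nU[of "Suc j"] j by auto
      show "{x, y} \<noteq> ed j" using edE(2)[OF j] by simp
    qed
  qed
  \<comment> \<open>This is the minimality of \<open>B\<close>: each \<open>D j\<close> lies in
    \<open>B\<close> and leaves out \<open>f\<close>, so it has fewer faces and cannot be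
    heavy.\<close>
  have Dsmall: "sum \<omega> (enclosed (c ! j) (c ! Suc j) (D j)) < k" if j: "j < ?m" for j
  proof (rule ccontr)
    assume big: "\<not> ?thesis"
    have e: "ed j \<in> E" using edE(1)[OF j] cE by blast
    show False
    proof (cases "ed j \<in> tree")
      case True
      then have "D j = {}" by (rule Dtree[OF j])
      then have "enclosed (c ! j) (c ! Suc j) (D j) = {}"
        using face_through_vertex unfolding enclosed_def by blast
      then have "sum \<omega> (enclosed (c ! j) (c ! Suc j) (D j)) = 0" by (simp only: sum.empty)
      then show False using big k by simp
    next
      case False
      then have "separating_edge (c ! j) (c ! Suc j) (D j)"
        using D(1,3)[OF j] e by (auto simp: separating_edge_def ed_def)
      then have "card B \<le> card (D j)" using least big by simp
      moreover have "D j \<subset> B" using DB[OF j] f(2) D(2)[OF j] by blast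
      then have "card (D j) < card B" using psubset_card_mono finite_subset[OF B(1) two_facedD(2)[OF two]] by blast
      ultimately show False by simp
    qed
  qed
  \<comment> \<open>The hard case is a vertex \<open>w\<close> on the stretch \<open>pre j\<close>.
    Adding \<open>f\<close> to \<open>A j\<close> exchanges this stretch for the complementary part
    of the boundary of \<open>f\<close>, which avoids \<open>w\<close>.\<close>
  have uniform: "h \<in> A j"
    if j: "j \<le> ?m" and w: "w \<notin> up (c ! 0)" "w \<notin> up (c ! j)"
      and gh: "g \<in> F" "h \<in> F" "g \<noteq> f" "h \<noteq> f" "w \<in> set g" "w \<in> set h" "g \<in> A j" for j w g h
  proof (cases "w \<in> set (take (Suc j) c)")
    case False
    have "w \<notin> e" if "e \<in> face_boundary F (A j)" for e
    proof -
      have "w \<notin> e'" if "e' \<in> pre j" for e'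
        using that False path_edges_subset unfolding pre_def by blast
      then show ?thesis
        using joined_avoid[OF nU nU w(1,2), of "pre j" e] that A(3)[OF j] j by blast
    qed
    then show ?thesis using cycle_mapD(4)[OF map A(1)[OF j], of w g h] gh by blast
  next
    case True
    let ?A = "sym_diff (A j) {f}"
    have AF: "?A \<subseteq> F" using A(1)[OF j] f(1) by blast
    have "face_boundary F ?A = sym_diff (joined (c ! 0) (c ! j) (pre j)) (cycle_edges c)"
      using face_boundary_sym_diff[OF two A(1)[OF j], of "{f}"] face_boundary_single[OF two f(1)] f(1) A(3)[OF j] c(1)
      by simp
    also have "\<dots> = joined (c ! 0) (c ! j) (cycle_edges c - pre j)"
      using pre_E[of j] ccyc unfolding joined_def by blast
    finally have bA: "face_boundary F ?A = joined (c ! 0) (c ! j) (cycle_edges c - pre j)" .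
    have wc: "w \<noteq> c ! 0" "w \<noteq> c ! j" using w up_self[OF nU[of 0]] up_self[OF nU[OF j]] by auto
    have jl: "j < length c" using j lc by linarith
    have cs: "c = take j c @ c ! j # drop (Suc j) c" using jl by (simp add: id_take_nth_drop)
    have wd: "w \<notin> set (c ! j # drop (Suc j) c @ [c ! 0])"
    proof -
      have "w \<in> set (take j c)" using True wc(2) jl by (auto simp: take_Suc_conv_app_nth)
      moreover have "distinct (take j c @ c ! j # drop (Suc j) c)" using c(3) cs by simp
      ultimately show ?thesis using wc by auto
    qed
    have "cycle_edges c = pre j \<union> path_edges (c ! j # drop (Suc j) c @ [c ! 0])"
    proof -
      have "c @ [hd c] = take j c @ c ! j # (drop (Suc j) c @ [c ! 0])" using cs c0(1) by (metis append_Cons append_assoc)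
      then have "cycle_edges c = path_edges (take j c @ [c ! j]) \<union> path_edges (c ! j # (drop (Suc j) c @ [c ! 0]))"
        unfolding cycle_edges_def using path_edges_append by metis
      then show ?thesis using jl by (simp add: pre_def take_Suc_conv_app_nth)
    qed
    then have avoid: "w \<notin> e" if "e \<in> cycle_edges c - pre j" for e
      using that wd path_edges_subset[of e "c ! j # drop (Suc j) c @ [c ! 0]"] by auto
    have "w \<notin> e" if "e \<in> face_boundary F ?A" for e
      using joined_avoid[OF nU[of 0] nU[OF j] w avoid that[unfolded bA]] by simp
    then have "h \<in> ?A" using cycle_mapD(4)[OF map AF, of w g h] gh by blast
    then show ?thesis using gh by blast
  qed
  \<comment> \<open>The face \<open>f\<close> is exempt: the curve between \<open>c ! 0\<close> and
    \<open>c ! j\<close> may be drawn through it, and vertices on its boundary are sorted by their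
    other faces.\<close>
  define I where "I j = {w \<in> U - up (c ! 0) - up (c ! j). \<forall>h\<in>F. w \<in> set h \<longrightarrow> h \<noteq> f \<longrightarrow> h \<in> A j}" for j
  define J where "J j = {w \<in> U - up (c ! 0) - up (c ! j). \<forall>h\<in>F. w \<in> set h \<longrightarrow> h \<noteq> f \<longrightarrow> h \<notin> A j}" for j
  have IJ: "I j \<union> J j = U - up (c ! 0) - up (c ! j)" if j: "j \<le> ?m" for j
  proof
    show "U - up (c ! 0) - up (c ! j) \<subseteq> I j \<union> J j"
    proof
      fix w assume w: "w \<in> U - up (c ! 0) - up (c ! j)"
      then have w': "w \<notin> up (c ! 0)" "w \<notin> up (c ! j)" by blast+
      show "w \<in> I j \<union> J j"
      proof (cases "w \<in> J j")
        case False
        then obtain g where "g \<in> F" "w \<in> set g" "g \<noteq> f" "g \<in> A j" using w unfolding J_def by blast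
        then have "w \<in> I j" using uniform[OF j w'] w unfolding I_def by blast
        then show ?thesis by blast
      qed blast
    qed
  qed (auto simp: I_def J_def)
  have IJ0: "I j \<inter> J j = {}" for j
    using face_through_vertex[of _ f] unfolding I_def J_def by blast
  have IU: "I j \<subseteq> U" "J j \<subseteq> U" for j by (auto simp: I_def J_def)
  have cross: "{a, b} \<notin> E" if "a \<in> I j" "b \<in> J j" for a b j
  proof
    assume "{a, b} \<in> E"
    then obtain h where "h \<in> F" "h \<noteq> f" "{a, b} \<subseteq> set h" by (rule face_through_edge)
    then show False using that unfolding I_def J_def by blast
  qed
  have "enclosed (c ! 0) (c ! ?m) B \<subseteq> I ?m" unfolding enclosed_def I_def Am by blast
  then have "enclosed x y B \<subseteq> I ?m" using inside_sym(1) by simp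
  then have big: "k \<le> sum \<omega> (I ?m)" using sumU[OF _ IU(1)] xyB(2) by (meson le_trans)
  have "I 0 = {}" using face_through_vertex[of _ f] unfolding I_def A0 by blast
  then have small: "\<not> k \<le> sum \<omega> (I 0)" using k by simp
  \<comment> \<open>The sweep starts with the empty \<open>I 0\<close> and ends heavy. Just before
    the first heavy position the weight is below \<open>k\<close>; one step adds less than
    \<open>k\<close> enclosed by \<open>D i\<close> and less than \<open>k\<close> on the path left
    behind.\<close>
  define j where "j = (LEAST j. k \<le> sum \<omega> (I j))"
  have j: "k \<le> sum \<omega> (I j)" unfolding j_def using big by (rule LeastI)
  have jm: "j \<le> ?m" unfolding j_def using big by (rule Least_le)
  have "j \<noteq> 0" using j small by metis
  then obtain i where i: "j = Suc i" using not0_implies_Suc by blast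
  have im: "i < ?m" using jm i by simp
  have isum: "sum \<omega> (I i) < k"
    using not_less_Least[of i "\<lambda>j. k \<le> sum \<omega> (I j)"] i unfolding j_def by simp
  have Isub: "I j \<subseteq> (I i \<union> enclosed (c ! i) (c ! Suc i) (D i)) \<union> (up (c ! i) - {v})"
  proof
    fix w assume wI: "w \<in> I j"
    then have w: "w \<in> U" "w \<notin> up (c ! 0)" "w \<notin> up (c ! Suc i)" unfolding I_def i by blast+
    have "v \<in> up (c ! 0)" using root_in_up[OF nU[of 0]] by simp
    then have wv: "w \<noteq> v" using w by auto
    show "w \<in> (I i \<union> enclosed (c ! i) (c ! Suc i) (D i)) \<union> (up (c ! i) - {v})"
    proof (cases "w \<in> up (c ! i) \<or> w \<in> I i")
      case False
      then have wi: "w \<notin> up (c ! i)" "w \<in> J i" using IJ[of i] im w by auto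
      obtain g where g: "g \<in> F" "g \<noteq> f" "w \<in> set g" using face_through_vertex[OF w(1)] by metis
      then have "g \<in> A (Suc i)" "g \<notin> A i" using wI wi(2) unfolding I_def J_def i by blast+
      then have "g \<in> D i" using ASuc[OF im] by blast
      moreover have "ed i \<in> E" using edE(1)[OF im] cE by blast
      ultimately have "w \<in> enclosed (c ! i) (c ! Suc i) (D i)"
        using uniform_sides[OF nU nU _ D(1)[OF im] D(3)[OF im, unfolded ed_def] wi(1) w(3) g(1) _ g(3)] im w wi
        unfolding enclosed_def ed_def by auto
      then show ?thesis by blast
    qed (use wv in blast)
  qed
  have fin: "finite (I j)" "finite (J j)" "finite (enclosed x' y' D')" "finite (up (c ! 0) - {v})"
    for j x' y' D'
    using finU IU upU[OF nU[of 0]] by (blast, blast, auto simp: enclosed_def intro: finU)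
  have fin2: "finite (up (c ! l) - {v})" if "l \<le> ?m" for l using upU[OF nU[OF that]] finU by blast
  have "sum \<omega> (I j) \<le> sum \<omega> ((I i \<union> enclosed (c ! i) (c ! Suc i) (D i)) \<union> (up (c ! i) - {v}))"
    using Isub fin fin2[of i] im by (intro sum_mono2) auto
  also have "\<dots> \<le> sum \<omega> (I i) + sum \<omega> (enclosed (c ! i) (c ! Suc i) (D i)) + sum \<omega> (up (c ! i) - {v})"
    using sum_le_Un[of "I i \<union> enclosed (c ! i) (c ! Suc i) (D i)" "up (c ! i) - {v}" \<omega>]
      sum_le_Un[of "I i" "enclosed (c ! i) (c ! Suc i) (D i)" \<omega>] fin fin2[of i] im by force
  also have "\<dots> < 3 * k" using isum Dsmall[OF im] paths[OF nU[of i]] im by linarith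
  finally have I3: "sum \<omega> (I j) < 3 * k" .
  \<comment> \<open>Of the total \<open>6 * k\<close>, less than \<open>3 * k\<close> is in
    \<open>I j\<close> and less than \<open>k\<close> on each path, so at least \<open>k\<close>
    remains for \<open>J j\<close>.\<close>
  have "U - {v} \<subseteq> (I j \<union> J j) \<union> ((up (c ! 0) - {v}) \<union> (up (c ! j) - {v}))"
    using IJ[OF jm] by blast
  then have "sum \<omega> (U - {v}) \<le> sum \<omega> ((I j \<union> J j) \<union> ((up (c ! 0) - {v}) \<union> (up (c ! j) - {v})))"
    using fin fin2[OF jm] by (intro sum_mono2) auto
  also have "\<dots> \<le> (sum \<omega> (I j) + sum \<omega> (J j)) + (sum \<omega> (up (c ! 0) - {v}) + sum \<omega> (up (c ! j) - {v}))"
    using sum_le_Un[of "I j \<union> J j" "(up (c ! 0) - {v}) \<union> (up (c ! j) - {v})" \<omega>]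
      sum_le_Un[of "I j" "J j" \<omega>] sum_le_Un[of "up (c ! 0) - {v}" "up (c ! j) - {v}" \<omega>] fin fin2[OF jm] by force
  finally have "k \<le> sum \<omega> (J j)"
    using I3 paths[OF nU[of 0]] paths[OF nU[OF jm]] total by linarith
  moreover have "c ! 0 \<noteq> c ! j"
  proof -
    have "j < length c" "0 < length c" using jm lc by linarith+
    then show ?thesis using c(3) \<open>j \<noteq> 0\<close> nth_eq_iff_index_eq by metis
  qed
  ultimately show ?thesis
    using nU[of 0] nU[OF jm] IJ[OF jm] IJ0[of j] j cross[of _ j]
    by (intro that[of "c ! 0" "c ! j" "I j" "J j"]) auto
qed

end

section \<open>Planar graphs\<close>

lemma planar_drawing:
  assumes G: "simple_graph V E" and P: "planar V E"
  obtains pos img where "drawing V {{u, w} |u w. E u w} pos img"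
proof -
  let ?EE = "{{u, w} |u w. E u w}"
  obtain pos :: "'a \<Rightarrow> complex" and \<gamma> where inj: "inj_on pos V"
    and arc: "\<forall>u w. E u w \<longrightarrow> arc (\<gamma> u w) \<and> pathstart (\<gamma> u w) = pos u \<and> pathfinish (\<gamma> u w) = pos w
        \<and> path_image (\<gamma> u w) \<inter> pos ` V = {pos u, pos w}"
    and cross: "\<forall>u w x y. E u w \<longrightarrow> E x y \<longrightarrow> {u, w} \<noteq> {x, y} \<longrightarrow>
        path_image (\<gamma> u w) \<inter> path_image (\<gamma> x y) \<subseteq> pos ` ({u, w} \<inter> {x, y})"
    using P unfolding planar_def by (elim exE conjE) (rule that)
  have "\<forall>e\<in>?EE. \<exists>q. E (fst q) (snd q) \<and> e = {fst q, snd q}" by auto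
  from bchoice[OF this] obtain q where q: "\<forall>e\<in>?EE. E (fst (q e)) (snd (q e)) \<and> e = {fst (q e), snd (q e)}" ..
  define s t where "s e = fst (q e)" and "t e = snd (q e)" for e
  have st: "E (s e) (t e) \<and> e = {s e, t e}" if "e \<in> ?EE" for e
    using bspec[OF q that] unfolding s_def t_def .
  \<comment> \<open>The arcs from u to w and from w to u may differ, so one orientation is fixed per edge.\<close>
  define img where "img e = path_image (\<gamma> (s e) (t e))" for e
  show ?thesis
  proof (rule that, unfold_locales)
    show "finite V" using G unfolding simple_graph_def by blast
    show "inj_on pos V" by (rule inj)
    show "\<exists>u w. u \<in> V \<and> w \<in> V \<and> u \<noteq> w \<and> e = {u, w}" if "e \<in> ?EE" for e
    proof -
      have "E (s e) (t e)" "e = {s e, t e}" using st[OF that] by blast+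
      moreover then have "s e \<noteq> t e" "s e \<in> V" "t e \<in> V" using G unfolding simple_graph_def by metis+
      ultimately show ?thesis by blast
    qed
    show "arc_between (img {u, w}) (pos u) (pos w)" if uw: "{u, w} \<in> ?EE" for u w
    proof -
      let ?e = "{u, w}"
      have e: "E (s ?e) (t ?e)" "{u, w} = {s ?e, t ?e}" using st[OF uw] by blast+
      have a: "arc_between (img ?e) (pos (s ?e)) (pos (t ?e))"
        using arc e(1) unfolding arc_between_def img_def by blast
      consider "u = s ?e" "w = t ?e" | "u = t ?e" "w = s ?e" using e(2) by (metis doubleton_eq_iff)
      then show ?thesis
      proof cases
        case 1
        then show ?thesis using a by simp
      next
        case 2
        then show ?thesis using arc_between_commute[OF a] by simp
      qed
    qed
    show "img e \<inter> pos ` V = pos ` e" if "e \<in> ?EE" for e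
    proof -
      have e: "E (s e) (t e)" "e = {s e, t e}" using st[OF that] by blast+
      have "pos ` e = {pos (s e), pos (t e)}" using arg_cong[OF e(2), of "\<lambda>X. pos ` X"] by simp
      then show ?thesis using arc e(1) unfolding img_def by simp
    qed
    show "img e \<inter> img e' \<subseteq> pos ` (e \<inter> e')" if "e \<in> ?EE" "e' \<in> ?EE" "e \<noteq> e'" for e e'
    proof -
      have e: "E (s e) (t e)" "e = {s e, t e}" using st[OF that(1)] by blast+
      have e': "E (s e') (t e')" "e' = {s e', t e'}" using st[OF that(2)] by blast+
      have "{s e, t e} \<noteq> {s e', t e'}" using e(2) e'(2) that(3) by simp
      from cross[rule_format, OF e(1) e'(1) this] show ?thesis
        unfolding img_def using e(2) e'(2) by simp
    qed
  qed
qed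

lemma card_le_one_if: "(\<And>x y. x \<in> A \<Longrightarrow> y \<in> A \<Longrightarrow> x = y) \<Longrightarrow> card A \<le> Suc 0"
  by (cases "finite A") (auto simp: card_le_Suc0_iff_eq)

section \<open>A fire starting at a vertex of degree at most six\<close>

locale fire_graph = drawing V "{{u, w} |u w. E u w}" pos img
  for V :: "'a set" and E :: "'a \<Rightarrow> 'a \<Rightarrow> bool" and pos img +
  fixes v :: 'a
  assumes simple: "simple_graph V E" and v: "v \<in> V" and deg: "card {w. E v w} \<le> 6"
begin

abbreviation "EE \<equiv> {{u, w} |u w. E u w}"
abbreviation "N \<equiv> {w. E v w}"

lemma sym: "E u w \<Longrightarrow> E w u" and irrefl: "\<not> E u u" and inV: "E u w \<Longrightarrow> u \<in> V \<and> w \<in> V"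
  using simple unfolding simple_graph_def by blast+

lemma EE_iff: "{u, w} \<in> EE \<longleftrightarrow> E u w"
  using sym by (auto simp: doubleton_eq_iff)

lemma N_V: "N \<subseteq> V" "finite N" "v \<notin> N"
proof -
  show "N \<subseteq> V" using inV by blast
  then show "finite N" using finite_V by (rule finite_subset)
  show "v \<notin> N" using irrefl by simp
qed

text \<open>Without a cycle through v, the neighbours of v lie in different components of the rest,
  and protecting a single neighbour saves its component.\<close>

lemma num_saved_no_cycle:
  assumes no: "\<And>f. distinct f \<Longrightarrow> length f \<ge> 3 \<Longrightarrow> cycle_edges f \<subseteq> EE \<Longrightarrow> v \<notin> set f"
  shows "card V \<le> 6 * num_saved V E v + 1"
proof -
  let ?E = "{e \<in> EE. v \<notin> e}"
  define C where "C u = {w. (u, w) \<in> (adjacency ?E)\<^sup>*}" for u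
  \<comment> \<open>Levels need only be lower bounds for burning times; everything here is protected
    in the first step.\<close>
  define L where "L w = (if w = v then 0 else 1 :: nat)" for w
  have apart: "u = u'" if uu: "u \<in> N" "u' \<in> N" "(u, u') \<in> (adjacency ?E)\<^sup>*" for u u'
  proof (rule ccontr)
    assume "u \<noteq> u'"
    obtain ws where ws: "ws \<noteq> []" "distinct ws" "hd ws = u" "last ws = u'" "path_edges ws \<subseteq> ?E"
      by (rule rtrancl_adjacency_path[OF uu(3)])
    have l: "length ws \<ge> 2" using ws(1,3,4) \<open>u \<noteq> u'\<close> by (cases ws; cases "tl ws") auto
    have "v \<notin> set ws" using Union_path_edges[OF l] ws(5) by blast
    moreover have "cycle_edges (v # ws) \<subseteq> EE"
    proof -
      obtain zs where zs: "ws = u # zs" using ws(1,3) by (metis list.collapse)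
      have "cycle_edges (v # ws) = insert {u', v} (insert {v, u} (path_edges ws))"
        using ws(1,4) by (subst cycle_edges_insert) (simp_all add: zs)
      moreover have "{u', v} \<in> EE" "{v, u} \<in> EE" using uu(1,2) sym EE_iff by simp_all
      moreover have "path_edges ws \<subseteq> EE" by (rule order_trans[OF ws(5) Collect_restrict])
      ultimately show ?thesis by (simp only: insert_subset simp_thms)
    qed
    ultimately show False using no[of "v # ws"] ws(2) l by simp
  qed
  \<comment> \<open>For a neighbour \<open>u\<close>, this is its component without \<open>v\<close>
    together with all that the fire cannot reach. The value \<open>u = v\<close> protects nothing
    and serves a root without neighbours.\<close>
  define Q where "Q u = V - {v} - \<Union>(C ` (N - {u}))" for u
  have Q: "card (Q u) \<le> num_saved V E v" if u: "u = v \<or> u \<in> N" for u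
  proof (rule num_saved_levels[where L = L and S = "{u} - {v}"])
    show "L v = 0" "\<And>x y. E x y \<Longrightarrow> L y \<le> L x + 1" by (auto simp: L_def)
    show "{u} - {v} \<subseteq> V" using u N_V by auto
    show "\<And>s. s \<in> {u} - {v} \<Longrightarrow> 1 \<le> L s" by (auto simp: L_def)
    have c: "card {s \<in> {u} - {v}. L s = t} \<le> Suc 0" for t by (rule card_le_one_if) auto
    show "card {s \<in> {u} - {v}. L s = 1} \<le> 4" using c[of 1] by simp
    show "card {s \<in> {u} - {v}. L s = t} \<le> 3" for t using c[of t] by simp
    show "Q u \<subseteq> V" "v \<notin> Q u" by (auto simp: Q_def)
    show "x \<in> Q u" if w: "w \<in> Q u - ({u} - {v})" and xw: "E x w" for w x
    proof -
      have wQ: "w \<in> V" "w \<noteq> v" "w \<noteq> u" "\<And>u'. u' \<in> N \<Longrightarrow> u' \<noteq> u \<Longrightarrow> w \<notin> C u'"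
        using w by (auto simp: Q_def)
      have "x \<noteq> v"
      proof
        assume "x = v"
        then have "w \<in> N" using xw by simp
        moreover have "w \<in> C w" by (simp add: C_def)
        ultimately show False using wQ(3,4) by blast
      qed
      moreover have "x \<notin> C u'" if "u' \<in> N" "u' \<noteq> u" for u'
      proof
        assume "x \<in> C u'"
        moreover have "(x, w) \<in> adjacency ?E"
          using xw EE_iff \<open>x \<noteq> v\<close> wQ(2) by (simp add: adjacency_def)
        ultimately have "w \<in> C u'" unfolding C_def by (simp add: rtrancl_into_rtrancl)
        then show False using wQ(4) that by blast
      qed
      ultimately show ?thesis using inV[OF xw] by (auto simp: Q_def)
    qed
  qed (rule finite_V)
  have cV: "card V = Suc (card (V - {v}))" using v finite_V by (metis card.remove)
  show ?thesis
  proof (cases "N = {}")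
    case True
    then have "Q v = V - {v}" by (simp add: Q_def)
    then show ?thesis using Q[of v] cV by simp
  next
    case False
    then obtain u0 where u0: "u0 \<in> N" by blast
    have "V - {v} \<subseteq> \<Union>(Q ` N)"
    proof
      fix w assume w: "w \<in> V - {v}"
      show "w \<in> \<Union>(Q ` N)"
      proof (cases "w \<in> Q u0")
        case False
        then obtain u where u: "u \<in> N" "w \<in> C u" using w by (auto simp: Q_def)
        have "w \<notin> C u'" if u': "u' \<in> N" "u' \<noteq> u" for u'
        proof
          assume "w \<in> C u'"
          then have "(u', w) \<in> (adjacency ?E)\<^sup>*" by (simp only: C_def mem_Collect_eq)
          moreover have "(w, u) \<in> (adjacency ?E)\<^sup>*"
            by (rule adjacency_rtrancl_sym) (use u(2) in \<open>simp only: C_def mem_Collect_eq\<close>)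
          ultimately have "(u', u) \<in> (adjacency ?E)\<^sup>*" by (rule rtrancl_trans)
          then show False using apart[OF u'(1) u(1)] u'(2) by simp
        qed
        then have "w \<in> Q u" using w by (auto simp: Q_def)
        then show ?thesis using u(1) by blast
      qed (use u0 in blast)
    qed
    moreover have "finite (Q u)" for u using finite_V by (auto simp: Q_def)
    ultimately have "card (V - {v}) \<le> card (\<Union>(Q ` N))" using N_V(2) by (intro card_mono) auto
    also have "\<dots> \<le> (\<Sum>u\<in>N. card (Q u))" by (rule card_UN_le[OF N_V(2)])
    also have "\<dots> \<le> card N * num_saved V E v" using Q by (intro sum_bounded_above[where K = "num_saved V E v", simplified]) auto
    also have "\<dots> \<le> 6 * num_saved V E v" using deg by (intro mult_right_mono) auto
    finally show ?thesis using cV by simp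
  qed
qed

text \<open>If fewer than \<open>k\<close> vertices can be saved, everything that can be shielded is
  light, in particular root paths and the part hanging on \<open>v\<close>. The separator then gives
  two sides of weight at least \<open>k\<close>, each of which must contain three neighbours of
  \<open>v\<close>; with the one on the paths there are seven.\<close>

lemma num_saved_cycle:
  assumes f0: "distinct f0" "length f0 \<ge> 3" "cycle_edges f0 \<subseteq> EE" "v \<in> set f0"
    and k: "k \<ge> 1" "card V \<ge> 8 * k + 1"
  shows "k \<le> num_saved V E v"
proof (rule ccontr)
  assume few: "\<not> ?thesis"
  obtain H \<kappa> where H: "plane_map H" "cycle_edges f0 \<subseteq> H"
    and \<kappa>U: "\<And>u. u \<in> \<Union>H \<Longrightarrow> \<kappa> u = Some u" and \<kappa>_in: "\<And>u a. \<kappa> u = Some a \<Longrightarrow> a \<in> \<Union>H"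
    and \<kappa>_edge: "\<And>u w. {u, w} \<in> EE \<Longrightarrow> \<kappa> u = \<kappa> w \<or> {u, w} \<in> H"
    by (rule anchors[OF plane_cycle[OF f0(1-3)]]) blast
  obtain F where HE: "H \<subseteq> EE" and map: "cycle_map H F" using H(1) unfolding plane_map_def by auto
  let ?U = "\<Union>H"
  have "set f0 \<subseteq> ?U" using Union_cycle_edges[of f0] f0(2) H(2) by auto
  then have vU: "v \<in> ?U" using f0(4) by (rule subsetD)
  have UV: "?U \<subseteq> V" using HE edge_V by (meson Sup_least subsetD)
  have finU: "finite ?U" by (rule finite_subset[OF UV finite_V])
  have reach: "(v, w) \<in> (adjacency H)\<^sup>*" if "w \<in> ?U" for w by (rule cycle_mapD(6)[OF map vU that])
  have adjU: "adjacency H \<subseteq> ?U \<times> ?U" unfolding adjacency_def by blast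
  obtain L :: "'a \<Rightarrow> nat" and par where L: "L v = 0" "\<And>u w. (u, w) \<in> adjacency H \<Longrightarrow> L w \<le> L u + 1"
    "\<And>w. w \<in> ?U \<Longrightarrow> w \<noteq> v \<Longrightarrow> (par w, w) \<in> adjacency H \<and> L w = Suc (L (par w))"
    using breadth_first_levels[OF reach adjU] by blast
  interpret rooted_cycle_map H F v L par
    using map vU L by unfold_locales (simp_all add: adjacency_def)
  define X where "X a = {u \<in> V. \<kappa> u = Some a}" for a
  define M where "M = {u \<in> V. \<kappa> u = None}"
  \<comment> \<open>The weight of \<open>a\<close> counts all vertices anchored at \<open>a\<close>,
    including \<open>a\<close>, so that keeping the fire from \<open>a\<close> is credited with all
    that hangs on it.\<close>
  define \<omega> where "\<omega> a = card (X a)" for a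
  have finX: "finite (X a)" "finite M" for a using finite_V by (simp_all add: X_def M_def)
  have sum\<omega>: "sum \<omega> Z = card (\<Union>(X ` Z))" if "Z \<subseteq> ?U" for Z
    unfolding \<omega>_def using finite_subset[OF that finU] finX
    by (intro card_UN_disjoint[symmetric]) (auto simp: X_def)
  have HU: "\<kappa> u = Some u" "\<kappa> w = Some w" if "{u, w} \<in> H" for u w
    using \<kappa>U UnionI[OF that, of u] UnionI[OF that, of w] by simp_all
  \<comment> \<open>It is enough to shield \<open>Z\<close> inside \<open>H\<close>: an edge between
    different anchor classes is an edge of \<open>H\<close> joining the anchors, so the fire enters
    a class only through its anchor.\<close>
  have save: "sum \<omega> Z < k"
    if Z: "Z \<subseteq> ?U - {v}" "S \<subseteq> Z" "\<And>a b. a \<in> Z - S \<Longrightarrow> {b, a} \<in> H \<Longrightarrow> b \<in> Z"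
      and S: "card {s \<in> S. L s = 1} \<le> 4" "\<And>t. t \<ge> 2 \<Longrightarrow> card {s \<in> S. L s = t} \<le> 3" for Z S
  proof -
    \<comment> \<open>A vertex gets the level of its anchor, a lower bound for its burning time. The
      default 0 is consistent, since all neighbours of an unanchored vertex are unanchored.\<close>
    define l where "l w = (case \<kappa> w of Some a \<Rightarrow> L a | None \<Rightarrow> 0)" for w
    have lS: "l s = L s" if "s \<in> ?U" for s using \<kappa>U[OF that] by (simp add: l_def)
    have ZU: "Z \<subseteq> ?U" "S \<subseteq> ?U" using Z(1,2) by blast+
    have "card (\<Union>(X ` Z)) \<le> num_saved V E v"
    proof (rule num_saved_levels[OF finite_V, where L = l and S = S])
      show "l v = 0" using lS[OF vU] L(1) by simp
      show "l w \<le> l u + 1" if "E u w" for u w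
      proof -
        have "{u, w} \<in> EE" using that EE_iff by blast
        then consider "\<kappa> u = \<kappa> w" | "{u, w} \<in> H" using \<kappa>_edge by blast
        then show ?thesis
        proof cases
          case 2
          then show ?thesis using HU[OF 2] L_step[OF 2] by (simp add: l_def)
        qed (simp add: l_def)
      qed
      show "S \<subseteq> V" using ZU(2) UV by (rule order_trans)
      show "1 \<le> l s" if "s \<in> S" for s
      proof -
        have s: "s \<in> ?U" "s \<noteq> v" using that Z(1,2) by blast+
        then have "L s \<noteq> 0" using level_zero by blast
        then show ?thesis using lS[OF s(1)] by simp
      qed
      have "l s = L s" if "s \<in> S" for s by (rule lS[OF subsetD[OF ZU(2) that]])
      then have "{s \<in> S. l s = t} = {s \<in> S. L s = t}" for t by auto
      then show "card {s \<in> S. l s = 1} \<le> 4" "\<And>t. 2 \<le> t \<Longrightarrow> card {s \<in> S. l s = t} \<le> 3"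
        using S by simp_all
      show "\<Union>(X ` Z) \<subseteq> V" by (auto simp: X_def)
      show "v \<notin> \<Union>(X ` Z)" using Z(1) \<kappa>U[OF vU] by (auto simp: X_def)
      show "w \<in> \<Union>(X ` Z)" if u: "u \<in> \<Union>(X ` Z) - S" and wu: "E w u" for u w
      proof -
        obtain a where a: "a \<in> Z" "\<kappa> u = Some a" "u \<notin> S" using u by (auto simp: X_def)
        have wV: "w \<in> V" using inV[OF wu] by blast
        have "{w, u} \<in> EE" using wu EE_iff by blast
        then consider "\<kappa> w = \<kappa> u" | "{w, u} \<in> H" using \<kappa>_edge by blast
        then show ?thesis
        proof cases
          case 1
          then show ?thesis using a wV by (auto simp: X_def)
        next
          case 2
          then have "u = a" "\<kappa> w = Some w" using HU[OF 2] a(2) by simp_all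
          then have "w \<in> Z" using Z(3)[of u w] 2 a by simp
          then show ?thesis using wV \<open>\<kappa> w = Some w\<close> by (auto simp: X_def)
        qed
      qed
    qed
    then show ?thesis using few sum\<omega>[OF ZU(1)] by simp
  qed
  have up_card: "card {s \<in> up x - {v}. L s = t} \<le> Suc 0" if "x \<in> ?U" for x t
    using up_inj[OF that] by (intro card_le_one_if) auto
  have up_sub: "up x - {v} \<subseteq> ?U - {v}" if "x \<in> ?U" for x using up_level[OF that] by blast
  \<comment> \<open>The whole path can be protected, with at most one vertex due in each
    step.\<close>
  have paths: "sum \<omega> (up x - {v}) < k" if x: "x \<in> ?U" for x
  proof (rule save[OF up_sub[OF x], of "up x - {v}"])
    show "card {s \<in> up x - {v}. L s = 1} \<le> 4" using up_card[OF x, of 1] by simp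
    show "card {s \<in> up x - {v}. L s = t} \<le> 3" for t using up_card[OF x, of t] by simp
  qed auto
  \<comment> \<open>The two neighbours of \<open>v\<close> on the cycle \<open>f0\<close>. They
    leave at most four neighbours anchored at \<open>v\<close>, which is what the first step can
    protect.\<close>
  obtain y z where yz: "y \<noteq> z" "{v, y} \<in> H" "{v, z} \<in> H"
  proof -
    obtain ps qs where s: "f0 = ps @ v # qs" using split_list[OF f0(4)] by blast
    let ?g = "v # qs @ ps"
    have cg: "cycle_edges ?g = cycle_edges f0" using cycle_edges_rotate[of "v # qs" ps] s by simp
    have "length (qs @ ps) \<ge> 2" "distinct (qs @ ps)" using f0(1,2) s by auto
    then obtain y r where r: "qs @ ps = y # r" "r \<noteq> []" by (cases "qs @ ps"; cases "tl (qs @ ps)") auto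
    have g: "?g = v # y # r" using r(1) by simp
    have "cycle_edges ?g = insert {last r, v} (path_edges (v # y # r))"
      unfolding g using r(2) by (subst cycle_edges_insert) simp_all
    then have "{v, y} \<in> cycle_edges ?g" "{v, last r} \<in> cycle_edges ?g" by (simp_all add: insert_commute)
    moreover have "y \<noteq> last r" using \<open>distinct (qs @ ps)\<close> r by auto
    ultimately show ?thesis using that cg H(2) by blast
  qed
  have hang: "card ((X v - {v}) \<union> M) < k"
  proof -
    define l where "l w = (if w = v then 0 else 1 :: nat)" for w
    have yz': "y \<in> N" "z \<in> N" "\<kappa> y = Some y" "\<kappa> z = Some z"
      using yz(2,3) HE EE_iff HU[OF yz(2)] HU[OF yz(3)] by blast+
    then have "y \<noteq> v" "z \<noteq> v" using N_V(3) by blast+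
    then have "N \<inter> X v \<subseteq> N - {y, z}" using yz' by (auto simp: X_def)
    then have "card (N \<inter> X v) \<le> card (N - {y, z})" using N_V(2) by (intro card_mono) auto
    also have "\<dots> \<le> 4" using yz' yz(1) N_V(2) deg by (simp add: card_Diff_subset)
    finally have c: "card (N \<inter> X v) \<le> 4" .
    have "card ((X v - {v}) \<union> M) \<le> num_saved V E v"
    proof (rule num_saved_levels[OF finite_V, where L = l and S = "N \<inter> X v"])
      show "l v = 0" "\<And>x y. E x y \<Longrightarrow> l y \<le> l x + 1" by (auto simp: l_def)
      show "N \<inter> X v \<subseteq> V" using N_V by blast
      show "1 \<le> l s" if "s \<in> N \<inter> X v" for s using that N_V(3) by (auto simp: l_def)
      have "card {s \<in> N \<inter> X v. l s = 1} \<le> card (N \<inter> X v)" using N_V(2) by (intro card_mono) auto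
      then show "card {s \<in> N \<inter> X v. l s = 1} \<le> 4" using c by simp
      show "card {s \<in> N \<inter> X v. l s = t} \<le> 3" if "2 \<le> t" for t
      proof -
        have "{s \<in> N \<inter> X v. l s = t} = {}" using that by (auto simp: l_def)
        then show ?thesis by (simp only: card.empty)
      qed
      show "(X v - {v}) \<union> M \<subseteq> V" by (auto simp: X_def M_def)
      show "v \<notin> (X v - {v}) \<union> M" using \<kappa>U[OF vU] by (simp add: M_def)
      show "w \<in> (X v - {v}) \<union> M" if u: "u \<in> ((X v - {v}) \<union> M) - N \<inter> X v" and wu: "E w u" for u w
      proof -
        have u': "u \<noteq> v" "\<kappa> u = Some v \<or> \<kappa> u = None" "u \<in> V" "u \<notin> N \<inter> X v"
          using u \<kappa>U[OF vU] by (auto simp: X_def M_def)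
        have nH: "{w, u} \<notin> H" using HU(2)[of w u] u'(1,2) by auto
        have "{w, u} \<in> EE" using wu EE_iff by blast
        then have eq: "\<kappa> w = \<kappa> u" using \<kappa>_edge nH by blast
        have "w \<noteq> v"
        proof
          assume "w = v"
          then have "u \<in> N" "\<kappa> u = Some v" using wu eq \<kappa>U[OF vU] by auto
          then show False using u'(3,4) by (simp add: X_def)
        qed
        then show ?thesis using eq u'(2) inV[OF wu] by (auto simp: X_def M_def)
      qed
    qed
    then show ?thesis using few by simp
  qed
  \<comment> \<open>Besides \<open>v\<close>, the only vertices lost are those anchored at
    \<open>v\<close> and the unanchored ones, fewer than \<open>k\<close> altogether.\<close>
  have total: "6 * k \<le> sum \<omega> (?U - {v})"
  proof -
    have "V \<subseteq> \<Union>(X ` (?U - {v})) \<union> (((X v - {v}) \<union> M) \<union> {v})"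
    proof
      fix u assume u: "u \<in> V"
      show "u \<in> \<Union>(X ` (?U - {v})) \<union> (((X v - {v}) \<union> M) \<union> {v})"
      proof (cases "\<kappa> u")
        case None
        then show ?thesis using u by (simp add: M_def)
      next
        case (Some a)
        then have "u \<in> X a" using u by (simp add: X_def)
        then show ?thesis using \<kappa>_in[OF Some] by blast
      qed
    qed
    moreover have "finite (\<Union>(X ` (?U - {v})) \<union> (((X v - {v}) \<union> M) \<union> {v}))"
      using finU finX by (intro finite_UnI finite_UN_I) auto
    ultimately have "card V \<le> card (\<Union>(X ` (?U - {v})) \<union> (((X v - {v}) \<union> M) \<union> {v}))"
      by (intro card_mono)
    also have "\<dots> \<le> card (\<Union>(X ` (?U - {v}))) + (card ((X v - {v}) \<union> M) + 1)"
      using card_Un_le[of "\<Union>(X ` (?U - {v}))" "((X v - {v}) \<union> M) \<union> {v}"]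
        card_Un_le[of "(X v - {v}) \<union> M" "{v}"] by simp
    finally show ?thesis using hang k sum\<omega>[of "?U - {v}"] by auto
  qed
  obtain x y I J where xy: "x \<in> ?U" "y \<in> ?U" "x \<noteq> y" and IJ: "I \<union> J = ?U - up x - up y" "I \<inter> J = {}"
    and cross: "\<forall>a\<in>I. \<forall>b\<in>J. {a, b} \<notin> H" and big: "sum \<omega> I \<ge> k" "sum \<omega> J \<ge> k"
    by (rule balanced_root_paths[OF k(1) _ total]) (rule paths)
  have vx: "v \<in> up x" using root_in_up xy(1) by simp
  let ?P = "(up x - {v}) \<union> (up y - {v})"
  have PU: "?P \<subseteq> ?U - {v}" using up_sub[OF xy(1)] up_sub[OF xy(2)] by (rule Un_least)
  \<comment> \<open>A side with at most two neighbours of v is cut off by the two root paths and these neighbours.\<close>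
  have many: "card (N \<inter> K) > 2"
    if K: "K \<union> K' = ?U - up x - up y" "\<And>a b. a \<in> K \<Longrightarrow> b \<in> K' \<Longrightarrow> {a, b} \<notin> H" "sum \<omega> K \<ge> k" for K K'
  proof (rule ccontr)
    assume "\<not> ?thesis"
    then have c2: "card (N \<inter> K) \<le> 2" by simp
    have KU: "K \<subseteq> ?U - up x - up y" unfolding K(1)[symmetric] by blast
    \<comment> \<open>The neighbours in \<open>K\<close> are all due in the first step, where at
      most two of them join at most two path vertices; this meets the budget of four.\<close>
    have lev1: "L s = 1" if s: "s \<in> N \<inter> K" for s
    proof -
      have sU: "s \<in> ?U" "s \<noteq> v" using s KU vx by auto
      have vs: "{v, s} \<in> EE" unfolding EE_iff using s by simp
      have "\<kappa> v \<noteq> \<kappa> s" using \<kappa>U[OF vU] \<kappa>U[OF sU(1)] sU(2) by simp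
      then have "{v, s} \<in> H" using \<kappa>_edge[OF vs] by simp
      then have "L s \<le> 1" using L_step[of v s] L(1) by simp
      moreover have "L s \<noteq> 0" using level_zero[OF sU(1)] sU(2) by blast
      ultimately show ?thesis by simp
    qed
    have finS: "finite {s \<in> up x - {v}. L s = t}" "finite {s \<in> up y - {v}. L s = t}" "finite (N \<inter> K)" for t
      using finite_subset[OF up_sub[OF xy(1)]] finite_subset[OF up_sub[OF xy(2)]] finU N_V(2) by simp_all
    have cP: "card ({s \<in> up x - {v}. L s = t} \<union> {s \<in> up y - {v}. L s = t}) \<le> 2" for t
      using card_Un_le[of "{s \<in> up x - {v}. L s = t}" "{s \<in> up y - {v}. L s = t}"]
        up_card[OF xy(1), of t] up_card[OF xy(2), of t] by simp
    have "sum \<omega> (K \<union> ?P) < k"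
    proof (rule save[where S = "?P \<union> (N \<inter> K)"])
      show "K \<union> ?P \<subseteq> ?U - {v}" using KU PU vx by blast
      show "?P \<union> N \<inter> K \<subseteq> K \<union> ?P" by blast
      show "b \<in> K \<union> ?P" if ab: "a \<in> (K \<union> ?P) - (?P \<union> N \<inter> K)" "{b, a} \<in> H" for a b
      proof -
        have a: "a \<in> K" "a \<notin> N" using ab(1) by blast+
        have bU: "b \<in> ?U" using UnionI[OF ab(2)] by simp
        have "b \<noteq> v" using a(2) ab(2) HE EE_iff by blast
        moreover have "b \<notin> K'" using K(2)[OF a(1), of b] ab(2) by (auto simp: insert_commute)
        moreover have "b \<in> K \<union> K' \<or> b \<in> up x \<or> b \<in> up y" unfolding K(1) using bU by blast
        ultimately show ?thesis by blast
      qed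
      have "{s \<in> ?P \<union> N \<inter> K. L s = 1} \<subseteq> ({s \<in> up x - {v}. L s = 1} \<union> {s \<in> up y - {v}. L s = 1}) \<union> (N \<inter> K)"
        by blast
      then have "card {s \<in> ?P \<union> N \<inter> K. L s = 1} \<le> card (({s \<in> up x - {v}. L s = 1} \<union> {s \<in> up y - {v}. L s = 1}) \<union> (N \<inter> K))"
        using finS by (intro card_mono) simp_all
      also have "\<dots> \<le> 4"
        using card_Un_le[of "{s \<in> up x - {v}. L s = 1} \<union> {s \<in> up y - {v}. L s = 1}" "N \<inter> K"] cP[of 1] c2 by simp
      finally show "card {s \<in> ?P \<union> N \<inter> K. L s = 1} \<le> 4" .
      show "card {s \<in> ?P \<union> N \<inter> K. L s = t} \<le> 3" if t: "2 \<le> t" for t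
      proof -
        have "{s \<in> ?P \<union> N \<inter> K. L s = t} \<subseteq> {s \<in> up x - {v}. L s = t} \<union> {s \<in> up y - {v}. L s = t}"
          using lev1 t by auto
        then have "card {s \<in> ?P \<union> N \<inter> K. L s = t} \<le> card ({s \<in> up x - {v}. L s = t} \<union> {s \<in> up y - {v}. L s = t})"
          using finS by (intro card_mono) simp_all
        then show ?thesis using cP[of t] by simp
      qed
    qed
    moreover have "sum \<omega> K \<le> sum \<omega> (K \<union> ?P)"
    proof (rule sum_mono2)
      have "K \<union> ?P \<subseteq> ?U" using KU PU by blast
      then show "finite (K \<union> ?P)" using finU by (rule finite_subset)
    qed auto
    ultimately show False using K(3) by simp
  qed
  have "card (N \<inter> I) > 2" by (rule many[OF IJ(1) _ big(1)]) (use cross in blast)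
  moreover have "card (N \<inter> J) > 2"
  proof (rule many[OF _ _ big(2)])
    show "J \<union> I = ?U - up x - up y" using IJ(1) by (simp add: Un_commute)
    show "a \<in> J \<Longrightarrow> b \<in> I \<Longrightarrow> {a, b} \<notin> H" for a b using bspec[OF bspec[OF cross, of b], of a] by (simp add: insert_commute)
  qed
  moreover have "card (N \<inter> I) + card (N \<inter> J) < card N"
  proof -
    \<comment> \<open>The ends differ, so one of the paths leaves \<open>v\<close>, and its first
      vertex after \<open>v\<close> is a neighbour lying on neither side.\<close>
    have "x \<noteq> v \<or> y \<noteq> v" using xy(3) by blast
    then obtain u where u: "u \<in> up x \<union> up y" "{v, u} \<in> H"
      using up_level_one[OF xy(1)] up_level_one[OF xy(2)] by blast
    then have "u \<in> N" using HE EE_iff by blast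
    moreover have "u \<notin> I \<union> J" unfolding IJ(1) using u(1) by blast
    ultimately have "N \<inter> I \<union> N \<inter> J \<subset> N" by blast
    then have "card (N \<inter> I \<union> N \<inter> J) < card N" using N_V(2) by (intro psubset_card_mono)
    moreover have "card (N \<inter> I \<union> N \<inter> J) = card (N \<inter> I) + card (N \<inter> J)"
      using N_V(2) IJ(2) by (intro card_Un_disjoint) auto
    ultimately show ?thesis by simp
  qed
  ultimately show False using deg by simp
qed

lemma num_saved_low_degree:
  assumes "card V \<ge> 8 * k + 1" shows "k \<le> num_saved V E v"
proof (cases "k = 0")
  case False
  show ?thesis
  proof (cases "\<exists>f. distinct f \<and> length f \<ge> 3 \<and> cycle_edges f \<subseteq> EE \<and> v \<in> set f")
    case True
    then obtain f where f: "distinct f" "length f \<ge> 3" "cycle_edges f \<subseteq> EE" "v \<in> set f" by auto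
    show ?thesis by (rule num_saved_cycle[OF f _ assms]) (use False in simp)
  next
    case no: False
    have "card V \<le> 6 * num_saved V E v + 1" by (rule num_saved_no_cycle) (use no in blast)
    then show ?thesis using assms by linarith
  qed
qed simp

end

section \<open>Averaging over all starting vertices\<close>

lemma num_saved_pos:
  assumes "finite V" "card V \<ge> 2"
  shows "1 \<le> num_saved V E v"
proof -
  have "\<not> V \<subseteq> {v}" using assms card_mono[of "{v}" V] by auto
  then obtain u where u: "u \<in> V" "u \<noteq> v" by blast
  define L where "L w = (if w = v then 0 else 1 :: nat)" for w
  have c: "card {s \<in> {u}. L s = t} \<le> Suc 0" for t by (rule card_le_one_if) auto
  have "card {u} \<le> num_saved V E v"
  proof (rule num_saved_levels[OF assms(1), where L = L and S = "{u}"])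
    show "card {s \<in> {u}. L s = 1} \<le> 4" using c[of 1] by simp
    show "card {s \<in> {u}. L s = t} \<le> 3" for t using c[of t] by simp
  qed (use u in \<open>auto simp: L_def\<close>)
  then show ?thesis by simp
qed

text \<open>The degrees sum to at most \<open>6 * card V\<close>, so at most six sevenths of the
  vertices have degree seven or more.\<close>

lemma (in drawing) many_low_degree_vertices:
  "card V \<le> 7 * card {v \<in> V. card {e \<in> EE. v \<in> e} \<le> 6}"
proof (cases "V = {}")
  case False
  let ?d = "\<lambda>v. card {e \<in> EE. v \<in> e}" and ?W = "{v \<in> V. card {e \<in> EE. v \<in> e} \<le> 6}"
  have "card e = 2" if "e \<in> EE" for e using edges[OF that] by auto
  moreover have "{v \<in> V. v \<in> e} = e" if "e \<in> EE" for e using edge_V[OF that] by blast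
  ultimately have "sum ?d V = (\<Sum>e\<in>EE. 2)"
    by (intro sum_multicount_gen finite_V finite_EE) auto
  then have "sum ?d V = 2 * card EE" by simp
  moreover have "{e \<in> EE. e \<subseteq> V} = EE" using edge_V by blast
  then have "card EE + 3 \<le> 3 * card V" using edge_count[of V] False by simp
  ultimately have up: "sum ?d V \<le> 6 * card V" by simp
  have "7 * card (V - ?W) = (\<Sum>v\<in>V - ?W. 7)" by simp
  also have "\<dots> \<le> sum ?d (V - ?W)" by (rule sum_mono) auto
  also have "\<dots> \<le> sum ?d V" by (rule sum_mono2[OF finite_V]) auto
  finally have "7 * card (V - ?W) \<le> 6 * card V" using up by simp
  moreover have "card (V - ?W) = card V - card ?W" by (rule card_Diff_subset) (use finite_V in auto)
  moreover have "card ?W \<le> card V" using finite_V by (intro card_mono) auto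
  ultimately show ?thesis by linarith
qed simp

theorem theorem3:
  fixes V :: "'a set" and E :: "'a \<Rightarrow> 'a \<Rightarrow> bool"
  assumes "simple_graph V E" and "planar V E" and "card V \<ge> 2"
  shows "surviving_rate V E \<ge> 1 / 2712"
proof -
  let ?EE = "{{u, w} |u w. E u w}"
  obtain pos img where "drawing V ?EE pos img" by (rule planar_drawing[OF assms(1,2)])
  then interpret drawing V ?EE pos img .
  let ?n = "card V" and ?s = "\<lambda>v. num_saved V E v"
  have n0: "real ?n > 0" using assms(3) by simp
  \<comment> \<open>Up to 2712 vertices it suffices that one vertex can always be saved, which gives
    a rate of at least \<open>1 / ?n\<close>.\<close>
  have "real ?n ^ 2 \<le> 2712 * real (sum ?s V)"
  proof (cases "?n \<le> 2712")
    case True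
    have "?n = (\<Sum>v\<in>V. 1)" by simp
    also have "\<dots> \<le> sum ?s V" using num_saved_pos[OF finite_V assms(3)] by (intro sum_mono)
    finally have "real ?n \<le> real (sum ?s V)" by (rule of_nat_mono)
    moreover have "real ?n ^ 2 \<le> 2712 * real ?n"
      unfolding power2_eq_square using True by (intro mult_right_mono) auto
    ultimately show ?thesis by linarith
  next
    case False
    define W where "W = {v \<in> V. card {e \<in> ?EE. v \<in> e} \<le> 6}"
    \<comment> \<open>The largest \<open>k\<close> with \<open>8 * k + 1 \<le> ?n\<close>, whence
      also \<open>?n \<le> 8 * k + 8\<close>.\<close>
    define k where "k = (?n - 1) div 8"
    have k: "?n \<ge> 8 * k + 1" "8 * k + 8 \<ge> ?n" unfolding k_def using assms(3) by presburger+
    have ks: "k \<le> ?s v" if "v \<in> W" for v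
    proof -
      have "finite {e \<in> ?EE. v \<in> e}" by (rule finite_subset[OF Collect_restrict finite_EE])
      moreover have "(\<lambda>w. {v, w}) ` {w. E v w} \<subseteq> {e \<in> ?EE. v \<in> e}" by blast
      ultimately have "card ((\<lambda>w. {v, w}) ` {w. E v w}) \<le> card {e \<in> ?EE. v \<in> e}"
        by (rule card_mono)
      moreover have "inj_on (\<lambda>w. {v, w}) {w. E v w}" by (auto simp: inj_on_def doubleton_eq_iff)
      ultimately have "card {w. E v w} \<le> card {e \<in> ?EE. v \<in> e}" by (simp add: card_image)
      then interpret fire_graph V E pos img v
        using that assms(1) by unfold_locales (auto simp: W_def)
      show ?thesis using num_saved_low_degree k(1) by blast
    qed
    have "card W * k \<le> sum ?s W" using sum_mono[of W "\<lambda>_. k" ?s] ks by simp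
    also have "\<dots> \<le> sum ?s V" using finite_V by (intro sum_mono2) (auto simp: W_def)
    finally have s: "card W * k \<le> sum ?s V" .
    \<comment> \<open>A factor 7 comes from the share of low degrees and a factor 16 from
      \<open>8 * k + 8 \<le> 16 * k\<close>; their product is 112.\<close>
    have "?n \<le> 7 * card W" unfolding W_def by (rule many_low_degree_vertices)
    then have "?n * ?n \<le> (7 * card W) * (8 * k + 8)" using k(2) by (rule mult_le_mono)
    also have "\<dots> \<le> (7 * card W) * (16 * k)" using k False by (intro mult_le_mono) auto
    also have "\<dots> = 112 * (card W * k)" by simp
    also have "\<dots> \<le> 2712 * sum ?s V" using s by linarith
    finally have "real (?n * ?n) \<le> real (2712 * sum ?s V)" by (rule of_nat_mono)
    then show ?thesis by (simp add: power2_eq_square)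
  qed
  then have "1 / 2712 \<le> real (sum ?s V) / real ?n ^ 2" using n0 by (simp add: field_simps)
  then show ?thesis unfolding surviving_rate_def by simp
qed

end
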